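(* Within each of the 7-dimensional one-parameter families $123457I$, $12457N$, $12457N_2$, $1357M$ and $1357N$ of real nilpotent Lie algebras, all members, except for perhaps finitely many, have isomorphic cohomology algebras. That is, if $(\mathfrak{g}(\lambda))_\lambda$ is any one of these five families, there is a finite set $F$ of parameter values such that $\mathrm{H}^*(\mathfrak{g}(\lambda),\mathbb{R})\simeq\mathrm{H}^*(\mathfrak{g}(\lambda'),\mathbb{R})$ as graded $\mathbb{R}$-algebras for all parameter values $\lambda,\lambda'\notin F$.
   Context: For a real Lie algebra $\mathfrak{g}$, $\mathrm{H}^*(\mathfrak{g},\mathbb{R})$ is the Lie algebra (Chevalley–Eilenberg) cohomology with trivial coefficients, a graded $\mathbb{R}$-algebra under the cup (wedge) product. The families are those of M.-P. Gong's classification of 7-dimensional nilpotent Lie algebras. Each member has basis $x_1,\dots,x_7$ and a real parameter $\lambda$ ranging over $\mathbb{R}$ with possible finitely many exceptions; all brackets of basis elements not determined by those listed (by antisymmetry) are zero. $123457I$: $[x_1,x_i]=x_{i+1}$ for $2\le i\le 6$, $[x_2,x_3]=x_5$, $[x_2,x_4]=x_6$, $[x_2,x_5]=\lambda x_7$, $[x_3,x_4]=(1-\lambda)x_7$. $12457N$: $[x_1,x_2]=x_3$, $[x_1,x_3]=x_4$, $[x_1,x_4]=x_7$, $[x_1,x_5]=x_6$, $[x_1,x_6]=x_7$, $[x_2,x_3]=x_5$, $[x_2,x_4]=x_6$, $[x_2,x_5]=\lambda x_7$, $[x_2,x_6]=x_7$, $[x_3,x_4]=x_7$, $[x_3,x_5]=-x_7$.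 $12457N_2$: $[x_1,x_2]=x_3$, $[x_1,x_3]=x_4$, $[x_1,x_4]=-x_6$, $[x_1,x_5]=x_7$, $[x_1,x_6]=x_7$, $[x_2,x_3]=x_5$, $[x_2,x_4]=x_7$, $[x_2,x_5]=-x_6+\lambda x_7$, $[x_3,x_5]=-x_7$. $1357M$ ($\lambda\ne0$): $[x_1,x_2]=x_3$, $[x_1,x_i]=x_{i+2}$ for $i=3,4,5$, $[x_2,x_4]=x_5$, $[x_2,x_6]=\lambda x_7$, $[x_3,x_4]=(1-\lambda)x_7$. $1357N$: $[x_1,x_2]=x_3$, $[x_1,x_i]=x_{i+2}$ for $i=3,4,5$, $[x_2,x_3]=\lambda x_7$, $[x_2,x_4]=x_5$, $[x_3,x_4]=x_7$, $[x_4,x_6]=x_7$. *)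

theory Defs
  imports "HOL-Analysis.Analysis"
begin

definition lie_algebra :: "('v::real_vector \<Rightarrow> 'v \<Rightarrow> 'v) \<Rightarrow> bool" where
  "lie_algebra br \<longleftrightarrow>
     (\<forall>u. linear (br u)) \<and> (\<forall>v. linear (\<lambda>u. br u v)) \<and>
     (\<forall>u. br u u = 0) \<and>
     (\<forall>u v w. br u (br v w) + br v (br w u) + br w (br u v) = 0)"

text \<open>The Chevalley--Eilenberg complex with trivial coefficients. A \<open>p\<close>-cochain is an alternating \<open>p\<close>-linear form. Its argument tuple is a list; the form is
  set to zero on lists of any other length, so that equality of cochains is equality of functions.\<close>

definition cochains :: "nat \<Rightarrow> ('v::real_vector list \<Rightarrow> real) set" where
  "cochains p = {\<omega>.
     (\<forall>xs. length xs \<noteq> p \<longrightarrow> \<omega> xs = 0) \<and>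
     (\<forall>xs i. length xs = p \<longrightarrow> i < p \<longrightarrow> linear (\<lambda>v. \<omega> (xs[i := v]))) \<and>
     (\<forall>xs. length xs = p \<longrightarrow> \<not> distinct xs \<longrightarrow> \<omega> xs = 0)}"

text \<open>\<open>nths xs (- {i, j})\<close> is the tuple with its \<open>i\<close>-th and \<open>j\<close>-th entries omitted. Positions count
  from 0, which does not affect the sign. The degree is implicit: on a \<open>p\<close>-cochain only lists of
  length \<open>p + 1\<close> contribute.\<close>

definition coboundary ::
    "('v \<Rightarrow> 'v \<Rightarrow> 'v) \<Rightarrow> ('v list \<Rightarrow> real) \<Rightarrow> ('v list \<Rightarrow> real)" where
  "coboundary br \<omega> = (\<lambda>xs. \<Sum>j<length xs. \<Sum>i<j.
     (-1) ^ (i + j) * \<omega> (br (xs ! i) (xs ! j) # nths xs (- {i, j})))"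

text \<open>The exterior product as a sum over shuffles: for a \<open>p\<close>-cochain and a \<open>q\<close>-cochain, and
  \<open>length xs = p + q\<close>, only the sets \<open>I\<close> of size \<open>p\<close> contribute. They are the \<open>(p, q)\<close>-shuffles,
  whose sign is given by the number of inversions.\<close>

definition shuffle_sign :: "nat \<Rightarrow> nat set \<Rightarrow> real" where
  "shuffle_sign n I = (-1) ^ card {(i, j). i \<in> I \<and> j \<in> {..<n} - I \<and> j < i}"

definition wedge ::
    "('v list \<Rightarrow> real) \<Rightarrow> ('v list \<Rightarrow> real) \<Rightarrow> ('v list \<Rightarrow> real)" where
  "wedge \<omega> \<eta> = (\<lambda>xs. \<Sum>I\<in>Pow {..<length xs}.
     shuffle_sign (length xs) I * \<omega> (nths xs I) * \<eta> (nths xs (- I)))"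

definition cocycles :: "('v::real_vector \<Rightarrow> 'v \<Rightarrow> 'v) \<Rightarrow> nat \<Rightarrow> ('v list \<Rightarrow> real) set" where
  "cocycles br p = {\<omega> \<in> cochains p. coboundary br \<omega> = (\<lambda>_. 0)}"

definition coboundaries :: "('v::real_vector \<Rightarrow> 'v \<Rightarrow> 'v) \<Rightarrow> nat \<Rightarrow> ('v list \<Rightarrow> real) set" where
  "coboundaries br p =
     (case p of 0 \<Rightarrow> {\<lambda>_. 0} | Suc q \<Rightarrow> coboundary br ` cochains q)"

definition cohomologous ::
    "('v::real_vector \<Rightarrow> 'v \<Rightarrow> 'v) \<Rightarrow> nat \<Rightarrow> (('v list \<Rightarrow> real) \<times> ('v list \<Rightarrow> real)) set" where
  "cohomologous br p = {(\<omega>, \<eta>). \<omega> \<in> cocycles br p \<and> \<eta> \<in> cocycles br p \<and>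
     (\<lambda>xs. \<omega> xs - \<eta> xs) \<in> coboundaries br p}"

text \<open>A graded real algebra is given degree by degree. The operations carry the degrees of their
  arguments because the carriers of different degrees need not be disjoint as sets.\<close>

record 'a graded_algebra =
  component :: "nat \<Rightarrow> 'a set"
  gadd :: "nat \<Rightarrow> 'a \<Rightarrow> 'a \<Rightarrow> 'a"
  gscale :: "nat \<Rightarrow> real \<Rightarrow> 'a \<Rightarrow> 'a"
  gmult :: "nat \<Rightarrow> nat \<Rightarrow> 'a \<Rightarrow> 'a \<Rightarrow> 'a"
  gone :: "'a"

definition graded_algebra_isomorphic ::
    "'a graded_algebra \<Rightarrow> 'b graded_algebra \<Rightarrow> bool" where
  "graded_algebra_isomorphic A B \<longleftrightarrow> (\<exists>\<phi> :: nat \<Rightarrow> 'a \<Rightarrow> 'b.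
     (\<forall>p. bij_betw (\<phi> p) (component A p) (component B p)) \<and>
     (\<forall>p. \<forall>a\<in>component A p. \<forall>b\<in>component A p.
        \<phi> p (gadd A p a b) = gadd B p (\<phi> p a) (\<phi> p b)) \<and>
     (\<forall>p c. \<forall>a\<in>component A p. \<phi> p (gscale A p c a) = gscale B p c (\<phi> p a)) \<and>
     (\<forall>p q. \<forall>a\<in>component A p. \<forall>b\<in>component A q.
        \<phi> (p + q) (gmult A p q a b) = gmult B p q (\<phi> p a) (\<phi> q b)) \<and>
     \<phi> 0 (gone A) = gone B)"

definition cohomology ::
    "('v::real_vector \<Rightarrow> 'v \<Rightarrow> 'v) \<Rightarrow> ('v list \<Rightarrow> real) set graded_algebra" where
  "cohomology br = \<lparr>
     component = (\<lambda>p. cocycles br p // cohomologous br p),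
     gadd = (\<lambda>p a b. \<Union>\<omega>\<in>a. \<Union>\<eta>\<in>b. cohomologous br p `` {\<lambda>xs. \<omega> xs + \<eta> xs}),
     gscale = (\<lambda>p c a. \<Union>\<omega>\<in>a. cohomologous br p `` {\<lambda>xs. c * \<omega> xs}),
     gmult = (\<lambda>p q a b. \<Union>\<omega>\<in>a. \<Union>\<eta>\<in>b. cohomologous br (p + q) `` {wedge \<omega> \<eta>}),
     gone = cohomologous br 0 `` {\<lambda>xs. if xs = [] then 1 else 0}\<rparr>"

text \<open>An entry \<open>(i, j, k, c)\<close> contributes \<open>c x\<^sub>k\<close> to \<open>[x\<^sub>i, x\<^sub>j]\<close>, and \<open>- c x\<^sub>k\<close> to \<open>[x\<^sub>j, x\<^sub>i]\<close>.
  The five families are those of M.-P. Gong's classification (\<open>G12457N2\<close> is his \<open>12457N\<^sub>2\<close>).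
  The basis vector \<open>x\<^sub>i\<close> is \<open>axis i 1\<close>; in the index type \<open>7\<close> the numeral \<open>7\<close> is \<open>0\<close>, which is
  distinct from \<open>1, \<dots>, 6\<close>.\<close>

definition bracket_of_table :: "(7 \<times> 7 \<times> 7 \<times> real) list \<Rightarrow> real^7 \<Rightarrow> real^7 \<Rightarrow> real^7" where
  "bracket_of_table T u v =
     (\<Sum>(i, j, k, c)\<leftarrow>T. (c * (u $ i * v $ j - u $ j * v $ i)) *\<^sub>R axis k 1)"

datatype gong_family = G123457I | G12457N | G12457N2 | G1357M | G1357N

fun table :: "gong_family \<Rightarrow> real \<Rightarrow> (7 \<times> 7 \<times> 7 \<times> real) list" where
  "table G123457I l =
     [(1,2,3,1), (1,3,4,1), (1,4,5,1), (1,5,6,1), (1,6,7,1),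
      (2,3,5,1), (2,4,6,1), (2,5,7,l), (3,4,7,1 - l)]"
| "table G12457N l =
     [(1,2,3,1), (1,3,4,1), (1,4,7,1), (1,5,6,1), (1,6,7,1),
      (2,3,5,1), (2,4,6,1), (2,5,7,l), (2,6,7,1), (3,4,7,1), (3,5,7,-1)]"
| "table G12457N2 l =
     [(1,2,3,1), (1,3,4,1), (1,4,6,-1), (1,5,7,1), (1,6,7,1),
      (2,3,5,1), (2,4,7,1), (2,5,6,-1), (2,5,7,l), (3,5,7,-1)]"
| "table G1357M l =
     [(1,2,3,1), (1,3,5,1), (1,4,6,1), (1,5,7,1),
      (2,4,5,1), (2,6,7,l), (3,4,7,1 - l)]"
| "table G1357N l =
     [(1,2,3,1), (1,3,5,1), (1,4,6,1), (1,5,7,1),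
      (2,3,7,l), (2,4,5,1), (3,4,7,1), (4,6,7,1)]"

fun parameters :: "gong_family \<Rightarrow> real set" where
  "parameters G1357M = UNIV - {0}"
| "parameters _ = UNIV"

definition gong_bracket :: "gong_family \<Rightarrow> real \<Rightarrow> real^7 \<Rightarrow> real^7 \<Rightarrow> real^7" where
  "gong_bracket f l = bracket_of_table (table f l)"

lemma bracket_of_table_self: "bracket_of_table T u u = 0"
  unfolding bracket_of_table_def by (induction T) (auto simp: mult.commute)

lemma linear_bracket_of_table:
  "linear (bracket_of_table T u)" "linear (\<lambda>u. bracket_of_table T u v)"
proof -
  show "linear (bracket_of_table T u)"
  proof (rule linearI)
    show "bracket_of_table T u (x + y) = bracket_of_table T u x + bracket_of_table T u y" for x y
      unfolding bracket_of_table_def by (induction T) (auto simp: algebra_simps)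
    show "bracket_of_table T u (r *\<^sub>R x) = r *\<^sub>R bracket_of_table T u x" for r x
      unfolding bracket_of_table_def by (induction T) (auto simp: algebra_simps)
  qed
  show "linear (\<lambda>u. bracket_of_table T u v)"
  proof (rule linearI)
    show "bracket_of_table T (x + y) v = bracket_of_table T x v + bracket_of_table T y v" for x y
      unfolding bracket_of_table_def by (induction T) (auto simp: algebra_simps)
    show "bracket_of_table T (r *\<^sub>R x) v = r *\<^sub>R bracket_of_table T x v" for r x
      unfolding bracket_of_table_def by (induction T) (auto simp: algebra_simps)
  qed
qed

lemma lie_algebra_gong_bracket: "lie_algebra (gong_bracket f l)"
proof -
  have "bracket_of_table (table f l) u (bracket_of_table (table f l) v w)
      + bracket_of_table (table f l) v (bracket_of_table (table f l) w u)
      + bracket_of_table (table f l) w (bracket_of_table (table f l) u v) = 0" for u v w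
    by (cases f; simp add: bracket_of_table_def axis_def vec_eq_iff)
      (auto simp: algebra_simps)
  then show ?thesis
    unfolding lie_algebra_def gong_bracket_def
    by (auto simp: bracket_of_table_self linear_bracket_of_table)
qed

end

theory Submission
  imports Defs
begin

text \<open>Write \<open>H\<close> for the cohomology of a member of one of the families and \<open>\<integral>\<close> for the coefficient of the
volume form. Nilpotent Lie algebras are unimodular, so \<open>\<integral>\<close> vanishes on exact forms and the exterior
product pairs \<open>H\<^sup>p\<close> perfectly with \<open>H\<close> in degree \<open>7 - p\<close>. Hence the graded algebra \<open>H\<close> is determined by
\<open>H\<^sup>1\<close>, \<open>H\<^sup>2\<close> and \<open>H\<^sup>3\<close>, the products among them that stay in degree at most 3, and the trilinear form
\<open>\<integral> a b c\<close> in degrees \<open>(1, 3, 3)\<close> and \<open>(2, 2, 3)\<close>; the trilinear form matters only up to a factor,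
because the volume form may be rescaled. In each family there are bases of \<open>H\<^sup>1\<close>, \<open>H\<^sup>2\<close>, \<open>H\<^sup>3\<close>,
represented by cocycles that are polynomial in the parameter, for which these finitely many structure
constants do not depend on the parameter. They are bases as long as finitely many polynomials do not
vanish at the parameter. Matching the bases at two such parameters gives the isomorphism.

In general the isomorphism cannot come from a multiplicative map of cochain complexes: these are minimal
models, so such a map would make the two Lie algebras isomorphic. It is constructed as a
correspondence between cocycles
(\<open>isomorphic_if_correspondence\<close>) which compares coordinates in degrees at most 3 and pairings in degrees
at least 4 (\<open>isomorphic_if_matched\<close>). That classes span is witnessed by a homotopy identity
\<open>z = \<Sum> \<pi>\<^sub>i(z) w\<^sub>i + d h z + k d z\<close>, in which \<open>w\<^sub>i\<close> are the basis cocycles, \<open>\<pi>\<^sub>i\<close> their coordinate functionals,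
and \<open>h\<close> and \<open>k\<close> are linear. The same identity gives Poincare duality explicitly
(\<open>coboundary_of_orthogonal\<close>, \<open>dual_cocycle\<close>). After clearing denominators it is an identity between
forms with integer polynomial coefficients, to be checked on monomials, and the structure constants
become ratios of such polynomials. Both are computations on lists, whose soundness is
\<open>isomorphic_if_certificate\<close>; the data for the five families are at the end.

The exterior calculus needed for this (graded commutativity, associativity, the Leibniz rule) is derived
from two recursions on the first argument, \<open>wedge_Cons\<close> and \<open>coboundary_Cons\<close>, which replace the sums
over shuffles and over pairs of arguments.\<close>

section \<open>Alternating forms and their contractions\<close>

text \<open>The alternating property is split by the number of arguments because the closure
  properties below are proved by induction on it.\<close>

definition alternating_at :: "nat \<Rightarrow> ('v::real_vector list \<Rightarrow> real) \<Rightarrow> bool" where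
  "alternating_at n \<omega> \<longleftrightarrow>
     (\<forall>xs i. length xs = n \<longrightarrow> i < n \<longrightarrow> linear (\<lambda>v. \<omega> (xs[i := v]))) \<and>
     (\<forall>xs. length xs = n \<longrightarrow> \<not> distinct xs \<longrightarrow> \<omega> xs = 0)"

definition alternating :: "('v::real_vector list \<Rightarrow> real) \<Rightarrow> bool" where
  "alternating \<omega> \<longleftrightarrow> (\<forall>n. alternating_at n \<omega>)"

lemma linear_zero_fun: "linear (\<lambda>v. 0)"
  by (rule linearI) auto

lemma cochains_iff:
  "\<omega> \<in> cochains p \<longleftrightarrow> alternating \<omega> \<and> (\<forall>xs. length xs \<noteq> p \<longrightarrow> \<omega> xs = 0)"
proof
  assume w: "\<omega> \<in> cochains p"
  have "alternating_at n \<omega>" for n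
    by (cases "n = p") (use w in \<open>auto simp: alternating_at_def cochains_def linear_zero_fun\<close>)
  with w show "alternating \<omega> \<and> (\<forall>xs. length xs \<noteq> p \<longrightarrow> \<omega> xs = 0)"
    by (auto simp: alternating_def cochains_def)
next
  assume "alternating \<omega> \<and> (\<forall>xs. length xs \<noteq> p \<longrightarrow> \<omega> xs = 0)"
  then show "\<omega> \<in> cochains p"
    by (auto simp: alternating_def alternating_at_def cochains_def)
qed

definition contract :: "'v \<Rightarrow> ('v list \<Rightarrow> real) \<Rightarrow> 'v list \<Rightarrow> real" where
  "contract x \<omega> = (\<lambda>ys. \<omega> (x # ys))"

text \<open>The grade involution. With it the rules for contractions hold for inhomogeneous forms,
  and inductions need not keep track of degrees.\<close>

definition parity :: "('v list \<Rightarrow> real) \<Rightarrow> 'v list \<Rightarrow> real" where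
  "parity \<omega> = (\<lambda>xs. (- 1) ^ length xs * \<omega> xs)"

lemma contract_apply: "contract x \<omega> ys = \<omega> (x # ys)"
  by (simp add: contract_def)

lemma linear_head: "alternating_at (Suc n) \<omega> \<Longrightarrow> length ys = n \<Longrightarrow> linear (\<lambda>x. \<omega> (x # ys))"
  unfolding alternating_at_def by (auto dest!: spec[of _ "undefined # ys"] spec[of _ 0])

lemma swap_head:
  fixes \<omega> :: "'v::real_vector list \<Rightarrow> real"
  assumes lin: "\<And>x. linear (\<lambda>y. \<omega> (x # y # zs))" "\<And>y. linear (\<lambda>x. \<omega> (x # y # zs))"
    and eq: "\<And>x. \<omega> (x # x # zs) = 0"
  shows "\<omega> (x # y # zs) = - \<omega> (y # x # zs)"
proof -
  have "\<omega> ((x + y) # (x + y) # zs) = \<omega> (x # (x + y) # zs) + \<omega> (y # (x + y) # zs)"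
    using linear_add[OF lin(2)[of "x + y"]] by simp
  also have "\<dots> = \<omega> (x # y # zs) + \<omega> (y # x # zs)"
    using linear_add[OF lin(1)[of x]] linear_add[OF lin(1)[of y]] by (simp add: eq)
  finally have "\<omega> (x # y # zs) + \<omega> (y # x # zs) = 0" using eq[of "x + y"] by simp
  then show ?thesis by linarith
qed

lemma alternating_at_0: "alternating_at 0 \<omega>"
  by (simp add: alternating_at_def)

lemma alternating_at_contract:
  assumes "alternating_at (Suc n) \<omega>" shows "alternating_at n (contract x \<omega>)"
  unfolding alternating_at_def contract_def
proof (intro conjI allI impI)
  fix xs :: "'a list" and i assume "length xs = n" "i < n"
  then have "linear (\<lambda>v. \<omega> ((x # xs)[Suc i := v]))"
    using assms unfolding alternating_at_def by (auto simp del: list_update.simps)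
  then show "linear (\<lambda>v. \<omega> (x # xs[i := v]))" by simp
next
  fix xs :: "'a list" assume "length xs = n" "\<not> distinct xs"
  then show "\<omega> (x # xs) = 0"
    using assms unfolding alternating_at_def by auto
qed

text \<open>If the first argument is repeated further on, a swap of the first two arguments turns the
  repetition into one that a contraction sees.\<close>

lemma alternating_at_SucI:
  assumes lin: "\<And>ys. length ys = n \<Longrightarrow> linear (\<lambda>x. \<omega> (x # ys))"
    and alt: "\<And>x. alternating_at n (contract x \<omega>)"
    and rep: "\<And>x zs. Suc (length zs) = n \<Longrightarrow> \<omega> (x # x # zs) = 0"
  shows "alternating_at (Suc n) \<omega>"
  unfolding alternating_at_def
proof (intro conjI allI impI)
  fix xs :: "'a list" and i assume l: "length xs = Suc n" "i < Suc n"
  then obtain x ys where xs: "xs = x # ys" "length ys = n" by (cases xs) auto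
  show "linear (\<lambda>v. \<omega> (xs[i := v]))"
  proof (cases i)
    case 0 then show ?thesis using lin xs by simp
  next
    case (Suc k)
    then have "linear (\<lambda>v. contract x \<omega> (ys[k := v]))"
      using alt[of x] l xs unfolding alternating_at_def by auto
    then show ?thesis using Suc xs by (simp add: contract_def)
  qed
next
  fix xs :: "'a list" assume l: "length xs = Suc n" "\<not> distinct xs"
  then obtain x ys where xs: "xs = x # ys" "length ys = n" by (cases xs) auto
  show "\<omega> xs = 0"
  proof (cases "distinct ys")
    case False
    then have "contract x \<omega> ys = 0" using alt[of x] xs unfolding alternating_at_def by auto
    then show ?thesis using xs by (simp add: contract_def)
  next
    case True
    then have "x \<in> set ys" using l xs by auto
    then obtain us vs where ys: "ys = us @ x # vs" by (auto simp: in_set_conv_decomp)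
    show ?thesis
    proof (cases us)
      case Nil then show ?thesis using rep[of vs x] xs ys by simp
    next
      case (Cons u us')
      let ?zs = "us' @ x # vs"
      have len: "Suc (length ?zs) = n" using xs ys Cons by simp
      have "\<omega> (x # u # ?zs) = - \<omega> (u # x # ?zs)"
      proof (rule swap_head)
        fix z show "linear (\<lambda>y. \<omega> (z # y # ?zs))"
          using linear_head[of "length ?zs" "contract z \<omega>" ?zs] alt[of z] len
          by (simp add: contract_def)
        show "linear (\<lambda>y. \<omega> (y # z # ?zs))" using lin[of "z # ?zs"] len by simp
        show "\<omega> (z # z # ?zs) = 0" using rep[of ?zs z] len by simp
      qed
      also have "\<omega> (u # x # ?zs) = contract u \<omega> (x # ?zs)" by (simp add: contract_def)
      also have "\<dots> = 0"
        using alt[of u] len unfolding alternating_at_def by auto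
      finally show ?thesis using xs ys Cons by simp
    qed
  qed
qed

lemma alternating_contract: "alternating \<omega> \<Longrightarrow> alternating (contract x \<omega>)"
  by (simp add: alternating_def alternating_at_contract)

lemma alternating_linear_head: "alternating \<omega> \<Longrightarrow> linear (\<lambda>x. \<omega> (x # ys))"
  unfolding alternating_def using linear_head[of "length ys" \<omega> ys] by simp

lemma alternating_repeat: "alternating \<omega> \<Longrightarrow> \<not> distinct xs \<Longrightarrow> \<omega> xs = 0"
  unfolding alternating_def alternating_at_def by blast

lemma alternating_swap:
  assumes "alternating \<omega>" shows "\<omega> (x # y # zs) = - \<omega> (y # x # zs)"
proof (rule swap_head)
  fix z show "linear (\<lambda>y. \<omega> (z # y # zs))"
    using alternating_linear_head[OF alternating_contract[OF assms, of z]] by (simp add: contract_def)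
  show "linear (\<lambda>y. \<omega> (y # z # zs))" by (rule alternating_linear_head[OF assms])
  show "\<omega> (z # z # zs) = 0" by (rule alternating_repeat[OF assms]) simp
qed

lemma linear_fun_add: "linear f \<Longrightarrow> linear g \<Longrightarrow> linear (\<lambda>x. f x + g x :: real)"
  by (rule linear_compose_add)

lemma linear_fun_cmul: "linear f \<Longrightarrow> linear (\<lambda>x. c * f x :: real)"
  using linear_compose_scale_right[of f c] by simp

lemma linear_fun_mult: "linear f \<Longrightarrow> linear (\<lambda>x. f x * c :: real)"
  using linear_fun_cmul[of f c] by (simp add: mult.commute)

lemma alternating_at_add:
  "alternating_at n \<omega> \<Longrightarrow> alternating_at n \<eta> \<Longrightarrow> alternating_at n (\<lambda>xs. \<omega> xs + \<eta> xs)"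
  unfolding alternating_at_def by (auto intro: linear_fun_add)

lemma alternating_at_cmul: "alternating_at n \<omega> \<Longrightarrow> alternating_at n (\<lambda>xs. c * \<omega> xs)"
  unfolding alternating_at_def by (auto intro: linear_fun_cmul)

lemma alternating_add: "alternating \<omega> \<Longrightarrow> alternating \<eta> \<Longrightarrow> alternating (\<lambda>xs. \<omega> xs + \<eta> xs)"
  by (simp add: alternating_def alternating_at_add)

lemma alternating_cmul: "alternating \<omega> \<Longrightarrow> alternating (\<lambda>xs. c * \<omega> xs)"
  by (simp add: alternating_def alternating_at_cmul)

lemma alternating_parity:
  assumes "alternating \<omega>" shows "alternating (parity \<omega>)"
  unfolding alternating_def
proof
  fix n
  have "alternating_at n (\<lambda>xs. (- 1) ^ n * \<omega> xs)"
    using assms alternating_at_cmul unfolding alternating_def by blast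
  then show "alternating_at n (parity \<omega>)"
    by (simp add: alternating_at_def parity_def)
qed

lemma minus_one_power_cancel: "(- 1) ^ n * ((- 1) ^ n * x) = (x :: real)"
  by (simp flip: mult.assoc power_mult_distrib)

lemma parity_parity: "parity (parity \<omega>) = \<omega>"
  by (simp add: parity_def minus_one_power_cancel)

lemma parity_Nil: "parity \<omega> [] = \<omega> []"
  by (simp add: parity_def)

lemma parity_Cons: "parity \<omega> (x # ys) = - parity (contract x \<omega>) ys"
  by (simp add: parity_def contract_def)

lemma contract_parity: "contract x (parity \<omega>) = (\<lambda>ys. - parity (contract x \<omega>) ys)"
  by (simp add: parity_def contract_def)

lemma parity_add: "parity (\<lambda>xs. \<omega> xs + \<eta> xs) = (\<lambda>xs. parity \<omega> xs + parity \<eta> xs)"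
  by (simp add: parity_def distrib_left)

lemma parity_cochain: "\<omega> \<in> cochains p \<Longrightarrow> parity \<omega> = (\<lambda>xs. (- 1) ^ p * \<omega> xs)"
  by (force simp: parity_def cochains_def)

section \<open>The exterior product\<close>

lemma shuffle_sign_insert_0:
  "shuffle_sign (Suc n) (insert 0 (Suc ` I)) = shuffle_sign n I"
proof -
  have "{(i, j). i \<in> insert 0 (Suc ` I) \<and> j \<in> {..<Suc n} - insert 0 (Suc ` I) \<and> j < i} =
    (\<lambda>(i, j). (Suc i, Suc j)) ` {(i, j). i \<in> I \<and> j \<in> {..<n} - I \<and> j < i}" (is "?L = ?g ` ?R")
  proof (intro set_eqI iffI)
    fix z assume "z \<in> ?L"
    then obtain i j where z: "z = (i, j)" "i \<in> insert 0 (Suc ` I)" "j < Suc n"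
      "j \<notin> insert 0 (Suc ` I)" "j < i" by auto
    then obtain i' j' where "i = Suc i'" "j = Suc j'" by (cases i; cases j) auto
    with z show "z \<in> ?g ` ?R" by (auto intro!: image_eqI[of _ _ "(i', j')"])
  qed auto
  moreover have "inj_on ?g ?R" by (auto simp: inj_on_def)
  ultimately have "card ?L = card ?R" by (simp only: card_image)
  then show ?thesis unfolding shuffle_sign_def by (rule arg_cong)
qed

lemma shuffle_sign_Suc:
  assumes "I \<subseteq> {..<n}"
  shows "shuffle_sign (Suc n) (Suc ` I) = (- 1) ^ card I * shuffle_sign n I"
proof -
  let ?R = "{(i, j). i \<in> I \<and> j \<in> {..<n} - I \<and> j < i}"
  let ?g = "\<lambda>(i, j). (Suc i, Suc j)" and ?h = "\<lambda>i. (Suc i, 0 :: nat)"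
  have fin: "finite I" using assms finite_subset by blast
  have finR: "finite ?R" by (rule finite_subset[of _ "I \<times> {..<n}"]) (use fin in auto)
  have "{(i, j). i \<in> Suc ` I \<and> j \<in> {..<Suc n} - Suc ` I \<and> j < i} = ?h ` I \<union> ?g ` ?R"
    (is "?L = _")
  proof (intro set_eqI iffI)
    fix z assume "z \<in> ?L"
    then obtain i j where z: "z = (Suc i, j)" "i \<in> I" "j < Suc n" "j \<notin> Suc ` I" "j < Suc i"
      by auto
    then show "z \<in> ?h ` I \<union> ?g ` ?R"
      by (cases j) (auto intro!: image_eqI[of _ _ "(i, j - 1)"])
  qed auto
  moreover have "card (?h ` I \<union> ?g ` ?R) = card I + card ?R"
  proof (subst card_Un_disjoint)
    show "card (?h ` I) + card (?g ` ?R) = card I + card ?R"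
      by (intro arg_cong2[of _ _ _ _ "(+)"] card_image) (auto simp: inj_on_def)
  qed (use fin finR in auto)
  ultimately show ?thesis unfolding shuffle_sign_def by (simp add: power_add)
qed

lemma Pow_lessThan_Suc:
  "Pow {..<Suc n} = (`) Suc ` Pow {..<n} \<union> (\<lambda>I. insert 0 (Suc ` I)) ` Pow {..<n}"
proof -
  have "Pow {..<Suc n} = Pow (Suc ` {..<n}) \<union> insert 0 ` Pow (Suc ` {..<n})"
    by (simp only: lessThan_Suc_eq_insert_0 Pow_insert)
  also have "Pow (Suc ` {..<n}) = (`) Suc ` Pow {..<n}"
    by (metis image_Pow_surj)
  finally show ?thesis by (simp add: image_image)
qed

lemma wedge_Nil: "wedge \<omega> \<eta> [] = \<omega> [] * \<eta> []"
  by (simp add: wedge_def shuffle_sign_def)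

text \<open>Contraction is an antiderivation. A shuffle sends the first argument either to the first
  factor, at no cost, or to the second one, past all arguments of the first factor.\<close>

lemma wedge_Cons:
  "wedge \<omega> \<eta> (x # ys) = wedge (contract x \<omega>) \<eta> ys + wedge (parity \<omega>) (contract x \<eta>) ys"
proof -
  let ?n = "length ys"
  let ?f = "\<lambda>I. shuffle_sign (Suc ?n) I * \<omega> (nths (x # ys) I) * \<eta> (nths (x # ys) (- I))"
  have "wedge \<omega> \<eta> (x # ys) = (\<Sum>I\<in>Pow {..<Suc ?n}. ?f I)" by (simp add: wedge_def)
  also have "\<dots> = (\<Sum>I\<in>(`) Suc ` Pow {..<?n}. ?f I) + (\<Sum>I\<in>(\<lambda>I. insert 0 (Suc ` I)) ` Pow {..<?n}. ?f I)"
    unfolding Pow_lessThan_Suc by (rule sum.union_disjoint) auto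
  also have "(\<Sum>I\<in>(`) Suc ` Pow {..<?n}. ?f I) = (\<Sum>I\<in>Pow {..<?n}. ?f (Suc ` I))"
    by (rule sum.reindex_cong[OF _ refl refl]) (auto simp: inj_on_def)
  also have "(\<Sum>I\<in>(\<lambda>I. insert 0 (Suc ` I)) ` Pow {..<?n}. ?f I) =
      (\<Sum>I\<in>Pow {..<?n}. ?f (insert 0 (Suc ` I)))"
  proof (rule sum.reindex_cong[OF _ refl refl])
    show "inj_on (\<lambda>I. insert 0 (Suc ` I)) (Pow {..<?n})"
    proof (rule inj_onI)
      fix I J assume "insert 0 (Suc ` I) = insert 0 (Suc ` J)"
      then have "Suc ` I = Suc ` J" by (auto dest!: insert_ident[THEN iffD1, rotated 2])
      then show "I = J" by (simp add: inj_image_eq_iff)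
    qed
  qed
  also have "(\<Sum>I\<in>Pow {..<?n}. ?f (insert 0 (Suc ` I))) = wedge (contract x \<omega>) \<eta> ys"
    unfolding wedge_def
  proof (rule sum.cong[OF refl])
    fix I assume "I \<in> Pow {..<?n}"
    have "{j. Suc j \<in> insert 0 (Suc ` I)} = I" "{j. Suc j \<in> - insert 0 (Suc ` I)} = - I" by auto
    then show "?f (insert 0 (Suc ` I)) =
        shuffle_sign ?n I * contract x \<omega> (nths ys I) * \<eta> (nths ys (- I))"
      by (simp add: nths_Cons shuffle_sign_insert_0 contract_def)
  qed
  also have "(\<Sum>I\<in>Pow {..<?n}. ?f (Suc ` I)) = wedge (parity \<omega>) (contract x \<eta>) ys"
    unfolding wedge_def
  proof (rule sum.cong[OF refl])
    fix I assume I: "I \<in> Pow {..<?n}"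
    have "{j. Suc j \<in> Suc ` I} = I" "{j. Suc j \<in> - Suc ` I} = - I" by auto
    moreover have "length (nths ys I) = card I"
      using I by (auto simp: length_nths intro!: arg_cong[of _ _ card])
    ultimately show "?f (Suc ` I) =
        shuffle_sign ?n I * parity \<omega> (nths ys I) * contract x \<eta> (nths ys (- I))"
      using I by (simp add: nths_Cons shuffle_sign_Suc contract_def parity_def)
  qed
  finally show ?thesis by simp
qed

lemma contract_wedge:
  "contract x (wedge \<omega> \<eta>) =
     (\<lambda>ys. wedge (contract x \<omega>) \<eta> ys + wedge (parity \<omega>) (contract x \<eta>) ys)"
  by (rule ext) (simp add: contract_apply wedge_Cons)

lemma wedge_add_left: "wedge (\<lambda>xs. a xs + b xs) c = (\<lambda>xs. wedge a c xs + wedge b c xs)"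
  by (simp add: wedge_def fun_eq_iff algebra_simps sum.distrib)

lemma wedge_add_right: "wedge c (\<lambda>xs. a xs + b xs) = (\<lambda>xs. wedge c a xs + wedge c b xs)"
  by (simp add: wedge_def fun_eq_iff algebra_simps sum.distrib)

lemma wedge_cmul_left: "wedge (\<lambda>xs. r * a xs) c = (\<lambda>xs. r * wedge a c xs)"
  by (simp add: wedge_def fun_eq_iff algebra_simps sum_distrib_left)

lemma wedge_cmul_right: "wedge c (\<lambda>xs. r * a xs) = (\<lambda>xs. r * wedge c a xs)"
  by (simp add: wedge_def fun_eq_iff algebra_simps sum_distrib_left)

lemma wedge_minus_left: "wedge (\<lambda>xs. - a xs) c = (\<lambda>xs. - wedge a c xs)"
  using wedge_cmul_left[of "-1"] by simp

lemma wedge_minus_right: "wedge c (\<lambda>xs. - a xs) = (\<lambda>xs. - wedge c a xs)"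
  using wedge_cmul_right[of c "-1"] by simp

lemma wedge_zero_left: "wedge (\<lambda>xs. 0) c = (\<lambda>xs. 0)"
  by (simp add: wedge_def)

lemma wedge_zero_right: "wedge c (\<lambda>xs. 0) = (\<lambda>xs. 0)"
  by (simp add: wedge_def)

lemma parity_wedge: "parity (wedge \<omega> \<eta>) = wedge (parity \<omega>) (parity \<eta>)"
proof
  fix xs show "parity (wedge \<omega> \<eta>) xs = wedge (parity \<omega>) (parity \<eta>) xs"
    by (induction xs arbitrary: \<omega> \<eta>)
      (simp_all add: wedge_Nil wedge_Cons parity_Nil parity_Cons contract_wedge parity_add
        contract_parity wedge_minus_left wedge_minus_right)
qed

lemma wedge_assoc: "wedge (wedge a b) c = wedge a (wedge b c)"
proof
  fix xs show "wedge (wedge a b) c xs = wedge a (wedge b c) xs"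
  proof (induction xs arbitrary: a b c)
    case (Cons x xs)
    show ?case
      by (simp only: wedge_Cons contract_wedge wedge_add_left wedge_add_right parity_wedge Cons.IH
        add.assoc)
  qed (simp add: wedge_Nil)
qed

lemma contract_cochain:
  assumes "\<omega> \<in> cochains (Suc p)" shows "contract x \<omega> \<in> cochains p"
  using assms by (simp add: cochains_iff alternating_contract contract_apply)

lemma contract_cochain_0: "\<omega> \<in> cochains 0 \<Longrightarrow> contract x \<omega> = (\<lambda>_. 0)"
  by (simp add: cochains_def contract_def fun_eq_iff)

lemma wedge_alternating_at:
  "alternating \<omega> \<Longrightarrow> alternating \<eta> \<Longrightarrow> alternating_at n (wedge \<omega> \<eta>)"
proof (induction n arbitrary: \<omega> \<eta>)
  case (Suc n)
  have c: "alternating (contract x \<omega>)" "alternating (contract x \<eta>)" "alternating (parity \<omega>)" for x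
    using Suc.prems by (auto intro: alternating_contract alternating_parity)
  show ?case
  proof (rule alternating_at_SucI)
    fix ys :: "'a list"
    have 1: "linear (\<lambda>x. wedge (contract x \<omega>) \<eta> ys)"
      unfolding wedge_def contract_def
      by (rule linear_compose_sum, rule ballI, rule linear_fun_mult, rule linear_fun_cmul,
        rule alternating_linear_head, rule Suc.prems)
    have 2: "linear (\<lambda>x. wedge (parity \<omega>) (contract x \<eta>) ys)"
      unfolding wedge_def contract_def
      by (rule linear_compose_sum, rule ballI, rule linear_fun_cmul,
        rule alternating_linear_head, rule Suc.prems)
    show "linear (\<lambda>x. wedge \<omega> \<eta> (x # ys))"
      unfolding wedge_Cons by (rule linear_fun_add[OF 1 2])
  next
    show "alternating_at n (contract x (wedge \<omega> \<eta>))" for x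
      unfolding contract_wedge by (intro alternating_at_add Suc.IH c Suc.prems)
  next
    fix x zs
    have z: "contract x (contract x \<omega>) = (\<lambda>_. 0)" "contract x (contract x \<eta>) = (\<lambda>_. 0)"
      using Suc.prems by (auto simp: contract_def fun_eq_iff intro!: alternating_repeat)
    show "wedge \<omega> \<eta> (x # x # zs) = 0"
      by (simp add: wedge_Cons contract_wedge z contract_parity wedge_zero_left wedge_zero_right
        wedge_minus_left parity_parity)
  qed
qed (rule alternating_at_0)

lemma alternating_wedge: "alternating \<omega> \<Longrightarrow> alternating \<eta> \<Longrightarrow> alternating (wedge \<omega> \<eta>)"
  using wedge_alternating_at unfolding alternating_def by blast

lemma wedge_cochains:
  assumes "\<omega> \<in> cochains p" "\<eta> \<in> cochains q" shows "wedge \<omega> \<eta> \<in> cochains (p + q)"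
  unfolding cochains_iff
proof (intro conjI allI impI)
  show "alternating (wedge \<omega> \<eta>)" using assms alternating_wedge by (auto simp: cochains_iff)
  fix xs :: "'a list" assume l: "length xs \<noteq> p + q"
  have "\<omega> (nths xs I) = 0 \<or> \<eta> (nths xs (- I)) = 0" for I
  proof -
    have "length (nths xs I) + length (nths xs (- I)) = card ({i. i < length xs \<and> i \<in> I} \<union> {i. i < length xs \<and> i \<notin> I})"
      unfolding length_nths by (subst card_Un_disjoint) auto
    also have "\<dots> = card {..<length xs}" by (rule arg_cong[of _ _ card]) auto
    finally have "length (nths xs I) \<noteq> p \<or> length (nths xs (- I)) \<noteq> q" using l by auto
    then show ?thesis using assms by (auto simp: cochains_def)
  qed
  then show "wedge \<omega> \<eta> xs = 0" unfolding wedge_def by (intro sum.neutral) auto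
qed

lemma wedge_commute:
  "\<omega> \<in> cochains p \<Longrightarrow> \<eta> \<in> cochains q \<Longrightarrow> wedge \<omega> \<eta> xs = (- 1) ^ (p * q) * wedge \<eta> \<omega> xs"
proof (induction xs arbitrary: p q \<omega> \<eta>)
  case Nil
  then show ?case by (cases p; cases q) (auto simp: wedge_Nil cochains_def)
next
  case (Cons x xs)
  note pw = parity_cochain[OF Cons.prems(1)] parity_cochain[OF Cons.prems(2)]
  have 1: "wedge (contract x \<omega>) \<eta> xs = (- 1) ^ (p * q) * (- 1) ^ q * wedge \<eta> (contract x \<omega>) xs"
  proof (cases p)
    case 0 then show ?thesis
      using Cons.prems by (simp add: contract_cochain_0 wedge_zero_left wedge_zero_right)
  next
    case (Suc p')
    then show ?thesis
      using Cons.IH[of "contract x \<omega>" p' \<eta> q] Cons.prems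
      by (simp add: contract_cochain power_add minus_one_power_cancel)
  qed
  have 2: "wedge \<omega> (contract x \<eta>) xs * (- 1) ^ p = (- 1) ^ (p * q) * wedge (contract x \<eta>) \<omega> xs"
  proof (cases q)
    case 0 then show ?thesis
      using Cons.prems by (simp add: contract_cochain_0 wedge_zero_left wedge_zero_right)
  next
    case (Suc q')
    then show ?thesis
      using Cons.IH[of \<omega> p "contract x \<eta>" q'] Cons.prems
      by (simp add: contract_cochain power_add)
  qed
  have "wedge \<omega> \<eta> (x # xs) =
      wedge (contract x \<omega>) \<eta> xs + (- 1) ^ p * wedge \<omega> (contract x \<eta>) xs"
    and "wedge \<eta> \<omega> (x # xs) =
      wedge (contract x \<eta>) \<omega> xs + (- 1) ^ q * wedge \<eta> (contract x \<omega>) xs"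
    by (simp_all add: wedge_Cons pw wedge_cmul_left)
  then show ?case using 1 2 by (simp add: algebra_simps)
qed

section \<open>The coboundary as an antiderivation\<close>

text \<open>The Lie derivative along \<open>x\<close>, up to sign.\<close>

definition lie_action :: "('v \<Rightarrow> 'v \<Rightarrow> 'v) \<Rightarrow> 'v \<Rightarrow> ('v list \<Rightarrow> real) \<Rightarrow> 'v list \<Rightarrow> real" where
  "lie_action br x \<omega> = (\<lambda>ys. \<Sum>j<length ys. \<omega> (ys[j := br x (ys ! j)]))"

lemma lie_action_Nil: "lie_action br x \<omega> [] = 0"
  by (simp add: lie_action_def)

lemma lie_action_Cons:
  "lie_action br x \<omega> (y # ys) = \<omega> (br x y # ys) + lie_action br x (contract y \<omega>) ys"
  by (simp add: lie_action_def contract_def sum.lessThan_Suc_shift del: sum.lessThan_Suc)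

lemma contract_lie_action:
  "contract y (lie_action br x \<omega>) =
     (\<lambda>ys. contract (br x y) \<omega> ys + lie_action br x (contract y \<omega>) ys)"
  by (simp add: contract_def lie_action_Cons[unfolded contract_def] fun_eq_iff)

lemma lie_action_add:
  "lie_action br x (\<lambda>xs. a xs + b xs) ys = lie_action br x a ys + lie_action br x b ys"
  by (simp add: lie_action_def sum.distrib)

lemma parity_lie_action: "parity (lie_action br x \<omega>) = lie_action br x (parity \<omega>)"
  by (simp add: parity_def lie_action_def fun_eq_iff sum_distrib_left)

lemma lie_action_wedge:
  "lie_action br x (wedge a b) ys = wedge (lie_action br x a) b ys + wedge a (lie_action br x b) ys"
proof (induction ys arbitrary: a b)
  case (Cons y ys)
  then show ?case
    by (simp add: lie_action_Cons wedge_Cons contract_wedge lie_action_add contract_lie_action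
      wedge_add_left wedge_add_right parity_lie_action)
qed (simp add: lie_action_Nil wedge_Nil)

lemma move_to_front:
  "alternating \<omega> \<Longrightarrow> j < length ys \<Longrightarrow> \<omega> (v # nths ys (- {j})) = (- 1) ^ j * \<omega> (ys[j := v])"
proof (induction ys arbitrary: j \<omega>)
  case (Cons y ys)
  show ?case
  proof (cases j)
    case 0
    have "nths (y # ys) (- {0}) = ys" by (simp add: nths_Cons nths_all)
    then show ?thesis using 0 by simp
  next
    case (Suc k)
    have "{i. Suc i \<in> - {j}} = - {k}" using Suc by auto
    then have "nths (y # ys) (- {j}) = y # nths ys (- {k})" using Suc by (simp add: nths_Cons)
    then have "\<omega> (v # nths (y # ys) (- {j})) = - contract y \<omega> (v # nths ys (- {k}))"
      using alternating_swap[OF Cons.prems(1), of v y "nths ys (- {k})"] by (simp add: contract_def)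
    also have "contract y \<omega> (v # nths ys (- {k})) = (- 1) ^ k * contract y \<omega> (ys[k := v])"
      using Cons.IH[of "contract y \<omega>" k] Cons.prems Suc by (simp add: alternating_contract)
    finally show ?thesis using Suc by (simp add: contract_def)
  qed
qed simp

lemma coboundary_Nil: "coboundary br \<omega> [] = 0"
  by (simp add: coboundary_def)

text \<open>Cartan's formula \<open>\<iota>\<^sub>x d + d \<iota>\<^sub>x = L\<^sub>x\<close>. The terms of the coboundary that bracket the first
  argument with another one make up the Lie derivative; in the others the first argument is
  passed on unchanged.\<close>

lemma coboundary_Cons:
  assumes "alternating \<omega>"
  shows "coboundary br \<omega> (x # ys) = - lie_action br x \<omega> ys - coboundary br (contract x \<omega>) ys"
proof -
  let ?t = "\<lambda>i j. (- 1) ^ (i + j) * \<omega> (br ((x # ys) ! i) ((x # ys) ! j) # nths (x # ys) (- {i, j}))"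
  have "coboundary br \<omega> (x # ys) = (\<Sum>j<length ys. \<Sum>i<Suc j. ?t i (Suc j))"
    unfolding coboundary_def by (simp only: length_Cons sum.lessThan_Suc_shift[of _ "length ys"]) simp
  also have "\<dots> = (\<Sum>j<length ys. ?t 0 (Suc j) + (\<Sum>i<j. ?t (Suc i) (Suc j)))"
    by (simp only: sum.lessThan_Suc_shift)
  also have "\<dots> = (\<Sum>j<length ys. - \<omega> (ys[j := br x (ys ! j)]) -
      (\<Sum>i<j. (- 1) ^ (i + j) * contract x \<omega> (br (ys ! i) (ys ! j) # nths ys (- {i, j}))))"
  proof (rule sum.cong[OF refl])
    fix j assume j: "j \<in> {..<length ys}"
    have "{i. Suc i \<in> - {0, Suc j}} = - {j}" by auto
    then have "?t 0 (Suc j) = (- 1) ^ Suc j * \<omega> (br x (ys ! j) # nths ys (- {j}))"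
      by (simp add: nths_Cons)
    also have "\<dots> = - \<omega> (ys[j := br x (ys ! j)])"
      using move_to_front[OF assms, of j ys] j by (simp add: minus_one_power_cancel)
    finally have 1: "?t 0 (Suc j) = - \<omega> (ys[j := br x (ys ! j)])" .
    have 2: "?t (Suc i) (Suc j) =
        - ((- 1) ^ (i + j) * contract x \<omega> (br (ys ! i) (ys ! j) # nths ys (- {i, j})))" for i
    proof -
      have "{k. Suc k \<in> - {Suc i, Suc j}} = - {i, j}" by auto
      then have "nths (x # ys) (- {Suc i, Suc j}) = x # nths ys (- {i, j})" by (simp add: nths_Cons)
      then show ?thesis
        using alternating_swap[OF assms, of "br (ys ! i) (ys ! j)" x "nths ys (- {i, j})"]
        by (simp add: contract_def)
    qed
    show "?t 0 (Suc j) + (\<Sum>i<j. ?t (Suc i) (Suc j)) = - \<omega> (ys[j := br x (ys ! j)]) -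
      (\<Sum>i<j. (- 1) ^ (i + j) * contract x \<omega> (br (ys ! i) (ys ! j) # nths ys (- {i, j})))"
      unfolding 1 2 by (simp add: sum_negf)
  qed
  also have "\<dots> = - lie_action br x \<omega> ys - coboundary br (contract x \<omega>) ys"
    by (simp add: lie_action_def coboundary_def sum_subtractf sum_negf)
  finally show ?thesis .
qed

lemma contract_coboundary:
  assumes "alternating \<omega>"
  shows "contract x (coboundary br \<omega>) =
    (\<lambda>ys. - lie_action br x \<omega> ys - coboundary br (contract x \<omega>) ys)"
  by (rule ext) (simp add: contract_apply coboundary_Cons[OF assms])

lemma coboundary_add:
  "coboundary br (\<lambda>xs. a xs + b xs) = (\<lambda>xs. coboundary br a xs + coboundary br b xs)"
  by (simp add: coboundary_def fun_eq_iff distrib_left sum.distrib)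

lemma coboundary_cmul: "coboundary br (\<lambda>xs. c * a xs) = (\<lambda>xs. c * coboundary br a xs)"
  by (simp add: coboundary_def fun_eq_iff sum_distrib_left algebra_simps)

lemma coboundary_minus: "coboundary br (\<lambda>xs. - a xs) = (\<lambda>xs. - coboundary br a xs)"
  using coboundary_cmul[of br "-1" a] by simp

lemma parity_coboundary:
  "alternating \<omega> \<Longrightarrow> parity (coboundary br \<omega>) xs = - coboundary br (parity \<omega>) xs"
proof (induction xs arbitrary: \<omega>)
  case (Cons x xs)
  have "parity (coboundary br \<omega>) (x # xs) =
      parity (lie_action br x \<omega>) xs + parity (coboundary br (contract x \<omega>)) xs"
    by (simp add: parity_Cons contract_coboundary[OF Cons.prems]) (simp add: parity_def algebra_simps)
  then show ?case
    using Cons.IH[OF alternating_contract[OF Cons.prems, of x]]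
    by (simp add: coboundary_Cons alternating_parity Cons.prems parity_lie_action contract_parity
      coboundary_minus)
qed (simp add: coboundary_Nil parity_Nil)

text \<open>By Cartan's formula, contracting both sides leaves the Leibniz rule for the contracted
  factors, which is the induction hypothesis, and the derivation property of the Lie action.\<close>

lemma coboundary_wedge:
  "alternating a \<Longrightarrow> alternating b \<Longrightarrow>
    coboundary br (wedge a b) xs = wedge (coboundary br a) b xs + wedge (parity a) (coboundary br b) xs"
proof (induction xs arbitrary: a b)
  case (Cons x xs)
  note c = alternating_contract[OF Cons.prems(1), of x] alternating_contract[OF Cons.prems(2), of x]
    alternating_parity[OF Cons.prems(1)]
  have minus: "parity (coboundary br a) = (\<lambda>xs. - coboundary br (parity a) xs)"
    by (rule ext) (rule parity_coboundary[OF Cons.prems(1)])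
  have diff_l: "wedge (\<lambda>ys. - f ys - g ys) h = (\<lambda>ys. - wedge f h ys - wedge g h ys)"
    and diff_r: "wedge h (\<lambda>ys. - f ys - g ys) = (\<lambda>ys. - wedge h f ys - wedge h g ys)"
    for f g h :: "'a list \<Rightarrow> real"
    by (simp_all add: wedge_def fun_eq_iff algebra_simps sum.distrib sum_subtractf sum_negf)
  show ?case
    using Cons.IH[OF c(1) Cons.prems(2)] Cons.IH[OF c(3,2)] Cons.prems
    by (simp add: coboundary_Cons alternating_wedge lie_action_wedge contract_wedge coboundary_add
      wedge_Cons contract_coboundary diff_l diff_r minus contract_parity wedge_minus_left
      parity_parity)
qed (simp add: coboundary_Nil wedge_Nil)

lemma lie_action_alternating_at:
  assumes lin: "\<And>u. linear (br u)"
  shows "alternating \<omega> \<Longrightarrow> alternating_at n (lie_action br x \<omega>)"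
proof (induction n arbitrary: \<omega>)
  case (Suc n)
  note alt = Suc.prems
  show ?case
  proof (rule alternating_at_SucI)
    fix ys :: "'a list"
    have "linear (\<lambda>y. \<omega> (br x y # ys))"
      using linear_compose[OF lin[of x] alternating_linear_head[OF alt, of ys]] by (simp add: comp_def)
    moreover have "linear (\<lambda>y. lie_action br x (contract y \<omega>) ys)"
      unfolding lie_action_def contract_def
      by (rule linear_compose_sum, rule ballI, rule alternating_linear_head, rule alt)
    ultimately show "linear (\<lambda>y. lie_action br x \<omega> (y # ys))"
      unfolding lie_action_Cons by (rule linear_fun_add)
  next
    fix y
    show "alternating_at n (contract y (lie_action br x \<omega>))"
      unfolding contract_lie_action
      using Suc.IH[OF alternating_contract[OF alt]] alternating_contract[OF alt]
      by (intro alternating_at_add) (auto simp: alternating_def)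
  next
    fix y zs
    have "contract y (contract y \<omega>) = (\<lambda>_. 0)"
      using alt by (auto simp: contract_def fun_eq_iff intro!: alternating_repeat)
    then show "lie_action br x \<omega> (y # y # zs) = 0"
      using alternating_swap[OF alt, of y "br x y" zs]
      by (simp add: lie_action_Cons contract_apply) (simp add: lie_action_def)
  qed
qed (rule alternating_at_0)

text \<open>By Cartan's formula, if the first two arguments are both \<open>x\<close>, only the term with
  \<open>[x, x]\<close> is left.\<close>

lemma coboundary_alternating_at:
  assumes lin: "\<And>u. linear (br u)" "\<And>v. linear (\<lambda>u. br u v)" and self: "\<And>u. br u u = 0"
  shows "alternating \<omega> \<Longrightarrow> alternating_at n (coboundary br \<omega>)"
proof (induction n arbitrary: \<omega>)
  case (Suc n)
  note alt = Suc.prems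
  have neg: "alternating_at n (\<lambda>ys. - f ys - g ys)"
    if "alternating_at n f" "alternating_at n g" for f g :: "'a list \<Rightarrow> real"
    using alternating_at_cmul[OF alternating_at_add[OF that], of "-1"] by simp
  show ?case
  proof (rule alternating_at_SucI)
    fix ys :: "'a list"
    have 1: "linear (\<lambda>x. lie_action br x \<omega> ys)"
      unfolding lie_action_def
    proof (rule linear_compose_sum, rule ballI)
      fix j assume "j \<in> {..<length ys}"
      then have "linear (\<lambda>v. \<omega> (ys[j := v]))"
        using alt unfolding alternating_def alternating_at_def by blast
      from linear_compose[OF lin(2) this]
      show "linear (\<lambda>x. \<omega> (ys[j := br x (ys ! j)]))" by (simp add: comp_def)
    qed
    have 2: "linear (\<lambda>x. coboundary br (contract x \<omega>) ys)"
      unfolding coboundary_def contract_def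
      by (rule linear_compose_sum, rule ballI, rule linear_compose_sum, rule ballI,
        rule linear_fun_cmul, rule alternating_linear_head, rule alt)
    show "linear (\<lambda>x. coboundary br \<omega> (x # ys))"
      using linear_fun_cmul[OF linear_fun_add[OF 1 2], of "-1"] by (simp add: coboundary_Cons alt)
  next
    fix x
    show "alternating_at n (contract x (coboundary br \<omega>))"
      unfolding contract_coboundary[OF alt]
      by (rule neg[OF lie_action_alternating_at[OF lin(1) alt] Suc.IH[OF alternating_contract[OF alt]]])
  next
    fix x and zs :: "'a list"
    have "contract x (contract x \<omega>) = (\<lambda>_. 0)"
      using alt by (auto simp: contract_def fun_eq_iff intro!: alternating_repeat)
    moreover have "\<omega> (0 # zs) = 0"
      using linear_0[OF alternating_linear_head[OF alt]] .
    ultimately show "coboundary br \<omega> (x # x # zs) = 0"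
      by (simp add: coboundary_Cons alt alternating_contract lie_action_Cons self)
        (simp add: coboundary_def)
  qed
qed (rule alternating_at_0)

lemma coboundary_support:
  "\<omega> \<in> cochains p \<Longrightarrow> length xs \<noteq> Suc p \<Longrightarrow> coboundary br \<omega> xs = 0"
proof (induction xs arbitrary: p \<omega>)
  case (Cons x xs)
  have "lie_action br x \<omega> xs = 0"
    using Cons.prems by (auto simp: lie_action_def cochains_def)
  moreover have "coboundary br (contract x \<omega>) xs = 0"
  proof (cases p)
    case 0
    then show ?thesis using Cons.prems contract_cochain_0[of \<omega> x] by (simp add: coboundary_def)
  next
    case (Suc p')
    then show ?thesis using Cons.IH[of "contract x \<omega>" p'] Cons.prems by (simp add: contract_cochain)
  qed
  ultimately show ?case using Cons.prems by (simp add: coboundary_Cons cochains_iff)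
qed (rule coboundary_Nil)

lemma coboundary_cochains:
  assumes "lie_algebra br" "\<omega> \<in> cochains p" shows "coboundary br \<omega> \<in> cochains (Suc p)"
  using assms coboundary_alternating_at[of br \<omega>] coboundary_support[OF assms(2)]
  by (auto simp: cochains_iff lie_algebra_def alternating_def)

section \<open>Cohomology classes\<close>

lemma additive_functional_sum:
  fixes f :: "('a \<Rightarrow> real) \<Rightarrow> real"
  assumes add: "\<And>a b. f (\<lambda>xs. a xs + b xs) = f a + f b" and scale: "\<And>c a. f (\<lambda>xs. c * a xs) = c * f a"
  shows "f (\<lambda>xs. \<Sum>i\<in>I. c i * a i xs) = (\<Sum>i\<in>I. c i * f (a i))"
proof -
  have "f (\<lambda>_. 0) = 0" using scale[of 0 "\<lambda>_. 0"] by simp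
  then show ?thesis by (induction I rule: infinite_finite_induct) (auto simp: add scale)
qed

lemma cochains_add: "a \<in> cochains p \<Longrightarrow> b \<in> cochains p \<Longrightarrow> (\<lambda>xs. a xs + b xs) \<in> cochains p"
  by (simp add: cochains_iff alternating_add)

lemma cochains_cmul: "a \<in> cochains p \<Longrightarrow> (\<lambda>xs. c * a xs) \<in> cochains p"
  by (simp add: cochains_iff alternating_cmul)

lemma cochains_zero: "(\<lambda>_. 0) \<in> cochains p"
  by (simp add: cochains_def linear_zero_fun)

lemma cochains_sum:
  "(\<And>i. i \<in> I \<Longrightarrow> a i \<in> cochains p) \<Longrightarrow> (\<lambda>xs. \<Sum>i\<in>I. a i xs) \<in> cochains p"
  by (induction I rule: infinite_finite_induct) (auto intro: cochains_add cochains_zero)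

lemma cochains_alternating: "a \<in> cochains p \<Longrightarrow> alternating a"
  by (simp add: cochains_iff)

lemma coboundary_zero: "coboundary br (\<lambda>_. 0) = (\<lambda>_. 0)"
  by (simp add: coboundary_def)

lemma coboundary_sum:
  "coboundary br (\<lambda>xs. \<Sum>i\<in>I. a i xs) = (\<lambda>xs. \<Sum>i\<in>I. coboundary br (a i) xs)"
  by (induction I rule: infinite_finite_induct) (auto simp: coboundary_zero coboundary_add)

lemma cocycles_cochains: "a \<in> cocycles br p \<Longrightarrow> a \<in> cochains p"
  by (simp add: cocycles_def)

lemma cocycles_add: "a \<in> cocycles br p \<Longrightarrow> b \<in> cocycles br p \<Longrightarrow> (\<lambda>xs. a xs + b xs) \<in> cocycles br p"
  by (simp add: cocycles_def cochains_add coboundary_add)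

lemma cocycles_cmul: "a \<in> cocycles br p \<Longrightarrow> (\<lambda>xs. c * a xs) \<in> cocycles br p"
  by (simp add: cocycles_def cochains_cmul coboundary_cmul)

lemma cocycles_zero: "(\<lambda>_. 0) \<in> cocycles br p"
  by (simp add: cocycles_def cochains_zero coboundary_zero)

lemma cocycles_sum:
  "(\<And>i. i \<in> I \<Longrightarrow> a i \<in> cocycles br p) \<Longrightarrow> (\<lambda>xs. \<Sum>i\<in>I. a i xs) \<in> cocycles br p"
  by (induction I rule: infinite_finite_induct) (auto intro: cocycles_add cocycles_zero)

lemma coboundaries_zero: "(\<lambda>_. 0) \<in> coboundaries br p"
  unfolding coboundaries_def
  by (cases p) (auto intro!: image_eqI[OF _ cochains_zero] simp: coboundary_zero)

lemma coboundaries_add: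
  assumes "a \<in> coboundaries br p" "b \<in> coboundaries br p"
  shows "(\<lambda>xs. a xs + b xs) \<in> coboundaries br p"
proof (cases p)
  case (Suc q)
  then obtain \<omega> \<eta> where "a = coboundary br \<omega>" "b = coboundary br \<eta>" "\<omega> \<in> cochains q" "\<eta> \<in> cochains q"
    using assms by (auto simp: coboundaries_def)
  then show ?thesis
    using Suc by (auto simp: coboundaries_def intro!: image_eqI[OF _ cochains_add] simp flip: coboundary_add)
qed (use assms in \<open>auto simp: coboundaries_def\<close>)

lemma coboundaries_cmul:
  assumes "a \<in> coboundaries br p" shows "(\<lambda>xs. c * a xs) \<in> coboundaries br p"
proof (cases p)
  case (Suc q)
  then obtain \<omega> where "a = coboundary br \<omega>" "\<omega> \<in> cochains q"
    using assms by (auto simp: coboundaries_def)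
  then show ?thesis
    using Suc by (auto simp: coboundaries_def intro!: image_eqI[OF _ cochains_cmul] simp flip: coboundary_cmul)
qed (use assms in \<open>auto simp: coboundaries_def\<close>)

lemma equiv_cohomologous: "equiv (cocycles br p) (cohomologous br p)"
proof (rule equivI)
  show "cohomologous br p \<subseteq> cocycles br p \<times> cocycles br p" by (auto simp: cohomologous_def)
  show "refl_on (cocycles br p) (cohomologous br p)"
    by (auto simp: refl_on_def cohomologous_def coboundaries_zero)
  show "sym (cohomologous br p)"
    using coboundaries_cmul[of _ br p "-1"] by (fastforce simp: sym_def cohomologous_def)
  show "trans (cohomologous br p)"
  proof (rule transI)
    fix a b c assume "(a, b) \<in> cohomologous br p" "(b, c) \<in> cohomologous br p"
    then show "(a, c) \<in> cohomologous br p"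
      using coboundaries_add[of "\<lambda>xs. a xs - b xs" br p "\<lambda>xs. b xs - c xs"]
      by (auto simp: cohomologous_def)
  qed
qed

definition cohomology_class ::
    "('v::real_vector \<Rightarrow> 'v \<Rightarrow> 'v) \<Rightarrow> nat \<Rightarrow> ('v list \<Rightarrow> real) \<Rightarrow> ('v list \<Rightarrow> real) set" where
  "cohomology_class br p \<omega> = cohomologous br p `` {\<omega>}"

lemma cohomology_class_eq_iff:
  "a \<in> cocycles br p \<Longrightarrow> b \<in> cocycles br p \<Longrightarrow>
    cohomology_class br p a = cohomology_class br p b \<longleftrightarrow> (\<lambda>xs. a xs - b xs) \<in> coboundaries br p"
  unfolding cohomology_class_def
  by (subst eq_equiv_class_iff[OF equiv_cohomologous]) (auto simp: cohomologous_def)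

lemma mem_cohomology_class:
  "b \<in> cohomology_class br p a \<longleftrightarrow>
    a \<in> cocycles br p \<and> b \<in> cocycles br p \<and> (\<lambda>xs. a xs - b xs) \<in> coboundaries br p"
  by (auto simp: cohomology_class_def cohomologous_def)

lemma cohomology_component:
  "component (cohomology br) p = cohomology_class br p ` cocycles br p"
  by (auto simp: cohomology_def quotient_def cohomology_class_def)

lemma UN_constant_class: "x \<in> A \<Longrightarrow> (\<And>y. y \<in> A \<Longrightarrow> f y = c) \<Longrightarrow> (\<Union>y\<in>A. f y) = c"
  by auto

lemma UN_constant_class2:
  "x \<in> A \<Longrightarrow> y \<in> B \<Longrightarrow> (\<And>u v. u \<in> A \<Longrightarrow> v \<in> B \<Longrightarrow> f u v = c) \<Longrightarrow> (\<Union>u\<in>A. \<Union>v\<in>B. f u v) = c"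
  by auto

lemma cohomology_gadd:
  assumes a: "a \<in> cocycles br p" and b: "b \<in> cocycles br p"
  shows "gadd (cohomology br) p (cohomology_class br p a) (cohomology_class br p b) =
    cohomology_class br p (\<lambda>xs. a xs + b xs)"
proof -
  have unfolded: "gadd (cohomology br) p X Y = (\<Union>\<omega>\<in>X. \<Union>\<eta>\<in>Y. cohomology_class br p (\<lambda>xs. \<omega> xs + \<eta> xs))" for X Y
    by (simp add: cohomology_def cohomology_class_def)
  have same: "cohomology_class br p (\<lambda>xs. \<omega> xs + \<eta> xs) = cohomology_class br p (\<lambda>xs. a xs + b xs)"
    if "\<omega> \<in> cohomology_class br p a" "\<eta> \<in> cohomology_class br p b" for \<omega> \<eta>
  proof (subst cohomology_class_eq_iff)
    show "(\<lambda>xs. \<omega> xs + \<eta> xs - (a xs + b xs)) \<in> coboundaries br p"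
      using coboundaries_cmul[OF coboundaries_add[of "\<lambda>xs. a xs - \<omega> xs" br p "\<lambda>xs. b xs - \<eta> xs"], of "-1"] that
      by (simp add: mem_cohomology_class algebra_simps)
  qed (use that a b in \<open>auto simp: mem_cohomology_class cocycles_add\<close>)
  have mem: "a \<in> cohomology_class br p a" "b \<in> cohomology_class br p b"
    using a b by (auto simp: mem_cohomology_class coboundaries_zero)
  show ?thesis
    unfolding unfolded by (rule UN_constant_class2[OF mem]) (rule same)
qed

lemma cohomology_gscale:
  assumes a: "a \<in> cocycles br p"
  shows "gscale (cohomology br) p c (cohomology_class br p a) = cohomology_class br p (\<lambda>xs. c * a xs)"
proof -
  have unfolded: "gscale (cohomology br) p c X = (\<Union>\<omega>\<in>X. cohomology_class br p (\<lambda>xs. c * \<omega> xs))" for X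
    by (simp add: cohomology_def cohomology_class_def)
  have same: "cohomology_class br p (\<lambda>xs. c * \<omega> xs) = cohomology_class br p (\<lambda>xs. c * a xs)"
    if "\<omega> \<in> cohomology_class br p a" for \<omega>
  proof (subst cohomology_class_eq_iff)
    show "(\<lambda>xs. c * \<omega> xs - c * a xs) \<in> coboundaries br p"
      using coboundaries_cmul[of "\<lambda>xs. a xs - \<omega> xs" br p "-c"] that
      by (simp add: mem_cohomology_class algebra_simps)
  qed (use that a in \<open>auto simp: mem_cohomology_class cocycles_cmul\<close>)
  have "a \<in> cohomology_class br p a"
    using a by (auto simp: mem_cohomology_class coboundaries_zero)
  show ?thesis
    unfolding unfolded by (rule UN_constant_class, fact, rule same)
qed

lemma wedge_diff_left: "wedge (\<lambda>xs. a xs - b xs) c = (\<lambda>xs. wedge a c xs - wedge b c xs)"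
  by (simp add: wedge_def fun_eq_iff algebra_simps sum_subtractf)

lemma wedge_diff_right: "wedge c (\<lambda>xs. a xs - b xs) = (\<lambda>xs. wedge c a xs - wedge c b xs)"
  by (simp add: wedge_def fun_eq_iff algebra_simps sum_subtractf)

lemma coboundary_wedge_cochains:
  assumes "a \<in> cochains p" "b \<in> cochains q"
  shows "coboundary br (wedge a b) =
    (\<lambda>xs. wedge (coboundary br a) b xs + (- 1) ^ p * wedge a (coboundary br b) xs)"
  by (rule ext) (use assms in \<open>simp add: coboundary_wedge cochains_alternating parity_cochain wedge_cmul_left\<close>)

lemma wedge_cocycles:
  assumes "a \<in> cocycles br p" "b \<in> cocycles br q" shows "wedge a b \<in> cocycles br (p + q)"
  using assms
  by (auto simp: cocycles_def wedge_cochains coboundary_wedge_cochains wedge_zero_left wedge_zero_right)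

lemma wedge_coboundary_left:
  assumes "a \<in> coboundaries br p" "b \<in> cocycles br q" shows "wedge a b \<in> coboundaries br (p + q)"
proof (cases p)
  case 0
  then show ?thesis using assms by (simp add: coboundaries_def[of br 0] wedge_zero_left coboundaries_zero)
next
  case (Suc r)
  then obtain \<omega> where "a = coboundary br \<omega>" "\<omega> \<in> cochains r" using assms by (auto simp: coboundaries_def)
  then have "wedge a b = coboundary br (wedge \<omega> b)" "wedge \<omega> b \<in> cochains (r + q)"
    using assms by (auto simp: cocycles_def coboundary_wedge_cochains wedge_zero_right wedge_cochains)
  then show ?thesis using Suc by (auto simp: coboundaries_def)
qed

lemma wedge_coboundary_right:
  assumes "a \<in> cocycles br p" "b \<in> coboundaries br q" shows "wedge a b \<in> coboundaries br (p + q)"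
proof (cases q)
  case 0
  then show ?thesis using assms
    using coboundaries_zero by (auto simp: coboundaries_def[of br 0] wedge_zero_right)
next
  case (Suc r)
  then obtain \<omega> where w: "b = coboundary br \<omega>" "\<omega> \<in> cochains r" using assms by (auto simp: coboundaries_def)
  let ?w = "\<lambda>xs. (- 1) ^ p * wedge a \<omega> xs"
  have "wedge a b = coboundary br ?w" "?w \<in> cochains (p + r)"
    using assms w
    by (auto simp: cocycles_def coboundary_wedge_cochains wedge_zero_left wedge_cochains cochains_cmul
        coboundary_cmul minus_one_power_cancel)
  then show ?thesis using Suc by (auto simp: coboundaries_def)
qed

lemma cohomology_gmult:
  assumes a: "a \<in> cocycles br p" and b: "b \<in> cocycles br q"
  shows "gmult (cohomology br) p q (cohomology_class br p a) (cohomology_class br q b) =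
    cohomology_class br (p + q) (wedge a b)"
proof -
  have unfolded: "gmult (cohomology br) p q X Y = (\<Union>\<omega>\<in>X. \<Union>\<eta>\<in>Y. cohomology_class br (p + q) (wedge \<omega> \<eta>))" for X Y
    by (simp add: cohomology_def cohomology_class_def)
  have same: "cohomology_class br (p + q) (wedge \<omega> \<eta>) = cohomology_class br (p + q) (wedge a b)"
    if w: "\<omega> \<in> cohomology_class br p a" "\<eta> \<in> cohomology_class br q b" for \<omega> \<eta>
  proof (subst cohomology_class_eq_iff)
    have "wedge (\<lambda>xs. a xs - \<omega> xs) \<eta> \<in> coboundaries br (p + q)"
      "wedge a (\<lambda>xs. b xs - \<eta> xs) \<in> coboundaries br (p + q)"
      using w a by (auto simp: mem_cohomology_class wedge_coboundary_left wedge_coboundary_right)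
    from coboundaries_cmul[OF coboundaries_add[OF this], of "-1"]
    show "(\<lambda>xs. wedge \<omega> \<eta> xs - wedge a b xs) \<in> coboundaries br (p + q)"
      by (simp add: wedge_diff_left wedge_diff_right)
  qed (use w a b in \<open>auto simp: mem_cohomology_class wedge_cocycles\<close>)
  have mem: "a \<in> cohomology_class br p a" "b \<in> cohomology_class br q b"
    using a b by (auto simp: mem_cohomology_class coboundaries_zero)
  show ?thesis
    unfolding unfolded by (rule UN_constant_class2[OF mem]) (rule same)
qed

definition one_form :: "'v list \<Rightarrow> real" where
  "one_form = (\<lambda>xs. if xs = [] then 1 else 0)"

lemma cohomology_gone: "gone (cohomology br) = cohomology_class br 0 one_form"
  by (simp add: cohomology_def cohomology_class_def one_form_def)

text \<open>A relation rather than a map: in high degrees the correspondence constructed below is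
  determined only up to exact forms, and it is symmetric in the two algebras. Since it is linear
  and respects exactness in both directions, it descends to a bijection of classes.\<close>

lemma isomorphic_if_correspondence:
  fixes br br' :: "'v::real_vector \<Rightarrow> 'v \<Rightarrow> 'v"
    and R :: "nat \<Rightarrow> ('v list \<Rightarrow> real) \<Rightarrow> ('v list \<Rightarrow> real) \<Rightarrow> bool"
  assumes cocycles: "\<And>p a a'. R p a a' \<Longrightarrow> a \<in> cocycles br p \<and> a' \<in> cocycles br' p"
    and total: "\<And>p a. a \<in> cocycles br p \<Longrightarrow> \<exists>a'. R p a a'"
    and onto: "\<And>p a'. a' \<in> cocycles br' p \<Longrightarrow> \<exists>a. R p a a'"
    and add: "\<And>p a a' b b'. R p a a' \<Longrightarrow> R p b b' \<Longrightarrow> R p (\<lambda>xs. a xs + b xs) (\<lambda>xs. a' xs + b' xs)"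
    and scale: "\<And>p c a a'. R p a a' \<Longrightarrow> R p (\<lambda>xs. c * a xs) (\<lambda>xs. c * a' xs)"
    and exact: "\<And>p a a'. R p a a' \<Longrightarrow> a \<in> coboundaries br p \<longleftrightarrow> a' \<in> coboundaries br' p"
    and mult: "\<And>p q a a' b b'. R p a a' \<Longrightarrow> R q b b' \<Longrightarrow> R (p + q) (wedge a b) (wedge a' b')"
    and one: "R 0 one_form one_form"
  shows "graded_algebra_isomorphic (cohomology br) (cohomology br')"
proof -
  define \<phi> where "\<phi> p X = (\<Union>{cohomology_class br' p a' | a a'. a \<in> X \<and> R p a a'})" for p X
  have cls: "cohomology_class br p a = cohomology_class br p b \<longleftrightarrow>
      cohomology_class br' p a' = cohomology_class br' p b'" if "R p a a'" "R p b b'" for p a b a' b'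
  proof -
    have "R p (\<lambda>xs. a xs - b xs) (\<lambda>xs. a' xs - b' xs)"
      using add[OF that(1) scale[OF that(2), of "-1"]] by simp
    then show ?thesis
      using exact cocycles[OF that(1)] cocycles[OF that(2)] by (simp add: cohomology_class_eq_iff)
  qed
  have \<phi>: "\<phi> p (cohomology_class br p a) = cohomology_class br' p a'" if r: "R p a a'" for p a a'
  proof -
    have "cohomology_class br' p b' = cohomology_class br' p a'"
      if "b \<in> cohomology_class br p a" "R p b b'" for b b'
    proof -
      have "cohomology_class br p b = cohomology_class br p a"
        using that(1) by (subst eq_commute) (auto simp: mem_cohomology_class cohomology_class_eq_iff)
      then show ?thesis using cls[OF that(2) r] by simp
    qed
    moreover have "a \<in> cohomology_class br p a"
      using cocycles[OF r] by (simp add: mem_cohomology_class coboundaries_zero)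
    ultimately have "{cohomology_class br' p b' | b b'. b \<in> cohomology_class br p a \<and> R p b b'} =
        {cohomology_class br' p a'}"
      using r by blast
    then show ?thesis by (simp add: \<phi>_def)
  qed
  have bij: "bij_betw (\<phi> p) (component (cohomology br) p) (component (cohomology br') p)" for p
    unfolding bij_betw_def cohomology_component
  proof (intro conjI equalityI subsetI, rule inj_onI)
    fix X Y assume "X \<in> cohomology_class br p ` cocycles br p" "Y \<in> cohomology_class br p ` cocycles br p"
      and eq: "\<phi> p X = \<phi> p Y"
    then obtain a b a' b' where ab: "X = cohomology_class br p a" "Y = cohomology_class br p b"
        "R p a a'" "R p b b'"
      using total by blast
    then show "X = Y" using eq cls[OF ab(3,4)] \<phi> by simp
  next
    fix Y assume "Y \<in> \<phi> p ` cohomology_class br p ` cocycles br p"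
    then obtain a where "a \<in> cocycles br p" "Y = \<phi> p (cohomology_class br p a)" by blast
    moreover obtain a' where "R p a a'" using total calculation by blast
    ultimately show "Y \<in> cohomology_class br' p ` cocycles br' p" using \<phi> cocycles by auto
  next
    fix Y assume "Y \<in> cohomology_class br' p ` cocycles br' p"
    then obtain a' where "a' \<in> cocycles br' p" "Y = cohomology_class br' p a'" by blast
    moreover obtain a where r: "R p a a'" using onto calculation by blast
    ultimately have "Y = \<phi> p (cohomology_class br p a)" using \<phi> by simp
    then show "Y \<in> \<phi> p ` cohomology_class br p ` cocycles br p" using cocycles[OF r] by blast
  qed
  show ?thesis
    unfolding graded_algebra_isomorphic_def
  proof (intro exI[of _ \<phi>] conjI allI ballI)
    show "bij_betw (\<phi> p) (component (cohomology br) p) (component (cohomology br') p)" for p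
      by (rule bij)
    show "\<phi> p (gadd (cohomology br) p X Y) = gadd (cohomology br') p (\<phi> p X) (\<phi> p Y)"
      if X: "X \<in> component (cohomology br) p" "Y \<in> component (cohomology br) p" for p X Y
    proof -
      obtain a b a' b' where ab: "X = cohomology_class br p a" "Y = cohomology_class br p b"
          "R p a a'" "R p b b'"
        using X total unfolding cohomology_component by blast
      then show ?thesis
        using cocycles[OF ab(3)] cocycles[OF ab(4)] \<phi>[OF add[OF ab(3,4)]]
        by (simp add: cohomology_gadd \<phi>)
    qed
    show "\<phi> p (gscale (cohomology br) p c X) = gscale (cohomology br') p c (\<phi> p X)"
      if X: "X \<in> component (cohomology br) p" for p c X
    proof -
      obtain a a' where a: "X = cohomology_class br p a" "R p a a'"
        using X total unfolding cohomology_component by blast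
      then show ?thesis
        using cocycles[OF a(2)] \<phi>[OF scale[OF a(2)]] by (simp add: cohomology_gscale \<phi>)
    qed
    show "\<phi> (p + q) (gmult (cohomology br) p q X Y) = gmult (cohomology br') p q (\<phi> p X) (\<phi> q Y)"
      if X: "X \<in> component (cohomology br) p" "Y \<in> component (cohomology br) q" for p q X Y
    proof -
      obtain a b a' b' where ab: "X = cohomology_class br p a" "Y = cohomology_class br q b"
          "R p a a'" "R q b b'"
        using X total unfolding cohomology_component by blast
      then show ?thesis
        using cocycles[OF ab(3)] cocycles[OF ab(4)] \<phi>[OF mult[OF ab(3,4)]]
        by (simp add: cohomology_gmult \<phi>)
    qed
    show "\<phi> 0 (gone (cohomology br)) = gone (cohomology br')"
      by (simp add: cohomology_gone \<phi>[OF one])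
  qed
qed

section \<open>Monomials on a seven-dimensional space\<close>

definition basis_vec :: "nat \<Rightarrow> real^7" where
  "basis_vec k = axis (of_nat k) 1"

definition covector :: "nat \<Rightarrow> (real^7) list \<Rightarrow> real" where
  "covector k = (\<lambda>xs. if length xs = 1 then hd xs $ of_nat k else 0)"

definition monomial :: "nat list \<Rightarrow> (real^7) list \<Rightarrow> real" where
  "monomial J = foldr (\<lambda>k. wedge (covector k)) J one_form"

lemma atLeastAtMost_1_7: "{1..7} = {1, 2, 3, 4, 5, 6, 7 :: nat}"
  by auto

lemma of_nat_7_inj: "inj_on (of_nat :: nat \<Rightarrow> 7) {1..7}"
  unfolding atLeastAtMost_1_7 inj_on_def by simp

lemma of_nat_7_surj: "(of_nat :: nat \<Rightarrow> 7) ` {1..7} = UNIV"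
  by (rule card_eq_UNIV_imp_eq_UNIV) (simp_all add: card_image[OF of_nat_7_inj] del: One_nat_def)

lemma basis_vec_nth:
  "j \<in> {1..7} \<Longrightarrow> k \<in> {1..7} \<Longrightarrow> basis_vec k $ of_nat j = (if j = k then 1 else 0)"
  using of_nat_7_inj by (auto simp: basis_vec_def axis_def inj_on_def)

lemma basis_vec_expansion: "(\<Sum>k\<in>{1..7}. v $ of_nat k *\<^sub>R basis_vec k) = v"
proof -
  have "(\<Sum>k\<in>{1..7}. v $ of_nat k *\<^sub>R basis_vec k) =
      (\<Sum>i\<in>of_nat ` {1..7::nat}. v $ i *\<^sub>R axis i 1)"
    by (simp add: sum.reindex[OF of_nat_7_inj] basis_vec_def del: One_nat_def)
  also have "\<dots> = v"
    using basis_expansion[of v] unfolding of_nat_7_surj by (simp add: scalar_mult_eq_scaleR)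
  finally show ?thesis .
qed

lemma one_form_cochain: "one_form \<in> cochains 0"
  by (simp add: cochains_def one_form_def)

lemma one_form_Nil: "one_form [] = 1"
  by (simp add: one_form_def)

lemma contract_one_form: "contract x one_form = (\<lambda>_. 0)"
  by (simp add: contract_def one_form_def)

lemma parity_one_form: "parity one_form = one_form"
  by (simp add: parity_def one_form_def fun_eq_iff)

lemma wedge_one_left: "wedge one_form \<omega> = \<omega>"
proof
  show "wedge one_form \<omega> xs = \<omega> xs" for xs
    by (induction xs arbitrary: \<omega>)
      (simp_all add: wedge_Nil wedge_Cons contract_one_form parity_one_form wedge_zero_left
        contract_apply one_form_Nil)
qed

lemma wedge_one_right: "wedge \<omega> one_form = \<omega>"
proof
  show "wedge \<omega> one_form xs = \<omega> xs" for xs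
    by (induction xs arbitrary: \<omega>)
      (simp_all add: wedge_Nil wedge_Cons contract_one_form wedge_zero_right
        contract_apply one_form_Nil)
qed

lemma covector_cochain: "covector k \<in> cochains 1"
proof -
  have "linear (\<lambda>v. covector k (xs[i := v]))" if "length xs = 1" "i < 1" for xs i
    using that by (cases xs) (auto simp: covector_def intro!: linearI)
  then show ?thesis by (auto simp: cochains_def covector_def length_Suc_conv)
qed

lemma contract_covector: "contract x (covector k) = (\<lambda>ys. x $ of_nat k * one_form ys)"
  by (auto simp: contract_def covector_def one_form_def)

lemma monomial_Nil: "monomial [] = one_form"
  by (simp add: monomial_def)

lemma monomial_Cons: "monomial (k # J) = wedge (covector k) (monomial J)"
  by (simp add: monomial_def)

lemma monomial_append: "monomial (J @ K) = wedge (monomial J) (monomial K)"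
  by (induction J) (simp_all add: monomial_Nil monomial_Cons wedge_one_left wedge_assoc)

lemma monomial_cochain: "monomial J \<in> cochains (length J)"
proof (induction J)
  case (Cons k J)
  then show ?case using wedge_cochains[OF covector_cochain[of k]] by (simp add: monomial_Cons)
qed (simp add: monomial_Nil one_form_cochain)

lemma monomial_swap: "monomial (j # k # J) = (\<lambda>xs. - monomial (k # j # J) xs)"
proof -
  have "wedge (covector j) (covector k) = (\<lambda>xs. - wedge (covector k) (covector j) xs)"
    by (rule ext, subst wedge_commute[OF covector_cochain covector_cochain]) simp
  then show ?thesis by (simp add: monomial_Cons wedge_minus_left flip: wedge_assoc)
qed

lemma monomial_repeat: "\<not> distinct J \<Longrightarrow> monomial J = (\<lambda>_. 0)"
proof (induction J)
  case (Cons k J)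
  have "monomial (k # J) = (\<lambda>_. 0)" if "k \<in> set J"
    using that
  proof (induction J)
    case (Cons j J)
    show ?case
    proof (cases "j = k")
      case True
      then show ?thesis using monomial_swap[of k k J] by (auto simp: fun_eq_iff)
    next
      case False
      then have "monomial (k # J) = (\<lambda>_. 0)" using Cons by auto
      then show ?thesis
        unfolding monomial_swap[of k j] by (simp add: monomial_Cons wedge_zero_right)
    qed
  qed simp
  then show ?case using Cons by (auto simp: monomial_Cons wedge_zero_right)
qed simp

lemma wedge_covector_sort:
  "\<exists>s \<in> {1, - 1}. wedge (covector k) (monomial J) = (\<lambda>xs. s * monomial (insort k J) xs)"
proof (induction J)
  case (Cons j J)
  show ?case
  proof (cases "k \<le> j")
    case True then show ?thesis by (auto simp: monomial_Cons intro!: bexI[of _ 1])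
  next
    case False
    obtain s where s: "s \<in> {1, - 1}" "monomial (k # J) = (\<lambda>xs. s * monomial (insort k J) xs)"
      using Cons unfolding monomial_Cons by blast
    have "monomial (k # j # J) = (\<lambda>xs. - wedge (covector j) (monomial (k # J)) xs)"
      using monomial_swap[of k j J] by (simp add: monomial_Cons)
    also have "\<dots> = (\<lambda>xs. - s * monomial (insort k (j # J)) xs)"
      unfolding s(2) using False by (simp add: wedge_cmul_right monomial_Cons)
    finally show ?thesis using s(1) by (intro bexI[of _ "- s"]) (auto simp: monomial_Cons)
  qed
qed (rule bexI[of _ 1]; simp add: monomial_Cons)

lemma monomial_sort: "\<exists>s \<in> {1, - 1}. monomial J = (\<lambda>xs. s * monomial (sort J) xs)"
proof (induction J)
  case (Cons k J)
  then obtain s where s: "s \<in> {1, - 1}" "monomial J = (\<lambda>xs. s * monomial (sort J) xs)" by blast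
  obtain t where t: "t \<in> {1, - 1}"
      "wedge (covector k) (monomial (sort J)) = (\<lambda>xs. t * monomial (insort k (sort J)) xs)"
    using wedge_covector_sort by blast
  have "monomial (k # J) = (\<lambda>xs. (s * t) * monomial (sort (k # J)) xs)"
    by (simp add: monomial_Cons s(2) wedge_cmul_right t(2) mult.assoc)
  moreover have "s * t \<in> {1, - 1}" using s(1) t(1) by auto
  ultimately show ?case by blast
qed (auto intro!: bexI[of _ 1])

section \<open>Alternating forms are determined by increasing basis tuples\<close>

lemma alternating_insort:
  assumes "alternating \<omega>"
  shows "\<bar>\<omega> (map basis_vec (insort k J))\<bar> = \<bar>\<omega> (map basis_vec (k # J))\<bar>"
  using assms
proof (induction J arbitrary: \<omega>)
  case (Cons j J)
  show ?case
  proof (cases "k \<le> j")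
    case False
    then have "\<bar>\<omega> (map basis_vec (insort k (j # J)))\<bar> =
        \<bar>contract (basis_vec j) \<omega> (map basis_vec (insort k J))\<bar>"
      by (simp add: contract_def)
    also have "\<dots> = \<bar>contract (basis_vec j) \<omega> (map basis_vec (k # J))\<bar>"
      by (rule Cons.IH[OF alternating_contract[OF Cons.prems]])
    also have "\<dots> = \<bar>\<omega> (basis_vec j # basis_vec k # map basis_vec J)\<bar>"
      by (simp add: contract_def)
    finally show ?thesis
      using alternating_swap[OF Cons.prems, of "basis_vec j" "basis_vec k"] by simp
  qed simp
qed simp

lemma alternating_sort:
  "alternating \<omega> \<Longrightarrow> \<bar>\<omega> (map basis_vec (sort J))\<bar> = \<bar>\<omega> (map basis_vec J)\<bar>"
proof (induction J arbitrary: \<omega>)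
  case (Cons k J)
  have "\<bar>\<omega> (map basis_vec (sort (k # J)))\<bar> = \<bar>contract (basis_vec k) \<omega> (map basis_vec (sort J))\<bar>"
    using alternating_insort[OF Cons.prems, of k "sort J"] by (simp add: contract_def)
  then show ?case using Cons.IH[OF alternating_contract[OF Cons.prems]] by (simp add: contract_def)
qed simp

definition indices :: "nat \<Rightarrow> nat list list" where
  "indices p = filter (\<lambda>J. length J = p) (subseqs [1..<8])"

lemma sorted_subseqs: "ys \<in> set (subseqs xs) \<Longrightarrow> sorted xs \<Longrightarrow> sorted ys"
proof (induction xs arbitrary: ys)
  case (Cons x xs)
  have "set zs \<subseteq> set xs" if "zs \<in> set (subseqs xs)" for zs
    using that subseqs_powset[of xs] by blast
  then show ?case using Cons by (auto simp: Let_def) blast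
qed simp

lemma indicesD:
  assumes "J \<in> set (indices p)"
  shows "sorted J" "distinct J" "set J \<subseteq> {1..7}" "length J = p"
proof -
  have J: "J \<in> set (subseqs [1..<8])" and "length J = p" using assms by (auto simp: indices_def)
  then show "length J = p" by simp
  show "sorted J" "distinct J" using sorted_subseqs[OF J] subseqs_distinctD[OF J] by simp_all
  have "set J \<subseteq> set [1..<8]" using J subseqs_powset[of "[1..<8]"] by blast
  then show "set J \<subseteq> {1..7}" by auto
qed

lemma indicesI:
  assumes "sorted J" "distinct J" "set J \<subseteq> {1..7}" shows "J \<in> set (indices (length J))"
proof -
  have "set J \<in> set ` set (subseqs [1..<8])" using assms by (auto simp: subseqs_powset)
  then obtain K where K: "set J = set K" "K \<in> set (subseqs [1..<8])" by auto
  then have "K \<in> set (indices (length K))" by (simp add: indices_def)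
  then have "sorted K" "distinct K" using indicesD by auto
  then have "J = K" using assms K sorted_distinct_set_unique by blast
  then show ?thesis using K by (simp add: indices_def)
qed

text \<open>By multilinearity the arguments can be replaced by basis vectors one at a time, and the
  tuples of basis vectors so obtained can be sorted.\<close>

lemma cochain_eq_0:
  assumes w: "\<omega> \<in> cochains p" and z: "\<And>J. J \<in> set (indices p) \<Longrightarrow> \<omega> (map basis_vec J) = 0"
  shows "\<omega> = (\<lambda>_. 0)"
proof -
  have alt: "alternating \<omega>" using w by (simp add: cochains_iff)
  have tuple: "\<omega> (map basis_vec J) = 0" if "set J \<subseteq> {1..7}" for J
  proof (cases "distinct J \<and> length J = p")
    case True
    then have "sort J \<in> set (indices p)" using that indicesI[of "sort J"] by simp
    then show ?thesis using alternating_sort[OF alt, of J] z by simp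
  next
    case False
    then show ?thesis using w by (auto simp: cochains_def distinct_map)
  qed
  have "\<omega> (map basis_vec J @ xs) = 0" if "set J \<subseteq> {1..7}" for J xs
    using that
  proof (induction xs arbitrary: J)
    case (Cons x xs)
    have lin: "linear (\<lambda>v. \<omega> (map basis_vec J @ v # xs))"
    proof -
      have "linear (\<lambda>v. \<omega> ((map basis_vec J @ x # xs)[length J := v]))"
        using alt unfolding alternating_def alternating_at_def
        by (metis add_Suc_right length_Cons length_append length_map less_add_Suc1)
      then show ?thesis by (simp add: list_update_append)
    qed
    have "\<omega> (map basis_vec J @ x # xs) =
        (\<Sum>k\<in>{1..7}. x $ of_nat k *\<^sub>R \<omega> (map basis_vec J @ basis_vec k # xs))"
      by (subst basis_vec_expansion[of x, symmetric])
        (simp only: linear_sum[OF lin] linear_scale[OF lin])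
    also have "\<dots> = 0"
    proof (intro sum.neutral ballI)
      fix k :: nat assume "k \<in> {1..7}"
      then show "x $ of_nat k *\<^sub>R \<omega> (map basis_vec J @ basis_vec k # xs) = 0"
        using Cons.IH[of "J @ [k]"] Cons.prems by simp
    qed
    finally show ?case .
  qed (simp add: tuple)
  from this[of "[]"] show ?thesis by (simp add: fun_eq_iff)
qed

lemma contract_monomial_0:
  "set J \<subseteq> {1..7} \<Longrightarrow> k \<in> {1..7} \<Longrightarrow> k \<notin> set J \<Longrightarrow> contract (basis_vec k) (monomial J) = (\<lambda>_. 0)"
proof (induction J)
  case (Cons j J)
  then show ?case
    by (simp add: monomial_Cons contract_wedge contract_covector basis_vec_nth wedge_zero_left
      wedge_zero_right)
qed (simp add: monomial_Nil contract_one_form)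

text \<open>If the two tuples differ, the second one has an index that the first one lacks. Contraction
  with that basis vector kills the monomial, wherever the vector stands.\<close>

lemma monomial_basis_vec:
  assumes J: "J \<in> set (indices p)" and K: "K \<in> set (indices p)"
  shows "monomial J (map basis_vec K) = (if J = K then 1 else 0)"
proof (cases "J = K")
  case True
  have "monomial J (map basis_vec J) = 1" if "distinct J" "set J \<subseteq> {1..7}" for J
    using that
  proof (induction J)
    case (Cons j J)
    then show ?case
      by (simp add: monomial_Cons wedge_Cons contract_covector basis_vec_nth wedge_cmul_left
        wedge_one_left contract_monomial_0 wedge_zero_right)
  qed (simp add: monomial_Nil one_form_def)
  then show ?thesis using True indicesD[OF J] by simp
next
  case False
  have "\<not> set K \<subseteq> set J"
  proof
    assume "set K \<subseteq> set J"
    moreover have "card (set K) = card (set J)" using indicesD[OF J] indicesD[OF K] by (simp add: distinct_card)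
    ultimately have "set K = set J" by (metis card_subset_eq List.finite_set)
    then show False using indicesD[OF J] indicesD[OF K] False sorted_distinct_set_unique by blast
  qed
  then obtain k where k: "k \<in> set K" "k \<notin> set J" by blast
  have zero: "\<omega> (map basis_vec L) = 0"
    if "alternating \<omega>" "contract (basis_vec k) \<omega> = (\<lambda>_. 0)" "k \<in> set L" for \<omega> L
    using that
  proof (induction L arbitrary: \<omega>)
    case (Cons l L)
    show ?case
    proof (cases "l = k")
      case True then show ?thesis using Cons.prems by (simp add: contract_def fun_eq_iff)
    next
      case False
      have "contract (basis_vec l) \<omega> (map basis_vec L) = 0"
      proof (rule Cons.IH)
        show "contract (basis_vec k) (contract (basis_vec l) \<omega>) = (\<lambda>_. 0)"
        proof
          fix ys
          show "contract (basis_vec k) (contract (basis_vec l) \<omega>) ys = 0"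
            using Cons.prems(2) alternating_swap[OF Cons.prems(1), of "basis_vec l" "basis_vec k" ys]
            by (simp add: contract_def fun_eq_iff)
        qed
      qed (use False Cons.prems in \<open>auto intro: alternating_contract\<close>)
      then show ?thesis by (simp add: contract_def)
    qed
  qed simp
  have "monomial J (map basis_vec K) = 0"
    using k indicesD[OF J] indicesD[OF K]
    by (intro zero contract_monomial_0) (auto intro: cochains_alternating[OF monomial_cochain])
  then show ?thesis using False by simp
qed

lemma cochain_expansion:
  assumes w: "\<omega> \<in> cochains p"
  shows "\<omega> = (\<lambda>xs. \<Sum>J\<in>set (indices p). \<omega> (map basis_vec J) * monomial J xs)"
proof -
  let ?e = "\<lambda>xs. \<Sum>J\<in>set (indices p). \<omega> (map basis_vec J) * monomial J xs"
  have "monomial J \<in> cochains p" if "J \<in> set (indices p)" for J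
    using monomial_cochain[of J] indicesD(4)[OF that] by simp
  then have "?e \<in> cochains p" by (intro cochains_sum cochains_cmul)
  then have "(\<lambda>xs. \<omega> xs + (- 1) * ?e xs) \<in> cochains p" by (intro cochains_add cochains_cmul w)
  then have "(\<lambda>xs. \<omega> xs + (- 1) * ?e xs) = (\<lambda>_. 0)"
  proof (rule cochain_eq_0)
    fix J assume J: "J \<in> set (indices p)"
    have "?e (map basis_vec J) =
        (\<Sum>K\<in>set (indices p). if K = J then \<omega> (map basis_vec J) else 0)"
      by (intro sum.cong) (auto simp: monomial_basis_vec J)
    then show "\<omega> (map basis_vec J) + (- 1) * ?e (map basis_vec J) = 0" using J by simp
  qed
  then have "\<omega> xs = ?e xs" for xs by (drule_tac x = xs in fun_cong) simp
  then show ?thesis by (rule ext)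
qed

lemma cochains_above_7:
  fixes \<omega> :: "(real^7) list \<Rightarrow> real"
  assumes "7 < p" "\<omega> \<in> cochains p" shows "\<omega> = (\<lambda>_. 0)"
proof (rule cochain_eq_0[OF assms(2)])
  fix J assume "J \<in> set (indices p)"
  then have "card (set J) \<le> card {1..7::nat}" "card (set J) = p"
    using indicesD[of J p] card_mono[of "{1..7}" "set J"] by (auto simp: distinct_card)
  then show "\<omega> (map basis_vec J) = 0" using assms(1) by simp
qed

section \<open>The volume pairing\<close>

text \<open>This functional plays the part of integration over a closed oriented manifold.\<close>

definition volume_coeff :: "((real^7) list \<Rightarrow> real) \<Rightarrow> real" where
  "volume_coeff \<omega> = \<omega> (map basis_vec [1..<8])"

lemma volume_coeff_add: "volume_coeff (\<lambda>xs. a xs + b xs) = volume_coeff a + volume_coeff b"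
  by (simp add: volume_coeff_def)

lemma volume_coeff_cmul: "volume_coeff (\<lambda>xs. c * a xs) = c * volume_coeff a"
  by (simp add: volume_coeff_def)

lemma volume_coeff_sum: "volume_coeff (\<lambda>xs. \<Sum>i\<in>I. a i xs) = (\<Sum>i\<in>I. volume_coeff (a i))"
  by (simp add: volume_coeff_def)

lemma wedge_sum_left: "wedge (\<lambda>xs. \<Sum>i\<in>I. a i xs) b = (\<lambda>xs. \<Sum>i\<in>I. wedge (a i) b xs)"
  by (induction I rule: infinite_finite_induct) (auto simp: wedge_zero_left wedge_add_left)

lemma wedge_sum_right: "wedge b (\<lambda>xs. \<Sum>i\<in>I. a i xs) = (\<lambda>xs. \<Sum>i\<in>I. wedge b (a i) xs)"
  by (induction I rule: infinite_finite_induct) (auto simp: wedge_zero_right wedge_add_right)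

lemma upt_1_8: "[1..<8] \<in> set (indices 7)"
proof -
  have "{1..<8} = {1..7::nat}" by auto
  then show ?thesis using indicesI[of "[1..<8]"] by simp
qed

lemma sorted_full: 
  assumes "distinct J" "set J \<subseteq> {1..7}" "length J = 7" shows "sort J = [1..<8]"
proof (rule sorted_distinct_set_unique)
  have "card (set J) = card {1..7::nat}" using assms by (simp add: distinct_card)
  then have "set J = {1..7}" using assms card_subset_eq[of "{1..7}" "set J"] by simp
  moreover have "{1..<8} = {1..7::nat}" by auto
  ultimately show "set (sort J) = set [1..<8]" by simp
qed (use assms in auto)

lemma volume_coeff_monomial:
  assumes "distinct J" "set J \<subseteq> {1..7}" "length J = 7"
  shows "volume_coeff (monomial J) \<noteq> 0"
proof -
  obtain s where "s \<in> {1, - 1 :: real}" "monomial J = (\<lambda>xs. s * monomial [1..<8] xs)"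
    using monomial_sort[of J] unfolding sorted_full[OF assms] by blast
  then show ?thesis using monomial_basis_vec[OF upt_1_8 upt_1_8] by (auto simp: volume_coeff_def)
qed

definition complement :: "nat list \<Rightarrow> nat list" where
  "complement J = filter (\<lambda>k. k \<notin> set J) [1..<8]"

lemma complement:
  assumes J: "J \<in> set (indices p)" and pq: "p + q = 7"
  shows "set (complement J) = {1..7} - set J" "length (complement J) = q" "distinct (complement J)"
proof -
  show s: "set (complement J) = {1..7} - set J" by (auto simp: complement_def)
  show d: "distinct (complement J)" by (simp add: complement_def)
  have "length (complement J) = card ({1..7} - set J)" using distinct_card[OF d] by (simp only: s)
  also have "\<dots> = 7 - p" using indicesD[OF J] by (simp add: card_Diff_subset distinct_card)
  finally show "length (complement J) = q" using pq by simp
qed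

lemma indices_subset_eq:
  assumes J: "J \<in> set (indices p)" and K: "K \<in> set (indices p)" and "set J \<subseteq> set K"
  shows "J = K"
proof -
  have "card (set K) = card (set J)" using indicesD[OF J] indicesD[OF K] by (simp add: distinct_card)
  then have "set J = set K" using assms(3) by (metis card_subset_eq List.finite_set)
  then show ?thesis using indicesD[OF J] indicesD[OF K] sorted_distinct_set_unique by blast
qed

lemma volume_coeff_complement_left:
  assumes J: "J \<in> set (indices p)" and K: "K \<in> set (indices p)" and pq: "p + q = 7"
  shows "volume_coeff (wedge (monomial (complement J)) (monomial K)) = 0 \<longleftrightarrow> J \<noteq> K"
proof -
  have "distinct (complement J @ K) \<longleftrightarrow> J = K"
    using complement[OF J pq] indicesD[OF J] indicesD[OF K] indices_subset_eq[OF K J] by auto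
  moreover have "volume_coeff (monomial (complement J @ K)) \<noteq> 0" if "distinct (complement J @ K)"
    using that complement[OF J pq] indicesD[OF K] pq by (intro volume_coeff_monomial) auto
  ultimately show ?thesis
    using monomial_repeat[of "complement J @ K"] by (auto simp: volume_coeff_def simp flip: monomial_append)
qed

lemma volume_coeff_complement_right:
  assumes J: "J \<in> set (indices p)" and K: "K \<in> set (indices p)" and pq: "p + q = 7"
  shows "volume_coeff (wedge (monomial K) (monomial (complement J))) = 0 \<longleftrightarrow> J \<noteq> K"
proof -
  have "monomial K \<in> cochains p" "monomial (complement J) \<in> cochains q"
    using monomial_cochain[of K] monomial_cochain[of "complement J"] indicesD[OF K] complement[OF J pq] by auto
  then show ?thesis
    using volume_coeff_complement_left[OF assms] wedge_commute[of "monomial K" p "monomial (complement J)" q]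
    by (simp add: volume_coeff_def)
qed

text \<open>The monomials of degree \<open>q\<close> and those with the complementary indices are dual bases up
  to sign.\<close>

lemma volume_pairing_represents:
  fixes f :: "((real^7) list \<Rightarrow> real) \<Rightarrow> real"
  assumes add: "\<And>a b. f (\<lambda>xs. a xs + b xs) = f a + f b" and scale: "\<And>c a. f (\<lambda>xs. c * a xs) = c * f a"
    and pq: "p + q = 7"
  obtains z where "z \<in> cochains p" "\<And>y. y \<in> cochains q \<Longrightarrow> volume_coeff (wedge z y) = f y"
proof
  let ?s = "\<lambda>J. volume_coeff (wedge (monomial (complement J)) (monomial J))"
  define z where "z = (\<lambda>xs. \<Sum>J\<in>set (indices q). f (monomial J) / ?s J * monomial (complement J) xs)"
  have qp: "q + p = 7" using pq by simp
  have "monomial (complement J) \<in> cochains p" if "J \<in> set (indices q)" for J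
    using monomial_cochain[of "complement J"] complement[OF that qp] by simp
  then show "z \<in> cochains p" unfolding z_def by (intro cochains_sum cochains_cmul)
  have zK: "volume_coeff (wedge z (monomial K)) = f (monomial K)" if K: "K \<in> set (indices q)" for K
  proof -
    have "volume_coeff (wedge z (monomial K)) =
        (\<Sum>J\<in>set (indices q). f (monomial J) / ?s J * volume_coeff (wedge (monomial (complement J)) (monomial K)))"
      unfolding z_def by (simp only: wedge_sum_left wedge_cmul_left volume_coeff_sum volume_coeff_cmul)
    also have "\<dots> = (\<Sum>J\<in>set (indices q). if J = K then f (monomial K) else 0)"
      using volume_coeff_complement_left[OF _ _ qp] K by (intro sum.cong) auto
    also have "\<dots> = f (monomial K)" using K by simp
    finally show ?thesis .
  qed
  fix y :: "(real^7) list \<Rightarrow> real" assume "y \<in> cochains q"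
  note y = cochain_expansion[OF this]
  have "volume_coeff (wedge z y) =
      (\<Sum>K\<in>set (indices q). y (map basis_vec K) * volume_coeff (wedge z (monomial K)))"
    by (subst y) (simp only: wedge_sum_right wedge_cmul_right volume_coeff_sum volume_coeff_cmul)
  also have "\<dots> = (\<Sum>K\<in>set (indices q). y (map basis_vec K) * f (monomial K))"
    by (intro sum.cong) (auto simp: zK)
  also have "\<dots> = f y"
    by (subst (2) y) (rule additive_functional_sum[OF add scale, symmetric])
  finally show "volume_coeff (wedge z y) = f y" .
qed

lemma volume_pairing_nondegenerate:
  assumes z: "z \<in> cochains p" and pq: "p + q = 7"
    and zero: "\<And>y. y \<in> cochains q \<Longrightarrow> volume_coeff (wedge z y) = 0"
  shows "z = (\<lambda>_. 0)"
proof (rule cochain_eq_0[OF z])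
  fix J assume J: "J \<in> set (indices p)"
  let ?c = "\<lambda>K. volume_coeff (wedge (monomial K) (monomial (complement J)))"
  have "monomial (complement J) \<in> cochains q"
    using monomial_cochain[of "complement J"] complement[OF J pq] by simp
  then have "0 = volume_coeff (wedge z (monomial (complement J)))" by (simp add: zero)
  also have "\<dots> = (\<Sum>K\<in>set (indices p). z (map basis_vec K) * ?c K)"
    by (subst cochain_expansion[OF z])
      (simp only: wedge_sum_left wedge_cmul_left volume_coeff_sum volume_coeff_cmul)
  also have "\<dots> = (\<Sum>K\<in>set (indices p). if K = J then z (map basis_vec J) * ?c J else 0)"
    using volume_coeff_complement_right[OF J _ pq] by (intro sum.cong) auto
  also have "\<dots> = z (map basis_vec J) * ?c J" using J by simp
  finally show "z (map basis_vec J) = 0" using volume_coeff_complement_right[OF J J pq] by simp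
qed

section \<open>Poincare duality from a contraction in low degrees\<close>

text \<open>The cocycles \<open>W q i\<close> represent a basis of the cohomology in degree \<open>q \<le> 3\<close>, with coordinate
  functionals \<open>coord q i\<close>. The last assumption is the homotopy identity
  \<open>z = \<Sum> \<pi>\<^sub>i(z) w\<^sub>i + d h z + k d z\<close> with \<open>k = K q\<close>, where \<open>h\<close> enters only through the exactness of
  \<open>d h z\<close>.\<close>

locale low_degree_contraction =
  fixes br :: "real^7 \<Rightarrow> real^7 \<Rightarrow> real^7"
    and n :: "nat \<Rightarrow> nat"
    and W :: "nat \<Rightarrow> nat \<Rightarrow> (real^7) list \<Rightarrow> real"
    and coord :: "nat \<Rightarrow> nat \<Rightarrow> ((real^7) list \<Rightarrow> real) \<Rightarrow> real"
    and K :: "nat \<Rightarrow> ((real^7) list \<Rightarrow> real) \<Rightarrow> (real^7) list \<Rightarrow> real"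
  assumes lie: "lie_algebra br"
    and unimodular: "\<And>\<omega>. \<omega> \<in> cochains 6 \<Longrightarrow> volume_coeff (coboundary br \<omega>) = 0"
    and W_cocycle: "\<And>q i. q \<le> 3 \<Longrightarrow> i < n q \<Longrightarrow> W q i \<in> cocycles br q"
    and coord_add: "\<And>q i a b. coord q i (\<lambda>xs. a xs + b xs) = coord q i a + coord q i b"
    and coord_cmul: "\<And>q i c a. coord q i (\<lambda>xs. c * a xs) = c * coord q i a"
    and coord_coboundary: "\<And>q i b. q \<le> 3 \<Longrightarrow> i < n q \<Longrightarrow> b \<in> coboundaries br q \<Longrightarrow> coord q i b = 0"
    and coord_W: "\<And>q i j. q \<le> 3 \<Longrightarrow> i < n q \<Longrightarrow> j < n q \<Longrightarrow> coord q i (W q j) = (if i = j then 1 else 0)"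
    and K_cochain: "\<And>q u. q \<le> 3 \<Longrightarrow> u \<in> cochains (Suc q) \<Longrightarrow> K q u \<in> cochains q"
    and K_add: "\<And>q a b. K q (\<lambda>xs. a xs + b xs) = (\<lambda>xs. K q a xs + K q b xs)"
    and K_cmul: "\<And>q c a. K q (\<lambda>xs. c * a xs) = (\<lambda>xs. c * K q a xs)"
    and contraction: "\<And>q z. q \<le> 3 \<Longrightarrow> z \<in> cochains q \<Longrightarrow>
      (\<lambda>xs. z xs - (\<Sum>i<n q. coord q i z * W q i xs) - K q (coboundary br z) xs) \<in> coboundaries br q"
begin

lemma K_zero: "K q (\<lambda>_. 0) = (\<lambda>_. 0)"
  using K_cmul[of q 0 "\<lambda>_. 0"] by simp

lemma cocycle_decomposition:
  assumes "q \<le> 3" "z \<in> cocycles br q"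
  obtains b where "b \<in> coboundaries br q" "z = (\<lambda>xs. (\<Sum>i<n q. coord q i z * W q i xs) + b xs)"
proof
  have dz: "coboundary br z = (\<lambda>_. 0)" "z \<in> cochains q" using assms(2) by (auto simp: cocycles_def)
  show "(\<lambda>xs. z xs - (\<Sum>i<n q. coord q i z * W q i xs)) \<in> coboundaries br q"
    using contraction[OF assms(1) dz(2)] by (simp add: dz(1) K_zero)
qed simp

lemma coboundary_iff:
  assumes "q \<le> 3" "z \<in> cocycles br q"
  shows "z \<in> coboundaries br q \<longleftrightarrow> (\<forall>i<n q. coord q i z = 0)"
proof
  assume z: "\<forall>i<n q. coord q i z = 0"
  obtain b where "b \<in> coboundaries br q" "z = (\<lambda>xs. (\<Sum>i<n q. coord q i z * W q i xs) + b xs)"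
    using cocycle_decomposition[OF assms] .
  then show "z \<in> coboundaries br q" using z by simp
qed (use coord_coboundary assms in blast)

lemma functional_on_cocycles:
  assumes add: "\<And>a b. f (\<lambda>xs. a xs + b xs) = f a + f b" and scale: "\<And>c a. f (\<lambda>xs. c * a xs) = c * f a"
    and exact: "\<And>b. b \<in> coboundaries br q \<Longrightarrow> f b = (0::real)"
    and "q \<le> 3" "z \<in> cocycles br q"
  shows "f z = (\<Sum>i<n q. coord q i z * f (W q i))"
proof -
  obtain b where b: "b \<in> coboundaries br q" "z = (\<lambda>xs. (\<Sum>i<n q. coord q i z * W q i xs) + b xs)"
    using cocycle_decomposition assms by blast
  have "f z = f (\<lambda>xs. \<Sum>i<n q. coord q i z * W q i xs) + f b" by (subst b(2)) (rule add)
  then show ?thesis using exact[OF b(1)] by (simp add: additive_functional_sum[of f, OF add scale])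
qed

lemma volume_coeff_coboundary:
  assumes "p + q = 7" "b \<in> coboundaries br 7" shows "volume_coeff b = 0"
  using assms unimodular by (auto simp: coboundaries_def eval_nat_numeral)

lemma volume_coeff_exact_left:
  assumes "p + q = 7" "b \<in> coboundaries br p" "z \<in> cocycles br q"
  shows "volume_coeff (wedge b z) = 0"
  using volume_coeff_coboundary[OF assms(1)] wedge_coboundary_left[OF assms(2,3)] assms(1) by simp

lemma volume_coeff_exact_right:
  assumes "p + q = 7" "z \<in> cocycles br p" "b \<in> coboundaries br q"
  shows "volume_coeff (wedge z b) = 0"
  using volume_coeff_coboundary[OF assms(1)] wedge_coboundary_right[OF assms(2,3)] assms(1) by simp

lemma volume_coeff_by_parts:
  assumes "a \<in> cochains p" "b \<in> cochains q" "p + q = 6"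
  shows "volume_coeff (wedge (coboundary br a) b) = - ((- 1) ^ p) * volume_coeff (wedge a (coboundary br b))"
proof -
  have "volume_coeff (coboundary br (wedge a b)) = 0"
    using unimodular wedge_cochains[OF assms(1,2)] assms(3) by simp
  then show ?thesis
    by (simp add: coboundary_wedge_cochains[OF assms(1,2)] volume_coeff_add volume_coeff_cmul)
qed

text \<open>Nondegeneracy on \<open>H\<^sup>p\<close>. By the homotopy identity \<open>\<integral> z \<and> y = \<integral> z \<and> k d y\<close>, so the functional
  \<open>y \<mapsto> \<integral> z \<and> y\<close> factors through \<open>d y\<close>. A form \<open>x\<close> that represents \<open>u \<mapsto> \<integral> z \<and> k u\<close> is then, up to
  sign, a primitive of \<open>z\<close>.\<close>

lemma coboundary_of_orthogonal:
  assumes pq: "p + q = 7" "q \<le> 3" and z: "z \<in> cocycles br p"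
    and orth: "\<And>y. y \<in> cocycles br q \<Longrightarrow> volume_coeff (wedge z y) = 0"
  shows "z \<in> coboundaries br p"
proof -
  obtain r where r: "p = Suc r" using pq by (cases p) auto
  have zc: "z \<in> cochains p" using z by (rule cocycles_cochains)
  define f where "f u = volume_coeff (wedge z (K q u))" for u
  have fadd: "f (\<lambda>xs. a xs + b xs) = f a + f b" for a b
    by (simp add: f_def K_add wedge_add_right volume_coeff_add)
  have fcmul: "f (\<lambda>xs. c * a xs) = c * f a" for c a
    by (simp add: f_def K_cmul wedge_cmul_right volume_coeff_cmul)
  have rq: "r + Suc q = 7" using pq r by simp
  obtain x where x: "x \<in> cochains r" "\<And>u. u \<in> cochains (Suc q) \<Longrightarrow> volume_coeff (wedge x u) = f u"
    using volume_pairing_represents[of f r "Suc q", OF fadd fcmul rq] by metis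
  \<comment> \<open>the sign of integration by parts\<close>
  define x' where "x' = (\<lambda>xs. (- ((- 1) ^ r)) * x xs)"
  have x': "x' \<in> cochains r" unfolding x'_def by (intro cochains_cmul x)
  have "(\<lambda>xs. z xs + (- 1) * coboundary br x' xs) = (\<lambda>_. 0)"
  proof (rule volume_pairing_nondegenerate[OF _ pq(1)])
    show "(\<lambda>xs. z xs + (- 1) * coboundary br x' xs) \<in> cochains p"
      using coboundary_cochains[OF lie x'] r by (intro cochains_add cochains_cmul zc) simp
    fix y :: "(real^7) list \<Rightarrow> real" assume y: "y \<in> cochains q"
    define b where "b = (\<lambda>xs. y xs - (\<Sum>i<n q. coord q i y * W q i xs) - K q (coboundary br y) xs)"
    have b: "b \<in> coboundaries br q" unfolding b_def by (rule contraction[OF pq(2) y])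
    let ?w = "\<lambda>xs. \<Sum>i<n q. coord q i y * W q i xs"
    have w: "?w \<in> cocycles br q"
      by (intro cocycles_sum cocycles_cmul W_cocycle pq) simp
    have "y = (\<lambda>xs. ?w xs + (b xs + K q (coboundary br y) xs))" by (simp add: b_def)
    then have "wedge z y = wedge z (\<lambda>xs. ?w xs + (b xs + K q (coboundary br y) xs))" by simp
    then have "volume_coeff (wedge z y) =
        volume_coeff (wedge z ?w) + (volume_coeff (wedge z b) + f (coboundary br y))"
      by (simp only: wedge_add_right volume_coeff_add f_def)
    also have "\<dots> = f (coboundary br y)"
      using orth[OF w] volume_coeff_exact_right[OF pq(1) z b] by simp
    also have "\<dots> = volume_coeff (wedge x (coboundary br y))"
      using x(2) coboundary_cochains[OF lie y] by simp
    also have "\<dots> = volume_coeff (wedge (coboundary br x') y)"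
    proof -
      have "r + q = 6" using pq r by simp
      from volume_coeff_by_parts[OF x' y this]
      have "volume_coeff (wedge (coboundary br x') y) =
          - ((- 1) ^ r) * (- ((- 1) ^ r) * volume_coeff (wedge x (coboundary br y)))"
        by (simp only: x'_def wedge_cmul_left volume_coeff_cmul)
      then show ?thesis by (simp add: minus_one_power_cancel)
    qed
    finally show "volume_coeff (wedge (\<lambda>xs. z xs + (- 1) * coboundary br x' xs) y) = 0"
      by (simp only: wedge_add_left wedge_cmul_left volume_coeff_add volume_coeff_cmul)
  qed
  then have "z xs = coboundary br x' xs" for xs by (drule_tac x = xs in fun_cong) simp
  then have "z = coboundary br x'" by (rule ext)
  then show ?thesis using x' r by (auto simp: coboundaries_def)
qed

text \<open>Every functional on \<open>H\<^sup>q\<close> is a pairing with a cocycle. The coordinate functionals extend it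
  to all cochains, where some form \<open>z\<close> represents it; since the functional kills exact forms,
  integration by parts shows that \<open>d z\<close> is orthogonal to everything.\<close>

lemma dual_cocycle:
  assumes pq: "p + q = 7" "q \<le> 3"
  obtains z where "z \<in> cocycles br p"
    "\<And>y. y \<in> cochains q \<Longrightarrow> volume_coeff (wedge z y) = (\<Sum>i<n q. c i * coord q i y)"
proof -
  define f where "f y = (\<Sum>i<n q. c i * coord q i y)" for y
  have fadd: "f (\<lambda>xs. a xs + b xs) = f a + f b" for a b
    by (simp add: f_def coord_add algebra_simps sum.distrib)
  have fcmul: "f (\<lambda>xs. r * a xs) = r * f a" for r a
    by (simp add: f_def coord_cmul sum_distrib_left algebra_simps)
  obtain z where z: "z \<in> cochains p" "\<And>y. y \<in> cochains q \<Longrightarrow> volume_coeff (wedge z y) = f y"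
    using volume_pairing_represents[of f p q, OF fadd fcmul pq(1)] by metis
  have "coboundary br z = (\<lambda>_. 0)"
  proof (cases q)
    case 0
    then show ?thesis
      using coboundary_cochains[OF lie z(1)] pq by (intro cochains_above_7[of "Suc p"]) auto
  next
    case (Suc r)
    show ?thesis
    proof (rule volume_pairing_nondegenerate[OF coboundary_cochains[OF lie z(1)], of r])
      show "Suc p + r = 7" using pq Suc by simp
      fix y :: "(real^7) list \<Rightarrow> real" assume y: "y \<in> cochains r"
      have dy: "coboundary br y \<in> coboundaries br q" "coboundary br y \<in> cochains q"
        using y Suc coboundary_cochains[OF lie y] by (auto simp: coboundaries_def)
      have "p + r = 6" using pq Suc by simp
      then show "volume_coeff (wedge (coboundary br z) y) = 0"
        using volume_coeff_by_parts[OF z(1) y] z(2)[OF dy(2)] coord_coboundary[OF pq(2) _ dy(1)]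
        by (simp add: f_def)
    qed
  qed
  then show ?thesis using that z unfolding f_def cocycles_def by blast
qed

lemma coord_wedge:
  assumes "p + q \<le> 3" "a \<in> cocycles br p" "b \<in> cocycles br q" "k < n (p + q)"
  shows "coord (p + q) k (wedge a b) =
    (\<Sum>i<n p. coord p i a * (\<Sum>j<n q. coord q j b * coord (p + q) k (wedge (W p i) (W q j))))"
proof -
  have "coord (p + q) k (wedge a b) = (\<Sum>i<n p. coord p i a * coord (p + q) k (wedge (W p i) b))"
    by (rule functional_on_cocycles[where f = "\<lambda>a. coord (p + q) k (wedge a b)"])
      (use assms in \<open>auto simp: wedge_add_left wedge_cmul_left coord_add coord_cmul
        intro!: coord_coboundary wedge_coboundary_left\<close>)
  also have "coord (p + q) k (wedge (W p i) b) =
      (\<Sum>j<n q. coord q j b * coord (p + q) k (wedge (W p i) (W q j)))" if "i < n p" for i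
    by (rule functional_on_cocycles[where f = "\<lambda>b. coord (p + q) k (wedge (W p i) b)"])
      (use assms that in \<open>auto simp: wedge_add_right wedge_cmul_right coord_add coord_cmul
        intro!: coord_coboundary wedge_coboundary_right W_cocycle\<close>)
  ultimately show ?thesis by simp
qed

lemma volume_coeff_wedge3:
  assumes le: "p \<le> 3" "q \<le> 3" "r \<le> 3" "p + (q + r) = 7"
    and abc: "a \<in> cocycles br p" "b \<in> cocycles br q" "c \<in> cocycles br r"
  shows "volume_coeff (wedge a (wedge b c)) =
    (\<Sum>i<n p. coord p i a * (\<Sum>j<n q. coord q j b * (\<Sum>k<n r. coord r k c *
      volume_coeff (wedge (W p i) (wedge (W q j) (W r k))))))"
proof -
  have "volume_coeff (wedge a (wedge b c)) =
      (\<Sum>i<n p. coord p i a * volume_coeff (wedge (W p i) (wedge b c)))"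
    by (rule functional_on_cocycles[where f = "\<lambda>a. volume_coeff (wedge a (wedge b c))"])
      (use le abc in \<open>auto simp: wedge_add_left wedge_cmul_left volume_coeff_add volume_coeff_cmul
        intro!: volume_coeff_exact_left wedge_cocycles\<close>)
  moreover have "volume_coeff (wedge (W p i) (wedge b c)) =
      (\<Sum>j<n q. coord q j b * volume_coeff (wedge (W p i) (wedge (W q j) c)))" if "i < n p" for i
    by (rule functional_on_cocycles[where f = "\<lambda>b. volume_coeff (wedge (W p i) (wedge b c))"])
      (use le abc that in \<open>auto simp: wedge_add_left wedge_add_right wedge_cmul_left wedge_cmul_right
        volume_coeff_add volume_coeff_cmul
        intro!: volume_coeff_exact_right[OF le(4)] wedge_coboundary_left W_cocycle\<close>)
  moreover have "volume_coeff (wedge (W p i) (wedge (W q j) c)) =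
      (\<Sum>k<n r. coord r k c * volume_coeff (wedge (W p i) (wedge (W q j) (W r k))))"
    if "i < n p" "j < n q" for i j
    by (rule functional_on_cocycles[where f = "\<lambda>c. volume_coeff (wedge (W p i) (wedge (W q j) c))"])
      (use le abc that in \<open>auto simp: wedge_add_right wedge_cmul_right
        volume_coeff_add volume_coeff_cmul
        intro!: volume_coeff_exact_right[OF le(4)] wedge_coboundary_right W_cocycle\<close>)
  ultimately show ?thesis by simp
qed

end

section \<open>Equal structure constants give isomorphic cohomology algebras\<close>

text \<open>Three degrees, each at most 3, add up to 7 only if they are \<open>1, 3, 3\<close> or \<open>2, 2, 3\<close> in some order.
  The factors \<open>t\<close> and \<open>t'\<close> normalize the two volume forms.\<close>

locale matched_contractions =
  A: low_degree_contraction br n W coord K + B: low_degree_contraction br' n W' coord' K'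
  for br br' n W W' coord coord' K K' +
  fixes t t' :: real
  assumes scale_nonzero: "t \<noteq> 0" "t' \<noteq> 0"
    and one: "n 0 = 1" "W 0 0 = one_form" "W' 0 0 = one_form"
    and products: "\<And>p q i j k. 1 \<le> p \<Longrightarrow> p \<le> q \<Longrightarrow> p + q \<le> 3 \<Longrightarrow>
      i < n p \<Longrightarrow> j < n q \<Longrightarrow> k < n (p + q) \<Longrightarrow>
      coord (p + q) k (wedge (W p i) (W q j)) = coord' (p + q) k (wedge (W' p i) (W' q j))"
    and triples: "\<And>p q r i j k. p \<le> q \<Longrightarrow> q \<le> r \<Longrightarrow> r \<le> 3 \<Longrightarrow> p + (q + r) = 7 \<Longrightarrow>
      i < n p \<Longrightarrow> j < n q \<Longrightarrow> k < n r \<Longrightarrow>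
      t' * volume_coeff (wedge (W p i) (wedge (W q j) (W r k))) =
      t * volume_coeff (wedge (W' p i) (wedge (W' q j) (W' r k)))"
begin

lemma all_products:
  assumes "p + q \<le> 3" "i < n p" "j < n q" "k < n (p + q)"
  shows "coord (p + q) k (wedge (W p i) (W q j)) = coord' (p + q) k (wedge (W' p i) (W' q j))"
proof -
  consider "p = 0" | "q = 0" | "1 \<le> p" "p \<le> q" | "1 \<le> q" "q \<le> p" by linarith
  then show ?thesis
  proof cases
    case 1
    then show ?thesis using assms one by (simp add: wedge_one_left A.coord_W B.coord_W)
  next
    case 2
    then show ?thesis using assms one by (simp add: wedge_one_right A.coord_W B.coord_W)
  next
    case 3
    then show ?thesis using products assms by blast
  next
    case 4
    have "wedge (W p i) (W q j) = (\<lambda>xs. (- 1) ^ (p * q) * wedge (W q j) (W p i) xs)"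
      "wedge (W' p i) (W' q j) = (\<lambda>xs. (- 1) ^ (p * q) * wedge (W' q j) (W' p i) xs)"
      using A.W_cocycle[of p i] A.W_cocycle[of q j] B.W_cocycle[of p i] B.W_cocycle[of q j] assms
      by (intro ext wedge_commute cocycles_cochains; simp)+
    then show ?thesis
      using products[of q p j i k] 4 assms by (simp add: A.coord_cmul B.coord_cmul add.commute)
  qed
qed

lemma all_triples:
  assumes "p \<le> 3" "q \<le> 3" "r \<le> 3" "p + (q + r) = 7" "i < n p" "j < n q" "k < n r"
  shows "t' * volume_coeff (wedge (W p i) (wedge (W q j) (W r k))) =
      t * volume_coeff (wedge (W' p i) (wedge (W' q j) (W' r k)))"
proof -
  define P where "P p q r \<longleftrightarrow> (\<forall>i<n p. \<forall>j<n q. \<forall>k<n r.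
      t' * volume_coeff (wedge (W p i) (wedge (W q j) (W r k))) =
      t * volume_coeff (wedge (W' p i) (wedge (W' q j) (W' r k))))" for p q r
  have swap: "wedge a b = (\<lambda>xs. (- 1) ^ (p * q) * wedge b a xs)"
    if "a \<in> cocycles c p" "b \<in> cocycles c q" for a b c p q
    using wedge_commute[OF that[THEN cocycles_cochains]] by (rule ext)
  have left: "P q p r" if "P p q r" "p \<le> 3" "q \<le> 3" for p q r
    unfolding P_def
  proof (intro allI impI)
    fix j i k assume ijk: "j < n q" "i < n p" "k < n r"
    have "wedge (W q j) (wedge (W p i) (W r k)) =
        (\<lambda>xs. (- 1) ^ (q * p) * wedge (W p i) (wedge (W q j) (W r k)) xs)"
      "wedge (W' q j) (wedge (W' p i) (W' r k)) =
        (\<lambda>xs. (- 1) ^ (q * p) * wedge (W' p i) (wedge (W' q j) (W' r k)) xs)"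
      using swap[OF A.W_cocycle[OF that(3) ijk(1)] A.W_cocycle[OF that(2) ijk(2)]]
        swap[OF B.W_cocycle[OF that(3) ijk(1)] B.W_cocycle[OF that(2) ijk(2)]]
      by (simp_all add: wedge_cmul_left flip: wedge_assoc)
    then show "t' * volume_coeff (wedge (W q j) (wedge (W p i) (W r k))) =
        t * volume_coeff (wedge (W' q j) (wedge (W' p i) (W' r k)))"
      using that(1) ijk by (simp add: P_def volume_coeff_cmul)
  qed
  have right: "P p r q" if "P p q r" "q \<le> 3" "r \<le> 3" for p q r
    unfolding P_def
  proof (intro allI impI)
    fix i k j assume ijk: "i < n p" "k < n r" "j < n q"
    show "t' * volume_coeff (wedge (W p i) (wedge (W r k) (W q j))) =
        t * volume_coeff (wedge (W' p i) (wedge (W' r k) (W' q j)))"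
      using that(1) ijk swap[OF A.W_cocycle[OF that(3) ijk(2)] A.W_cocycle[OF that(2) ijk(3)]]
        swap[OF B.W_cocycle[OF that(3) ijk(2)] B.W_cocycle[OF that(2) ijk(3)]]
      by (simp add: P_def volume_coeff_cmul wedge_cmul_right)
  qed
  have sorted: "P p q r" if "p \<le> q" "q \<le> r" "r \<le> 3" "p + (q + r) = 7" for p q r
    using triples[OF that] by (simp add: P_def)
  consider "p \<le> q" "q \<le> r" | "p \<le> r" "r \<le> q" | "q \<le> p" "p \<le> r" | "q \<le> r" "r \<le> p"
    | "r \<le> p" "p \<le> q" | "r \<le> q" "q \<le> p" by linarith
  then have "P p q r"
  proof cases
    case 1 then show ?thesis using sorted[of p q r] assms by simp
  next
    case 2 then show ?thesis using right[OF sorted[of p r q]] assms by simp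
  next
    case 3 then show ?thesis using left[OF sorted[of q p r]] assms by simp
  next
    case 4 then show ?thesis using left[OF right[OF sorted[of q r p]]] assms by simp
  next
    case 5 then show ?thesis using right[OF left[OF sorted[of r p q]]] assms by simp
  next
    case 6 then show ?thesis using left[OF right[OF left[OF sorted[of r q p]]]] assms by simp
  qed
  then show ?thesis using assms by (simp add: P_def)
qed

definition same_coordinates :: "nat \<Rightarrow> ((real^7) list \<Rightarrow> real) \<Rightarrow> ((real^7) list \<Rightarrow> real) \<Rightarrow> bool" where
  "same_coordinates p a a' \<longleftrightarrow> a \<in> cocycles br p \<and> a' \<in> cocycles br' p \<and> (\<forall>i<n p. coord p i a = coord' p i a')"

text \<open>In degree \<open>p \<ge> 4\<close> a class is identified with the functional that it induces on \<open>H\<close> in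
  degree \<open>7 - p\<close>.\<close>

definition corresponds :: "nat \<Rightarrow> ((real^7) list \<Rightarrow> real) \<Rightarrow> ((real^7) list \<Rightarrow> real) \<Rightarrow> bool" where
  "corresponds p a a' \<longleftrightarrow> a \<in> cocycles br p \<and> a' \<in> cocycles br' p \<and>
     (p \<le> 3 \<longrightarrow> same_coordinates p a a') \<and>
     (\<forall>q y y'. q \<le> 3 \<longrightarrow> p + q = 7 \<longrightarrow> same_coordinates q y y' \<longrightarrow>
        t' * volume_coeff (wedge a y) = t * volume_coeff (wedge a' y'))"

lemma corresponds_pairing:
  "corresponds p a a' \<Longrightarrow> q \<le> 3 \<Longrightarrow> p + q = 7 \<Longrightarrow> same_coordinates q y y' \<Longrightarrow>
    t' * volume_coeff (wedge a y) = t * volume_coeff (wedge a' y')"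
  by (simp add: corresponds_def)

lemma swapped: "matched_contractions br' br n W' W coord' coord K' K t' t"
  using scale_nonzero one products triples
  by (intro matched_contractions.intro matched_contractions_axioms.intro
    A.low_degree_contraction_axioms B.low_degree_contraction_axioms) auto

lemma same_coordinates_exists:
  assumes "q \<le> 3" "a \<in> cocycles br q" shows "\<exists>a'. same_coordinates q a a'"
proof
  let ?a' = "\<lambda>xs. \<Sum>j<n q. coord q j a * W' q j xs"
  have a': "?a' \<in> cocycles br' q"
    by (intro cocycles_sum cocycles_cmul B.W_cocycle assms) simp
  have "coord' q i ?a' = coord q i a" if "i < n q" for i
  proof -
    have "coord' q i ?a' = (\<Sum>j<n q. coord q j a * coord' q i (W' q j))"
      by (rule additive_functional_sum[OF B.coord_add B.coord_cmul])
    also have "(\<Sum>j<n q. coord q j a * coord' q i (W' q j)) = (\<Sum>j<n q. if j = i then coord q i a else 0)"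
      using B.coord_W[OF assms(1) that] by (intro sum.cong) auto
    finally show ?thesis using that by simp
  qed
  then show "same_coordinates q a ?a'" using assms a' by (simp add: same_coordinates_def)
qed

lemma corresponds_low: "p \<le> 3 \<Longrightarrow> corresponds p a a' \<longleftrightarrow> same_coordinates p a a'"
  by (auto simp: corresponds_def same_coordinates_def)

lemma corresponds_exists:
  assumes a: "a \<in> cocycles br p" shows "\<exists>a'. corresponds p a a'"
proof -
  consider "p \<le> 3" | "4 \<le> p" "p \<le> 7" | "7 < p" by linarith
  then show ?thesis
  proof cases
    case 1
    then show ?thesis using same_coordinates_exists[OF 1 a] by (simp add: corresponds_low)
  next
    case 2
    define q where "q = 7 - p"
    have q: "p + q = 7" "q \<le> 3" using 2 by (auto simp: q_def)
    \<comment> \<open>the pairings that a cocycle corresponding to \<open>a\<close> must have with the basis cocycles\<close>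
    define c where "c i = t' / t * volume_coeff (wedge a (W q i))" for i
    obtain a' where a': "a' \<in> cocycles br' p"
        "\<And>y. y \<in> cochains q \<Longrightarrow> volume_coeff (wedge a' y) = (\<Sum>i<n q. c i * coord' q i y)"
      using B.dual_cocycle[OF q] by metis
    have "t' * volume_coeff (wedge a y) = t * volume_coeff (wedge a' y')"
      if y: "same_coordinates q y y'" for y y'
    proof -
      have "volume_coeff (wedge a y) = (\<Sum>i<n q. coord q i y * volume_coeff (wedge a (W q i)))"
        by (rule A.functional_on_cocycles[where f = "\<lambda>y. volume_coeff (wedge a y)"])
          (use y q in \<open>auto simp: wedge_add_right wedge_cmul_right volume_coeff_add volume_coeff_cmul
            same_coordinates_def intro!: A.volume_coeff_exact_right[OF q(1) a]\<close>)
      then have "t' * volume_coeff (wedge a y) = (\<Sum>i<n q. t * (c i * coord q i y))"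
        using scale_nonzero by (simp add: c_def sum_distrib_left algebra_simps)
      also have "\<dots> = (\<Sum>i<n q. t * (c i * coord' q i y'))"
        using y by (intro sum.cong) (auto simp: same_coordinates_def)
      also have "\<dots> = t * volume_coeff (wedge a' y')"
      proof -
        have "y' \<in> cochains q" using y by (auto simp: same_coordinates_def intro: cocycles_cochains)
        then show ?thesis by (simp add: a'(2) sum_distrib_left)
      qed
      finally show ?thesis .
    qed
    moreover have "p + q' = 7 \<longleftrightarrow> q' = q" for q' using q by auto
    ultimately have "corresponds p a a'" using a a'(1) 2 by (simp add: corresponds_def)
    then show ?thesis by blast
  next
    case 3
    then have "corresponds p a (\<lambda>_. 0)" using a by (auto simp: corresponds_def cocycles_zero)
    then show ?thesis by blast
  qed
qed

lemma same_coordinates_wedge: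
  assumes "p + q \<le> 3" "same_coordinates p a a'" "same_coordinates q b b'"
  shows "same_coordinates (p + q) (wedge a b) (wedge a' b')"
  using assms
  by (auto simp: same_coordinates_def wedge_cocycles A.coord_wedge B.coord_wedge all_products intro!: sum.cong)

lemma coboundaries_corresponds:
  assumes r: "corresponds p a a'" and ex: "a \<in> coboundaries br p"
    and onto: "\<And>q y'. q \<le> 3 \<Longrightarrow> y' \<in> cocycles br' q \<Longrightarrow> \<exists>y. same_coordinates q y y'"
  shows "a' \<in> coboundaries br' p"
proof -
  have a: "a \<in> cocycles br p" "a' \<in> cocycles br' p" using r by (auto simp: corresponds_def)
  consider "p \<le> 3" | "4 \<le> p" "p \<le> 7" | "7 < p" by linarith
  then show ?thesis
  proof cases
    case 1
    then show ?thesis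
      using r ex A.coboundary_iff[OF 1 a(1)] B.coboundary_iff[OF 1 a(2)]
      by (auto simp: corresponds_def same_coordinates_def)
  next
    case 2
    define q where "q = 7 - p"
    have q: "p + q = 7" "q \<le> 3" using 2 by (auto simp: q_def)
    show ?thesis
    proof (rule B.coboundary_of_orthogonal[OF q a(2)])
      fix y' assume "y' \<in> cocycles br' q"
      then obtain y where y: "same_coordinates q y y'" using onto q by blast
      then have "t' * volume_coeff (wedge a y) = t * volume_coeff (wedge a' y')"
        using r q by (auto simp: corresponds_def)
      moreover have "volume_coeff (wedge a y) = 0"
        using A.volume_coeff_exact_left[OF q(1) ex] y by (auto simp: same_coordinates_def)
      ultimately show "volume_coeff (wedge a' y') = 0" using scale_nonzero by simp
    qed
  next
    case 3
    then have "a' = (\<lambda>_. 0)" using cochains_above_7 cocycles_cochains[OF a(2)] by blast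
    then show ?thesis by (simp add: coboundaries_zero)
  qed
qed

text \<open>A product of degree at least 4 is tested against a third class, of degree at most 3. If both
  factors have degree at most 3, the test is a triple product of basis classes. Otherwise the
  factor of high degree is moved to the front, and its own correspondence applies to the product
  of the other two, which has degree at most 3.\<close>

lemma corresponds_wedge:
  assumes a: "corresponds p a a'" and b: "corresponds q b b'"
  shows "corresponds (p + q) (wedge a b) (wedge a' b')"
proof -
  have ca: "a \<in> cocycles br p" "a' \<in> cocycles br' p" and cb: "b \<in> cocycles br q" "b' \<in> cocycles br' q"
    using a b by (auto simp: corresponds_def)
  have "t' * volume_coeff (wedge (wedge a b) y) = t * volume_coeff (wedge (wedge a' b') y')"
    if r: "r \<le> 3" "p + q + r = 7" and y: "same_coordinates r y y'" for r y y'
  proof -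
    have cy: "y \<in> cocycles br r" "y' \<in> cocycles br' r" using y by (auto simp: same_coordinates_def)
    consider "p \<le> 3" "q \<le> 3" | "4 \<le> p" | "4 \<le> q" by linarith
    then show ?thesis
    proof cases
      case 1
      have pqr: "p + (q + r) = 7" using r by simp
      have "coord p i a = coord' p i a'" if "i < n p" for i
        using a 1 that by (auto simp: corresponds_def same_coordinates_def)
      moreover have "coord q i b = coord' q i b'" if "i < n q" for i
        using b 1 that by (auto simp: corresponds_def same_coordinates_def)
      moreover have "coord r i y = coord' r i y'" if "i < n r" for i
        using y that by (auto simp: same_coordinates_def)
      moreover have "t' * (x * (u * (v * w))) = x * (u * (v * (t' * w)))"
        and "t * (x * (u * (v * w))) = x * (u * (v * (t * w)))" for x u v w by simp_all
      ultimately show ?thesis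
        unfolding wedge_assoc
        by (simp only: A.volume_coeff_wedge3[OF 1 r(1) pqr ca(1) cb(1) cy(1)]
            B.volume_coeff_wedge3[OF 1 r(1) pqr ca(2) cb(2) cy(2)] sum_distrib_left)
          (intro sum.cong refl, simp add: all_triples[OF 1 r(1) pqr])
    next
      case 2
      have "same_coordinates (q + r) (wedge b y) (wedge b' y')"
        using b y r 2 by (intro same_coordinates_wedge) (auto simp: corresponds_def)
      then show ?thesis using corresponds_pairing[OF a, of "q + r"] r 2 by (simp add: wedge_assoc)
    next
      case 3
      have "same_coordinates (p + r) (wedge a y) (wedge a' y')"
        using a y r 3 by (intro same_coordinates_wedge) (auto simp: corresponds_def)
      then have *: "t' * volume_coeff (wedge b (wedge a y)) = t * volume_coeff (wedge b' (wedge a' y'))"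
        using corresponds_pairing[OF b, of "p + r"] r 3 by simp
      have flip: "wedge (wedge u v) w = (\<lambda>xs. (- 1) ^ (p * q) * wedge v (wedge u w) xs)"
        if "u \<in> cochains p" "v \<in> cochains q" for u v w :: "(real^7) list \<Rightarrow> real"
      proof -
        have "wedge u v = (\<lambda>xs. (- 1) ^ (p * q) * wedge v u xs)"
          using wedge_commute[OF that] by (rule ext)
        then show ?thesis by (simp add: wedge_cmul_left wedge_assoc)
      qed
      show ?thesis
        using * ca cb by (simp add: flip cocycles_cochains volume_coeff_cmul)
    qed
  qed
  moreover have "same_coordinates (p + q) (wedge a b) (wedge a' b')" if "p + q \<le> 3"
    using same_coordinates_wedge[OF that] a b that by (auto simp: corresponds_def)
  ultimately show ?thesis
    using ca cb by (auto simp: corresponds_def wedge_cocycles)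
qed

lemma corresponds_add:
  assumes "corresponds p a a'" "corresponds p b b'"
  shows "corresponds p (\<lambda>xs. a xs + b xs) (\<lambda>xs. a' xs + b' xs)"
proof -
  have "t' * volume_coeff (wedge (\<lambda>xs. a xs + b xs) y) =
      t * volume_coeff (wedge (\<lambda>xs. a' xs + b' xs) y')"
    if "q \<le> 3" "p + q = 7" "same_coordinates q y y'" for q y y'
    using corresponds_pairing[OF assms(1) that] corresponds_pairing[OF assms(2) that]
    by (simp add: wedge_add_left volume_coeff_add distrib_left)
  moreover have "same_coordinates p (\<lambda>xs. a xs + b xs) (\<lambda>xs. a' xs + b' xs)" if "p \<le> 3"
    using assms that
    by (simp add: corresponds_low same_coordinates_def cocycles_add A.coord_add B.coord_add)
  ultimately show ?thesis using assms by (simp add: corresponds_def cocycles_add)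
qed

lemma corresponds_cmul:
  assumes "corresponds p a a'" shows "corresponds p (\<lambda>xs. c * a xs) (\<lambda>xs. c * a' xs)"
proof -
  have "t' * volume_coeff (wedge (\<lambda>xs. c * a xs) y) = t * volume_coeff (wedge (\<lambda>xs. c * a' xs) y')"
    if "q \<le> 3" "p + q = 7" "same_coordinates q y y'" for q y y'
    using corresponds_pairing[OF assms that]
    by (simp add: wedge_cmul_left volume_coeff_cmul mult.left_commute[of _ c])
  moreover have "same_coordinates p (\<lambda>xs. c * a xs) (\<lambda>xs. c * a' xs)" if "p \<le> 3"
    using assms that
    by (simp add: corresponds_low same_coordinates_def cocycles_cmul A.coord_cmul B.coord_cmul)
  ultimately show ?thesis using assms by (simp add: corresponds_def cocycles_cmul)
qed

end

theorem isomorphic_if_matched: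
  assumes "matched_contractions br br' n W W' coord coord' K K' t t'"
  shows "graded_algebra_isomorphic (cohomology br) (cohomology br')"
proof -
  interpret AB: matched_contractions br br' n W W' coord coord' K K' t t' by (rule assms)
  interpret BA: matched_contractions br' br n W' W coord' coord K' K t' t by (rule AB.swapped)
  have sym_low: "BA.same_coordinates p a' a \<longleftrightarrow> AB.same_coordinates p a a'" for p a a'
    by (auto simp: AB.same_coordinates_def BA.same_coordinates_def)
  have sym: "BA.corresponds p a' a \<longleftrightarrow> AB.corresponds p a a'" for p a a'
    unfolding AB.corresponds_def BA.corresponds_def sym_low by (auto simp: eq_commute)
  show ?thesis
  proof (rule isomorphic_if_correspondence[of AB.corresponds])
    fix p q c a a' b b'
    show "a \<in> cocycles br p \<and> a' \<in> cocycles br' p" if "AB.corresponds p a a'"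
      using that by (simp add: AB.corresponds_def)
    show "AB.corresponds p (\<lambda>xs. a xs + b xs) (\<lambda>xs. a' xs + b' xs)"
      if "AB.corresponds p a a'" "AB.corresponds p b b'"
      using that by (rule AB.corresponds_add)
    show "AB.corresponds p (\<lambda>xs. c * a xs) (\<lambda>xs. c * a' xs)" if "AB.corresponds p a a'"
      using that by (rule AB.corresponds_cmul)
    show "AB.corresponds (p + q) (wedge a b) (wedge a' b')"
      if "AB.corresponds p a a'" "AB.corresponds q b b'"
      using that by (rule AB.corresponds_wedge)
    show "\<exists>a'. AB.corresponds p a a'" if "a \<in> cocycles br p" for a
      using AB.corresponds_exists[OF that] .
    show "\<exists>a. AB.corresponds p a a'" if "a' \<in> cocycles br' p" for a'
      using BA.corresponds_exists[OF that] by (simp add: sym)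
    show "a \<in> coboundaries br p \<longleftrightarrow> a' \<in> coboundaries br' p" if "AB.corresponds p a a'"
    proof
      assume "a \<in> coboundaries br p"
      then show "a' \<in> coboundaries br' p"
        using AB.coboundaries_corresponds[OF that] BA.same_coordinates_exists sym_low by blast
    next
      assume "a' \<in> coboundaries br' p"
      then show "a \<in> coboundaries br p"
        using BA.coboundaries_corresponds[of p a' a] that AB.same_coordinates_exists sym sym_low by blast
    qed
  next
    have "AB.same_coordinates 0 one_form one_form"
      using AB.A.W_cocycle[of 0 0] AB.B.W_cocycle[of 0 0] AB.A.coord_W[of 0 0 0] AB.B.coord_W[of 0 0 0] AB.one
      by (simp add: AB.same_coordinates_def)
    then show "AB.corresponds 0 one_form one_form" by (simp add: AB.corresponds_low)
  qed
qed

section \<open>Exterior forms with polynomial coefficients\<close>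

text \<open>Coefficients are polynomials in the parameter, listed from the constant term upwards.\<close>

type_synonym coeffs = "int list"
type_synonym form = "(nat list \<times> coeffs) list"

fun padd :: "coeffs \<Rightarrow> coeffs \<Rightarrow> coeffs" where
  "padd [] q = q"
| "padd p [] = p"
| "padd (a # p) (b # q) = (a + b) # padd p q"

definition pscale :: "int \<Rightarrow> coeffs \<Rightarrow> coeffs" where
  "pscale a = map ((*) a)"

fun pmul :: "coeffs \<Rightarrow> coeffs \<Rightarrow> coeffs" where
  "pmul [] q = []"
| "pmul (a # p) q = padd (pscale a q) (0 # pmul p q)"

definition pzero :: "coeffs \<Rightarrow> bool" where
  "pzero p \<longleftrightarrow> list_all (\<lambda>a. a = 0) p"

fun insert_index :: "nat \<Rightarrow> nat list \<Rightarrow> (int \<times> nat list) list" where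
  "insert_index k [] = [(1, [k])]"
| "insert_index k (j # J) =
     (if k < j then [(1, k # j # J)] else if k = j then []
      else map (\<lambda>(s, L). (- s, j # L)) (insert_index k J))"

fun monomial_product :: "nat list \<Rightarrow> nat list \<Rightarrow> (int \<times> nat list) list" where
  "monomial_product [] J = [(1, J)]"
| "monomial_product (k # I) J =
     concat (map (\<lambda>(s, L). map (\<lambda>(t, M). (s * t, M)) (insert_index k L)) (monomial_product I J))"

fun add_term :: "nat list \<times> coeffs \<Rightarrow> form \<Rightarrow> form" where
  "add_term (J, c) [] = [(J, c)]"
| "add_term (J, c) ((L, d) # A) = (if J = L then (L, padd c d) # A else (L, d) # add_term (J, c) A)"

text \<open>Merging equal monomials makes cancellation visible to the test for zero.\<close>

definition collect :: "form \<Rightarrow> form" where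
  "collect A = foldr add_term A []"

definition form_scale :: "coeffs \<Rightarrow> form \<Rightarrow> form" where
  "form_scale c = map (\<lambda>(J, d). (J, pmul c d))"

definition form_product :: "form \<Rightarrow> form \<Rightarrow> form" where
  "form_product A B = collect (concat (map (\<lambda>(I, c). concat (map (\<lambda>(J, d).
     map (\<lambda>(s, M). (M, pscale s (pmul c d))) (monomial_product I J)) B)) A))"

definition form_zero :: "form \<Rightarrow> bool" where
  "form_zero A \<longleftrightarrow> list_all (\<lambda>(J, c). pzero c) (collect A)"

type_synonym bracket_table = "(nat \<times> nat \<times> nat \<times> coeffs) list"

definition d_covector :: "bracket_table \<Rightarrow> nat \<Rightarrow> form" where
  "d_covector T k = concat (map (\<lambda>(i, j, m, c). if m = k then [([i, j], pscale (- 1) c)] else []) T)"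

fun d_monomial :: "bracket_table \<Rightarrow> nat list \<Rightarrow> form" where
  "d_monomial T [] = []"
| "d_monomial T (k # J) = collect (form_product (d_covector T k) [(J, [1])] @
     form_product [([k], [- 1])] (d_monomial T J))"

definition d_form :: "bracket_table \<Rightarrow> form \<Rightarrow> form" where
  "d_form T A = concat (map (\<lambda>(J, c). form_scale c (d_monomial T J)) A)"

definition pairing :: "form \<Rightarrow> form \<Rightarrow> coeffs" where
  "pairing P A = foldr padd
     (concat (map (\<lambda>(J, c). concat (map (\<lambda>(L, d). if J = L then [pmul c d] else []) A)) P)) []"

definition apply_rows :: "(nat list \<times> form) list \<Rightarrow> form \<Rightarrow> form" where
  "apply_rows R A = concat (map (\<lambda>(L, d). concat (map (\<lambda>(J, B).
     if J = L then form_scale d B else []) R)) A)"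

text \<open>The data of the homotopy identity in one degree, multiplied by a common denominator. A
  functional is given by its coefficients at increasing basis tuples; the operators \<open>h\<close>
  (\<open>primitives\<close>) and \<open>k\<close> (\<open>cocontraction\<close>) are given by their values on monomials. The basis
  cocycle is the product of the two entries in \<open>classes\<close>: the first one is a scale that makes
  structure constants independent of the parameter, and keeping it apart lowers the degrees of
  the polynomials in the homotopy identity.\<close>

datatype degree_cert = Degree_Cert
  (denominator: coeffs)
  (classes: "(coeffs \<times> form) list")
  (coordinates: "form list")
  (primitives: "(nat list \<times> form) list")
  (cocontraction: "(nat list \<times> form) list")

definition basis_index :: "nat \<Rightarrow> nat list \<Rightarrow> bool" where
  "basis_index p J \<longleftrightarrow> length J = p \<and> sorted_wrt (<) J \<and> list_all (\<lambda>k. 1 \<le> k \<and> k \<le> 7) J"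

definition homogeneous :: "nat \<Rightarrow> form \<Rightarrow> bool" where
  "homogeneous p A \<longleftrightarrow> list_all (\<lambda>(J, c). basis_index p J) A"

definition contraction_identity :: "bracket_table \<Rightarrow> degree_cert \<Rightarrow> nat list \<Rightarrow> bool" where
  "contraction_identity T C J \<longleftrightarrow> homogeneous (Suc (length J)) (d_monomial T J) \<and> form_zero
     ([(J, pscale (- 1) (denominator C))] @
      concat (map (\<lambda>((s, A), P). form_scale (pairing P [(J, [1])]) A) (zip (classes C) (coordinates C))) @
      d_form T (apply_rows (primitives C) [(J, [1])]) @
      apply_rows (cocontraction C) (d_monomial T J))"

definition degree_ok :: "bracket_table \<Rightarrow> nat \<Rightarrow> degree_cert \<Rightarrow> bool" where
  "degree_ok T q C \<longleftrightarrow>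
     length (coordinates C) = length (classes C) \<and>
     list_all (\<lambda>(s, A). homogeneous q A \<and> form_zero (d_form T A)) (classes C) \<and>
     list_all (homogeneous q) (coordinates C) \<and>
     list_all (\<lambda>(J, A). q \<noteq> 0 \<and> homogeneous (q - 1) A) (primitives C) \<and>
     list_all (\<lambda>(J, A). basis_index (Suc q) J \<and> homogeneous q A) (cocontraction C) \<and>
     list_all (\<lambda>i. list_all (\<lambda>j. pzero (padd (pairing (coordinates C ! i) (snd (classes C ! j)))
       (if i = j then pscale (- 1) (denominator C) else []))) [0..<length (classes C)])
       [0..<length (classes C)] \<and>
     (q \<noteq> 0 \<longrightarrow> list_all (\<lambda>J. homogeneous q (d_monomial T J) \<and>
       list_all (\<lambda>P. pzero (pairing P (d_monomial T J))) (coordinates C)) (indices (q - 1))) \<and>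
     list_all (contraction_identity T C) (indices q)"

text \<open>The candidates for the constant ratio are read off coefficientwise.\<close>

definition proportional :: "coeffs \<Rightarrow> coeffs \<Rightarrow> bool" where
  "proportional u v \<longleftrightarrow> pzero u \<or>
     list_ex (\<lambda>(a, b). a \<noteq> 0 \<and> pzero (padd (pscale a u) (pscale (- b) v))) (zip v u)"

text \<open>The structure constants are ratios of polynomials in the parameter. They are constant if
  numerator and denominator are proportional.\<close>

definition products_ok :: "nat \<Rightarrow> degree_cert \<Rightarrow> degree_cert \<Rightarrow> degree_cert \<Rightarrow> bool" where
  "products_ok r C1 C2 C3 \<longleftrightarrow> list_all (\<lambda>(s, A). list_all (\<lambda>(t, B). let AB = form_product A B in
     homogeneous r AB \<and> list_all (\<lambda>((u, _), P). proportional (pmul s (pmul t (pairing P AB))) (pmul (denominator C3) u))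
       (zip (classes C3) (coordinates C3))) (classes C2)) (classes C1)"

definition triples_ok :: "coeffs \<Rightarrow> degree_cert \<Rightarrow> degree_cert \<Rightarrow> degree_cert \<Rightarrow> bool" where
  "triples_ok v C1 C2 C3 \<longleftrightarrow> list_all (\<lambda>(t, B). list_all (\<lambda>(u, C). let BC = form_product B C in
     list_all (\<lambda>(s, A). let ABC = form_product A BC in homogeneous 7 ABC \<and>
       proportional (pmul s (pmul t (pmul u (pairing [([1..<8], [1])] ABC)))) v)
       (classes C1)) (classes C3)) (classes C2)"

definition nonvanishing :: "degree_cert \<Rightarrow> bool" where
  "nonvanishing C \<longleftrightarrow> \<not> pzero (denominator C) \<and> list_all (\<lambda>(s, A). \<not> pzero s) (classes C)"

definition trivial_cert :: degree_cert where
  "trivial_cert = Degree_Cert [1] [([1], [([], [1])])] [[([], [1])]] [] []"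


fun peval :: "real \<Rightarrow> coeffs \<Rightarrow> real" where
  "peval x [] = 0"
| "peval x (a # p) = of_int a + x * peval x p"

lemma peval_padd: "peval x (padd p q) = peval x p + peval x q"
  by (induction p q rule: padd.induct) (simp_all add: algebra_simps)

lemma peval_pscale: "peval x (pscale a p) = of_int a * peval x p"
  by (induction p) (simp_all add: pscale_def algebra_simps)

lemma peval_pmul: "peval x (pmul p q) = peval x p * peval x q"
  by (induction p q rule: pmul.induct) (simp_all add: peval_padd peval_pscale algebra_simps)

lemma peval_pzero: "pzero p \<Longrightarrow> peval x p = 0"
  by (induction p) (simp_all add: pzero_def)

lemma peval_poly: "peval x p = poly (Poly (map of_int p)) x"
  by (induction p) simp_all

lemma finite_roots: "\<not> pzero p \<Longrightarrow> finite {x. peval x p = 0}"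
proof -
  assume "\<not> pzero p"
  then obtain i where "i < length p" "p ! i \<noteq> 0"
    by (auto simp: pzero_def list_all_length)
  then have "coeff (Poly (map real_of_int p)) i \<noteq> 0"
    by (simp add: nth_default_def)
  then have "Poly (map real_of_int p) \<noteq> 0" by (metis coeff_0)
  then show ?thesis unfolding peval_poly by (rule poly_roots_finite)
qed

definition eval_form :: "real \<Rightarrow> form \<Rightarrow> (real^7) list \<Rightarrow> real" where
  "eval_form x A = (\<lambda>xs. \<Sum>(J, c)\<leftarrow>A. peval x c * monomial J xs)"

definition eval_terms :: "(int \<times> nat list) list \<Rightarrow> (real^7) list \<Rightarrow> real" where
  "eval_terms S = (\<lambda>xs. \<Sum>(s, L)\<leftarrow>S. of_int s * monomial L xs)"

lemma eval_terms_Nil: "eval_terms [] = (\<lambda>_. 0)"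
  by (simp add: eval_terms_def)

lemma eval_terms_Cons: "eval_terms ((s, L) # S) = (\<lambda>xs. of_int s * monomial L xs + eval_terms S xs)"
  by (simp add: eval_terms_def)

lemma eval_terms_append: "eval_terms (S @ S') = (\<lambda>xs. eval_terms S xs + eval_terms S' xs)"
  by (simp add: eval_terms_def)

lemma eval_form_Nil: "eval_form x [] = (\<lambda>_. 0)"
  by (simp add: eval_form_def)

lemma eval_form_Cons: "eval_form x ((J, c) # A) = (\<lambda>xs. peval x c * monomial J xs + eval_form x A xs)"
  by (simp add: eval_form_def)

lemma eval_form_append: "eval_form x (A @ B) = (\<lambda>xs. eval_form x A xs + eval_form x B xs)"
  by (simp add: eval_form_def)

lemma eval_add_term:
  "eval_form x (add_term (J, c) A) = (\<lambda>xs. peval x c * monomial J xs + eval_form x A xs)"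
  by (induction A) (auto simp: eval_form_Nil eval_form_Cons peval_padd algebra_simps)

lemma eval_collect: "eval_form x (collect A) = eval_form x A"
  unfolding collect_def
  by (induction A) (auto simp: eval_form_Nil eval_form_Cons eval_add_term)

lemma eval_form_scale: "eval_form x (form_scale c A) = (\<lambda>xs. peval x c * eval_form x A xs)"
  unfolding form_scale_def
  by (induction A) (auto simp: eval_form_Nil eval_form_Cons peval_pmul algebra_simps)

lemma eval_form_zero: assumes "form_zero A" shows "eval_form x A = (\<lambda>_. 0)"
proof -
  have "eval_form x B = (\<lambda>_. 0)" if "list_all (\<lambda>(J, c). pzero c) B" for B
    using that by (induction B) (auto simp: eval_form_Nil eval_form_Cons peval_pzero)
  from this[of "collect A"] show ?thesis using assms by (simp add: eval_collect form_zero_def)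
qed

lemma wedge_covector_monomial:
  "wedge (covector k) (monomial J) = eval_terms (insert_index k J)"
proof (induction J)
  case (Cons j J)
  have neg: "eval_terms (map (\<lambda>(s, L). (- s, j # L)) S) = (\<lambda>xs. - wedge (covector j) (eval_terms S) xs)" for S
    by (induction S)
      (auto simp: eval_terms_Nil eval_terms_Cons monomial_Cons wedge_zero_right wedge_add_right
        wedge_cmul_right)
  consider "k < j" | "k = j" | "j < k" by linarith
  then show ?case
  proof cases
    case 1 then show ?thesis by (simp add: eval_terms_def monomial_Cons)
  next
    case 2
    then show ?thesis using monomial_repeat[of "k # j # J"] by (simp add: eval_terms_def monomial_Cons)
  next
    case 3
    then show ?thesis using monomial_swap[of k j J] by (simp add: neg Cons[symmetric] monomial_Cons)
  qed
qed (simp add: eval_terms_def monomial_Cons)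

lemma wedge_monomials: "wedge (monomial I) (monomial J) = eval_terms (monomial_product I J)"
proof (induction I)
  case (Cons k I)
  have scale: "eval_terms (map (\<lambda>(t, M). (s * t, M)) S) = (\<lambda>xs. of_int s * eval_terms S xs)" for s S
    by (induction S) (auto simp: eval_terms_Nil eval_terms_Cons distrib_left mult.assoc)
  have "wedge (covector k) (eval_terms S) =
      eval_terms (concat (map (\<lambda>(s, L). map (\<lambda>(t, M). (s * t, M)) (insert_index k L)) S))" for S
  proof (induction S)
    case (Cons a S)
    obtain s L where a: "a = (s, L)" by fastforce
    show ?case
      by (simp add: a eval_terms_Cons eval_terms_append wedge_add_right wedge_cmul_right Cons
        wedge_covector_monomial scale)
  qed (simp add: eval_terms_Nil wedge_zero_right)
  then show ?case by (simp add: monomial_Cons wedge_assoc Cons)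
qed (simp add: monomial_Nil wedge_one_left eval_terms_Nil eval_terms_Cons)

lemma eval_form_product: "eval_form x (form_product A B) = wedge (eval_form x A) (eval_form x B)"
proof -
  have terms: "eval_form x (map (\<lambda>(s, M). (M, pscale s c)) S) = (\<lambda>xs. peval x c * eval_terms S xs)" for c S
    by (induction S) (auto simp: eval_form_Nil eval_form_Cons eval_terms_Nil eval_terms_Cons
      peval_pscale distrib_left mult.assoc mult.left_commute)
  have row: "eval_form x (concat (map (\<lambda>(J, d). map (\<lambda>(s, M). (M, pscale s (pmul c d)))
      (monomial_product I J)) B)) = (\<lambda>xs. peval x c * wedge (monomial I) (eval_form x B) xs)" for I c
    by (induction B)
      (auto simp: eval_form_Nil eval_form_Cons eval_form_append terms wedge_zero_right wedge_add_right
        wedge_cmul_right wedge_monomials peval_pmul distrib_left mult.assoc)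
  have "eval_form x (concat (map (\<lambda>(I, c). concat (map (\<lambda>(J, d). map (\<lambda>(s, M). (M, pscale s (pmul c d)))
      (monomial_product I J)) B)) A)) = wedge (eval_form x A) (eval_form x B)"
    by (induction A)
      (auto simp: eval_form_Nil eval_form_Cons eval_form_append row wedge_zero_left wedge_add_left
        wedge_cmul_left)
  then show ?thesis by (simp add: form_product_def eval_collect)
qed

lemma basis_index_iff: "basis_index p J \<longleftrightarrow> J \<in> set (indices p)"
proof
  assume J: "basis_index p J"
  then have "set J \<subseteq> {1..7}" by (auto simp: basis_index_def list_all_iff)
  then show "J \<in> set (indices p)"
    using indicesI[of J] J by (auto simp: basis_index_def strict_sorted_iff)
next
  assume "J \<in> set (indices p)"
  then show "basis_index p J"
    using indicesD[of J p] by (auto simp: basis_index_def list_all_iff strict_sorted_iff)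
qed

lemma homogeneous_Cons: "homogeneous p ((J, c) # A) \<longleftrightarrow> J \<in> set (indices p) \<and> homogeneous p A"
  by (simp add: homogeneous_def basis_index_iff)

lemma eval_form_cochain: "homogeneous p A \<Longrightarrow> eval_form x A \<in> cochains p"
proof (induction A)
  case (Cons a A)
  obtain J c where a: "a = (J, c)" by fastforce
  have J: "J \<in> set (indices p)" "homogeneous p A" using Cons.prems by (auto simp: a homogeneous_Cons)
  then have "monomial J \<in> cochains p" using monomial_cochain[of J] indicesD(4)[OF J(1)] by simp
  then show ?case using Cons.IH J by (simp add: a eval_form_Cons cochains_add cochains_cmul)
qed (simp add: eval_form_Nil cochains_zero)

section \<open>The coboundary of a bracket given by a table\<close>

definition real_table :: "real \<Rightarrow> bracket_table \<Rightarrow> (7 \<times> 7 \<times> 7 \<times> real) list" where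
  "real_table x T = map (\<lambda>(i, j, k, c). (of_nat i, of_nat j, of_nat k, peval x c)) T"

abbreviation table_bracket :: "real \<Rightarrow> bracket_table \<Rightarrow> real^7 \<Rightarrow> real^7 \<Rightarrow> real^7" where
  "table_bracket x T \<equiv> bracket_of_table (real_table x T)"

text \<open>The second condition, that forms of degree 6 are closed, is unimodularity.\<close>

definition table_ok :: "bracket_table \<Rightarrow> bool" where
  "table_ok T \<longleftrightarrow> list_all (\<lambda>(i, j, k, c). 1 \<le> k \<and> k \<le> 7) T \<and>
     list_all (\<lambda>J. form_zero (d_monomial T J)) (indices 6)"

lemma coboundary_covector:
  assumes T: "list_all (\<lambda>(i, j, k, c). 1 \<le> k \<and> k \<le> 7) T" and k: "k \<in> {1..7}"
  shows "coboundary (table_bracket x T) (covector k) = eval_form x (d_covector T k)"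
proof
  fix xs :: "(real^7) list"
  let ?br = "table_bracket x T"
  have wedge2: "monomial [i, j] [u, v] = u $ of_nat i * v $ of_nat j - u $ of_nat j * v $ of_nat i"
    for i j u v
    by (simp add: monomial_Cons monomial_Nil wedge_one_right wedge_Cons wedge_Nil contract_apply
        parity_def covector_def)
  show "coboundary ?br (covector k) xs = eval_form x (d_covector T k) xs"
  proof (cases "length xs = 2")
    case False
    have "monomial [i, j] xs = 0" for i j
      using monomial_cochain[of "[i, j]"] False by (simp add: cochains_def)
    then have "eval_form x (d_covector T k) xs = 0"
      unfolding d_covector_def by (induction T) (auto simp: eval_form_Nil eval_form_Cons eval_form_append)
    then show ?thesis using coboundary_support[OF covector_cochain] False by simp
  next
    case True
    then obtain u v where xs: "xs = [u, v]" by (auto simp: length_Suc_conv numeral_2_eq_2)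
    have "coboundary ?br (covector k) xs = - (?br u v $ of_nat k)"
      by (simp add: cochains_alternating[OF covector_cochain] xs coboundary_Cons alternating_contract lie_action_Cons lie_action_Nil coboundary_Nil)
        (simp add: covector_def)
    also have "\<dots> = eval_form x (d_covector T k) xs"
      using T unfolding d_covector_def real_table_def bracket_of_table_def
    proof (induction T)
      case (Cons a T)
      obtain i j m c where a: "a = (i, j, m, c)" by (cases a) auto
      have "(of_nat k :: 7) = of_nat m \<longleftrightarrow> k = m"
        using of_nat_7_inj k Cons.prems by (auto simp: a inj_on_def)
      then show ?case
        using Cons by (auto simp: a eval_form_append eval_form_Cons eval_form_Nil peval_pscale xs wedge2 axis_def)
    qed (simp add: eval_form_Nil)
    finally show ?thesis .
  qed
qed

lemma coboundary_monomial:
  assumes T: "list_all (\<lambda>(i, j, k, c). 1 \<le> k \<and> k \<le> 7) T" and "set J \<subseteq> {1..7}"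
  shows "coboundary (table_bracket x T) (monomial J) = eval_form x (d_monomial T J)"
  using assms(2)
proof (induction J)
  case Nil
  show ?case
  proof
    fix xs
    show "coboundary (table_bracket x T) (monomial []) xs = eval_form x (d_monomial T []) xs"
    proof (cases xs)
      case (Cons y ys)
      have "lie_action (table_bracket x T) y one_form ys = 0"
        by (auto simp: lie_action_def one_form_def)
      then show ?thesis
        by (simp add: cochains_alternating[OF one_form_cochain] Cons monomial_Nil eval_form_Nil coboundary_Cons contract_one_form coboundary_zero)
    qed (simp add: coboundary_Nil eval_form_Nil)
  qed
next
  case (Cons k J)
  have k: "k \<in> {1..7}" using Cons.prems by simp
  have IH: "coboundary (table_bracket x T) (monomial J) = eval_form x (d_monomial T J)"
    using Cons by simp
  show ?case
    by (simp add: monomial_Cons coboundary_wedge_cochains[OF covector_cochain monomial_cochain] IH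
        coboundary_covector[OF T k] eval_collect eval_form_append eval_form_product eval_form_Cons
        eval_form_Nil monomial_Nil wedge_one_right wedge_cmul_left wedge_minus_left)
qed

lemma coboundary_form:
  assumes T: "list_all (\<lambda>(i, j, k, c). 1 \<le> k \<and> k \<le> 7) T"
  shows "homogeneous p A \<Longrightarrow>
    coboundary (table_bracket x T) (eval_form x A) = eval_form x (d_form T A)"
proof (induction A)
  case (Cons a A)
  obtain J c where a: "a = (J, c)" by fastforce
  have J: "set J \<subseteq> {1..7}" "homogeneous p A"
    using Cons.prems indicesD(3) by (auto simp: a homogeneous_Cons)
  then show ?case
    using Cons.IH by (simp add: a d_form_def eval_form_Cons eval_form_append eval_form_scale
      coboundary_add coboundary_cmul coboundary_monomial[OF T])
qed (simp add: d_form_def eval_form_Nil coboundary_zero)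

section \<open>Soundness of the certificates\<close>

definition functional :: "real \<Rightarrow> form \<Rightarrow> ((real^7) list \<Rightarrow> real) \<Rightarrow> real" where
  "functional x P z = (\<Sum>(J, c)\<leftarrow>P. peval x c * z (map basis_vec J))"

definition apply_rows_at ::
    "real \<Rightarrow> (nat list \<times> form) list \<Rightarrow> ((real^7) list \<Rightarrow> real) \<Rightarrow> (real^7) list \<Rightarrow> real" where
  "apply_rows_at x R z = (\<lambda>xs. \<Sum>(J, B)\<leftarrow>R. z (map basis_vec J) * eval_form x B xs)"

lemma apply_rows_at_Nil: "apply_rows_at x [] z = (\<lambda>_. 0)"
  by (simp add: apply_rows_at_def)

lemma apply_rows_at_Cons:
  "apply_rows_at x ((J, B) # R) z =
     (\<lambda>xs. z (map basis_vec J) * eval_form x B xs + apply_rows_at x R z xs)"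
  by (simp add: apply_rows_at_def)

lemma functional_add: "functional x P (\<lambda>xs. a xs + b xs) = functional x P a + functional x P b"
  unfolding functional_def by (induction P) (auto simp: algebra_simps)

lemma functional_cmul: "functional x P (\<lambda>xs. c * a xs) = c * functional x P a"
  unfolding functional_def by (induction P) (auto simp: algebra_simps)

lemma apply_rows_at_add:
  "apply_rows_at x R (\<lambda>xs. a xs + b xs) = (\<lambda>xs. apply_rows_at x R a xs + apply_rows_at x R b xs)"
  by (rule ext, induction R) (auto simp: apply_rows_at_def algebra_simps)

lemma apply_rows_at_cmul: "apply_rows_at x R (\<lambda>xs. c * a xs) = (\<lambda>xs. c * apply_rows_at x R a xs)"
  by (rule ext, induction R) (auto simp: apply_rows_at_def algebra_simps)

lemma functional_zero: "functional x P (\<lambda>_. 0) = 0"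
  using functional_cmul[of x P 0 "\<lambda>_. 0"] by simp

lemma peval_pairing:
  assumes P: "homogeneous p P" and A: "homogeneous p A"
  shows "peval x (pairing P A) = functional x P (eval_form x A)"
proof -
  have sum: "peval x (foldr padd ps []) = (\<Sum>q\<leftarrow>ps. peval x q)" for ps
    by (induction ps) (auto simp: peval_padd)
  have row: "(\<Sum>q\<leftarrow>concat (map (\<lambda>(L, d). if J = L then [pmul c d] else []) A). peval x q) =
      peval x c * eval_form x A (map basis_vec J)" if "J \<in> set (indices p)" for J c
    using A by (induction A)
      (auto simp: homogeneous_Cons eval_form_Nil eval_form_Cons peval_pmul monomial_basis_vec[of _ p] that
        algebra_simps)
  show ?thesis
    unfolding pairing_def sum functional_def using P
    by (induction P) (auto simp: homogeneous_Cons row)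
qed

lemma eval_apply_rows:
  assumes R: "list_all (\<lambda>(J, B). basis_index p J) R" and A: "homogeneous p A"
  shows "eval_form x (apply_rows R A) = apply_rows_at x R (eval_form x A)"
proof -
  have row: "eval_form x (concat (map (\<lambda>(J, B). if J = L then form_scale d B else []) R)) =
      (\<lambda>xs. peval x d * apply_rows_at x R (monomial L) xs)" if "L \<in> set (indices p)" for L d
    using R
    by (induction R)
      (auto simp: apply_rows_at_Nil apply_rows_at_Cons basis_index_iff eval_form_Nil eval_form_append eval_form_scale monomial_basis_vec[of _ p] that
        algebra_simps)
  have zero: "apply_rows_at x R (\<lambda>_. 0) = (\<lambda>_. 0)"
    using apply_rows_at_cmul[of x R 0 "\<lambda>_. 0"] by simp
  show ?thesis
    unfolding apply_rows_def using A
    by (induction A)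
      (auto simp: homogeneous_Cons eval_form_Nil eval_form_Cons eval_form_append row zero
        apply_rows_at_add apply_rows_at_cmul)
qed

lemma apply_rows_at_cochain:
  "list_all (\<lambda>(J, A). homogeneous q A) R \<Longrightarrow> apply_rows_at x R z \<in> cochains q"
proof (induction R)
  case (Cons r R)
  then show ?case
    by (cases r) (simp add: apply_rows_at_Cons cochains_add cochains_cmul eval_form_cochain)
qed (simp add: apply_rows_at_Nil cochains_zero)

lemma apply_rows_homogeneous:
  assumes "list_all (\<lambda>(J, A). homogeneous q A) R" shows "homogeneous q (apply_rows R A)"
proof -
  have scale: "homogeneous q (form_scale d B) \<longleftrightarrow> homogeneous q B" for d B
    by (auto simp: homogeneous_def form_scale_def list_all_iff)
  have append: "homogeneous q (B @ D) \<longleftrightarrow> homogeneous q B \<and> homogeneous q D" for B D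
    by (simp add: homogeneous_def)
  have nil: "homogeneous q []" by (simp add: homogeneous_def)
  have "homogeneous q (concat (map (\<lambda>(J, B). if J = L then form_scale d B else []) R))" for L d
    using assms by (induction R) (auto simp: scale append nil)
  then show ?thesis
    unfolding apply_rows_def by (induction A) (auto simp: append nil)
qed

definition class_at :: "real \<Rightarrow> degree_cert \<Rightarrow> nat \<Rightarrow> (real^7) list \<Rightarrow> real" where
  "class_at x C i = (\<lambda>xs. peval x (fst (classes C ! i)) * eval_form x (snd (classes C ! i)) xs)"

definition coordinate_at :: "real \<Rightarrow> degree_cert \<Rightarrow> nat \<Rightarrow> ((real^7) list \<Rightarrow> real) \<Rightarrow> real" where
  "coordinate_at x C i z =
     functional x (coordinates C ! i) z / (peval x (denominator C) * peval x (fst (classes C ! i)))"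

definition cocontraction_at ::
    "real \<Rightarrow> degree_cert \<Rightarrow> ((real^7) list \<Rightarrow> real) \<Rightarrow> (real^7) list \<Rightarrow> real" where
  "cocontraction_at x C z = (\<lambda>xs. apply_rows_at x (cocontraction C) z xs / peval x (denominator C))"

definition generic :: "real \<Rightarrow> degree_cert \<Rightarrow> bool" where
  "generic x C \<longleftrightarrow> peval x (denominator C) \<noteq> 0 \<and> (\<forall>(s, A) \<in> set (classes C). peval x s \<noteq> 0)"

lemma generic_scale: "generic x C \<Longrightarrow> i < length (classes C) \<Longrightarrow> peval x (fst (classes C ! i)) \<noteq> 0"
  unfolding generic_def using nth_mem by fastforce

context
  fixes T :: bracket_table and x :: real and q :: nat and C :: degree_cert
  assumes T: "table_ok T" and C: "degree_ok T q C" and x: "generic x C"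
begin

lemma table_indices: "list_all (\<lambda>(i, j, k, c). 1 \<le> k \<and> k \<le> 7) T"
  using T by (simp add: table_ok_def)

lemma length_coordinates: "length (coordinates C) = length (classes C)"
  using C by (simp add: degree_ok_def)

lemma homogeneous_class: "i < length (classes C) \<Longrightarrow> homogeneous q (snd (classes C ! i))"
  using C by (auto simp: degree_ok_def list_all_length case_prod_beta)

lemma homogeneous_coordinate: "i < length (classes C) \<Longrightarrow> homogeneous q (coordinates C ! i)"
  using C by (auto simp: degree_ok_def list_all_length)

lemma class_at_cocycle:
  assumes i: "i < length (classes C)" shows "class_at x C i \<in> cocycles (table_bracket x T) q"
proof -
  have "form_zero (d_form T (snd (classes C ! i)))"
    using C i by (auto simp: degree_ok_def list_all_length case_prod_beta)
  then have "eval_form x (snd (classes C ! i)) \<in> cocycles (table_bracket x T) q"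
    using homogeneous_class[OF i]
    by (simp add: cocycles_def eval_form_cochain coboundary_form[OF table_indices] eval_form_zero)
  then show ?thesis unfolding class_at_def by (rule cocycles_cmul)
qed

lemma coordinate_at_class_at:
  assumes ij: "i < length (classes C)" "j < length (classes C)"
  shows "coordinate_at x C i (class_at x C j) = (if i = j then 1 else 0)"
proof -
  have "pzero (padd (pairing (coordinates C ! i) (snd (classes C ! j)))
      (if i = j then pscale (- 1) (denominator C) else []))"
    using C ij by (auto simp: degree_ok_def list_all_iff)
  from peval_pzero[OF this, of x]
  have "functional x (coordinates C ! i) (eval_form x (snd (classes C ! j))) =
      (if i = j then peval x (denominator C) else 0)"
    using peval_pairing[OF homogeneous_coordinate[OF ij(1)] homogeneous_class[OF ij(2)], of x]
    by (auto simp: peval_padd peval_pscale)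
  then show ?thesis
    using x generic_scale[OF x ij(2)]
    by (simp add: coordinate_at_def class_at_def functional_cmul generic_def)
qed

lemma coordinate_at_coboundary:
  assumes i: "i < length (classes C)" and b: "b \<in> coboundaries (table_bracket x T) q"
  shows "coordinate_at x C i b = 0"
proof (cases q)
  case 0
  then show ?thesis using b by (simp add: coboundaries_def coordinate_at_def functional_zero)
next
  case (Suc r)
  then obtain y where y: "y \<in> cochains r" "b = coboundary (table_bracket x T) y" using b by (auto simp: coboundaries_def)
  let ?f = "\<lambda>z. functional x (coordinates C ! i) (coboundary (table_bracket x T) z)"
  have mon: "?f (monomial J) = 0" if J: "J \<in> set (indices r)" for J
  proof -
    have "homogeneous q (d_monomial T J)" "pzero (pairing (coordinates C ! i) (d_monomial T J))"
      using C J Suc i length_coordinates by (auto simp: degree_ok_def list_all_iff)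
    then show ?thesis
      using peval_pairing[OF homogeneous_coordinate[OF i], of "d_monomial T J" x] indicesD(3)[OF J]
      by (simp add: coboundary_monomial[OF table_indices] peval_pzero)
  qed
  have "?f y = ?f (\<lambda>xs. \<Sum>J\<in>set (indices r). y (map basis_vec J) * monomial J xs)"
    by (subst cochain_expansion[OF y(1)]) (rule refl)
  also have "\<dots> = (\<Sum>J\<in>set (indices r). y (map basis_vec J) * ?f (monomial J))"
    by (rule additive_functional_sum)
      (simp_all add: coboundary_add coboundary_cmul functional_add functional_cmul)
  also have "\<dots> = 0" using mon by simp
  finally show ?thesis by (simp add: y(2) coordinate_at_def)
qed

lemma cocontraction_at_cochain: "cocontraction_at x C z \<in> cochains q"
proof -
  have "list_all (\<lambda>(J, A). homogeneous q A) (cocontraction C)"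
    using C by (auto simp: degree_ok_def list_all_iff)
  from cochains_cmul[OF apply_rows_at_cochain[OF this, of x z], of "1 / peval x (denominator C)"]
  show ?thesis by (simp add: cocontraction_at_def)
qed

text \<open>The expression is linear in \<open>z\<close>, and on monomials its primitive is recorded.\<close>

lemma contraction_at:
  assumes z: "z \<in> cochains q"
  shows "(\<lambda>xs. z xs - (\<Sum>i<length (classes C). coordinate_at x C i z * class_at x C i xs)
    - cocontraction_at x C (coboundary (table_bracket x T) z) xs) \<in> coboundaries (table_bracket x T) q"
proof -
  let ?D = "peval x (denominator C)"
  let ?n = "length (classes C)"
  let ?A = "\<lambda>i. eval_form x (snd (classes C ! i))"
  let ?P = "\<lambda>i. functional x (coordinates C ! i)"
  let ?R = "apply_rows_at x (cocontraction C)"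
  let ?h = "\<lambda>J. eval_form x (apply_rows (primitives C) [(J, [1])])"
  define g where "g xs z = (\<Sum>i<?n. ?P i z * ?A i xs) + ?R (coboundary (table_bracket x T) z) xs - ?D * z xs" for xs z
  define y where "y = (\<lambda>xs. \<Sum>J\<in>set (indices q). z (map basis_vec J) * ?h J xs)"
  have zip_sum: "eval_form x (concat (map (\<lambda>((s, A), P). form_scale (pairing P B) A) (zip (classes C) (coordinates C))))
      xs = (\<Sum>i<?n. peval x (pairing (coordinates C ! i) B) * ?A i xs)" for B xs
  proof -
    have sum: "eval_form x (concat (map (\<lambda>((s, A), P). form_scale (pairing P B) A) W)) xs =
        (\<Sum>((s, A), P)\<leftarrow>W. peval x (pairing P B) * eval_form x A xs)" for W
      by (induction W) (auto simp: eval_form_Nil eval_form_append eval_form_scale)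
    show ?thesis
      unfolding sum sum_list_sum_nth
      using length_coordinates by (simp add: case_prod_beta atLeast0LessThan)
  qed
  have mono: "g xs (monomial J) = - coboundary (table_bracket x T) (?h J) xs" if J: "J \<in> set (indices q)" for xs J
  proof -
    have id: "contraction_identity T C J" using C J by (auto simp: degree_ok_def list_all_iff)
    have J': "homogeneous q [(J, [1])]" "eval_form x [(J, [1])] = monomial J" "set J \<subseteq> {1..7}"
      using J indicesD(3)[OF J] by (auto simp: homogeneous_Cons homogeneous_def[of _ "[]"] eval_form_Cons eval_form_Nil)
    have hom: "homogeneous (Suc q) (d_monomial T J)"
      using id indicesD(4)[OF J] by (simp add: contraction_identity_def)
    have prim: "list_all (\<lambda>(J, A). homogeneous (q - 1) A) (primitives C)"
      using C by (auto simp: degree_ok_def list_all_iff)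
    have keys: "list_all (\<lambda>(J, B). basis_index (Suc q) J) (cocontraction C)"
      using C by (auto simp: degree_ok_def list_all_iff)
    have "peval x (pairing (coordinates C ! i) [(J, [1])]) = ?P i (monomial J)" if "i < ?n" for i
      using peval_pairing[OF homogeneous_coordinate[OF that] J'(1), of x] by (simp add: J'(2))
    moreover have "coboundary (table_bracket x T) (?h J) = eval_form x (d_form T (apply_rows (primitives C) [(J, [1])]))"
      by (rule coboundary_form[OF table_indices apply_rows_homogeneous[OF prim]])
    moreover have "?R (coboundary (table_bracket x T) (monomial J)) = eval_form x (apply_rows (cocontraction C) (d_monomial T J))"
      by (simp add: eval_apply_rows[OF keys hom] coboundary_monomial[OF table_indices J'(3)])
    moreover have "eval_form x ([(J, pscale (- 1) (denominator C))] @
      concat (map (\<lambda>((s, A), P). form_scale (pairing P [(J, [1])]) A) (zip (classes C) (coordinates C))) @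
      d_form T (apply_rows (primitives C) [(J, [1])]) @
      apply_rows (cocontraction C) (d_monomial T J)) xs = 0"
      using id by (simp add: contraction_identity_def eval_form_zero)
    ultimately show ?thesis
      unfolding eval_form_append zip_sum
      by (simp add: g_def eval_form_Cons eval_form_Nil peval_pscale algebra_simps)
  qed
  have "g xs z = - coboundary (table_bracket x T) y xs" for xs
  proof -
    have "g xs z = g xs (\<lambda>xs. \<Sum>J\<in>set (indices q). z (map basis_vec J) * monomial J xs)"
      by (subst cochain_expansion[OF z]) (rule refl)
    also have "\<dots> = (\<Sum>J\<in>set (indices q). z (map basis_vec J) * g xs (monomial J))"
      by (rule additive_functional_sum)
        (simp_all add: g_def functional_add functional_cmul coboundary_add coboundary_cmul
          apply_rows_at_add apply_rows_at_cmul algebra_simps sum.distrib sum_distrib_left)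
    also have "\<dots> = (\<Sum>J\<in>set (indices q). - (z (map basis_vec J) * coboundary (table_bracket x T) (?h J) xs))"
      by (intro sum.cong) (auto simp: mono)
    also have "\<dots> = - coboundary (table_bracket x T) y xs"
      by (simp add: y_def coboundary_sum coboundary_cmul sum_negf)
    finally show ?thesis .
  qed
  then have "z xs - (\<Sum>i<?n. coordinate_at x C i z * class_at x C i xs) -
      cocontraction_at x C (coboundary (table_bracket x T) z) xs = 1 / ?D * coboundary (table_bracket x T) y xs" for xs
  proof -
    have D: "?D \<noteq> 0" using x by (simp add: generic_def)
    have "coordinate_at x C i z * class_at x C i xs = ?P i z * ?A i xs / ?D" if "i < ?n" for i
      using generic_scale[OF x that] by (simp add: coordinate_at_def class_at_def)
    then have "(\<Sum>i<?n. coordinate_at x C i z * class_at x C i xs) = (\<Sum>i<?n. ?P i z * ?A i xs) / ?D"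
      by (simp add: sum_divide_distrib)
    moreover have "coboundary (table_bracket x T) y xs = ?D * z xs - (\<Sum>i<?n. ?P i z * ?A i xs) - ?R (coboundary (table_bracket x T) z) xs"
      using \<open>g xs z = - coboundary (table_bracket x T) y xs\<close> by (simp add: g_def)
    ultimately show ?thesis using D by (simp add: cocontraction_at_def field_simps)
  qed
  moreover have "coboundary (table_bracket x T) y \<in> coboundaries (table_bracket x T) q"
  proof (cases q)
    case 0
    then have "primitives C = []" using C by (cases "primitives C") (auto simp: degree_ok_def)
    then have "y = (\<lambda>_. 0)" by (simp add: y_def apply_rows_def eval_form_Nil)
    then show ?thesis using coboundaries_zero by (simp add: coboundary_zero)
  next
    case (Suc r)
    have "list_all (\<lambda>(J, A). homogeneous (q - 1) A) (primitives C)"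
      using C by (auto simp: degree_ok_def list_all_iff)
    then have "y \<in> cochains r"
      unfolding y_def using Suc
      by (intro cochains_sum cochains_cmul eval_form_cochain apply_rows_homogeneous) simp
    then show ?thesis using Suc by (auto simp: coboundaries_def)
  qed
  ultimately show ?thesis using coboundaries_cmul[of "coboundary (table_bracket x T) y" "table_bracket x T" q "1 / ?D"] by simp
qed

end


lemma unimodular_if_table_ok:
  assumes T: "table_ok T" and w: "\<omega> \<in> cochains 6"
  shows "volume_coeff (coboundary (table_bracket x T) \<omega>) = 0"
proof -
  let ?d = "coboundary (table_bracket x T)"
  have T': "list_all (\<lambda>(i, j, k, c). 1 \<le> k \<and> k \<le> 7) T" using T by (simp add: table_ok_def)
  have mon: "volume_coeff (?d (monomial J)) = 0" if J: "J \<in> set (indices 6)" for J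
    using T J by (simp add: coboundary_monomial[OF T' indicesD(3)[OF J]] eval_form_zero
        table_ok_def list_all_iff volume_coeff_def)
  have "volume_coeff (?d \<omega>) =
      volume_coeff (?d (\<lambda>xs. \<Sum>J\<in>set (indices 6). \<omega> (map basis_vec J) * monomial J xs))"
    by (subst cochain_expansion[OF w]) (rule refl)
  also have "\<dots> = (\<Sum>J\<in>set (indices 6). \<omega> (map basis_vec J) * volume_coeff (?d (monomial J)))"
    by (rule additive_functional_sum[where f = "\<lambda>z. volume_coeff (?d z)"])
      (simp_all add: coboundary_add coboundary_cmul volume_coeff_add volume_coeff_cmul)
  also have "\<dots> = 0" using mon by simp
  finally show ?thesis .
qed

lemma low_degree_contraction_at:
  assumes T: "table_ok T" and lie: "lie_algebra (table_bracket x T)"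
    and C: "\<And>q. q \<le> 3 \<Longrightarrow> degree_ok T q (C q)" and x: "\<And>q. q \<le> 3 \<Longrightarrow> generic x (C q)"
  shows "low_degree_contraction (table_bracket x T) (\<lambda>q. length (classes (C q)))
    (\<lambda>q. class_at x (C q)) (\<lambda>q. coordinate_at x (C q)) (\<lambda>q. cocontraction_at x (C q))"
proof
  fix q i j c a b z
  show "coordinate_at x (C q) i (\<lambda>xs. a xs + b xs) = coordinate_at x (C q) i a + coordinate_at x (C q) i b"
    by (simp add: coordinate_at_def functional_add add_divide_distrib)
  show "coordinate_at x (C q) i (\<lambda>xs. c * a xs) = c * coordinate_at x (C q) i a"
    by (simp add: coordinate_at_def functional_cmul)
  show "cocontraction_at x (C q) (\<lambda>xs. a xs + b xs) =
      (\<lambda>xs. cocontraction_at x (C q) a xs + cocontraction_at x (C q) b xs)"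
    by (simp add: cocontraction_at_def apply_rows_at_add add_divide_distrib)
  show "cocontraction_at x (C q) (\<lambda>xs. c * a xs) = (\<lambda>xs. c * cocontraction_at x (C q) a xs)"
    by (simp add: cocontraction_at_def apply_rows_at_cmul)
  assume q: "q \<le> 3"
  note ok = T C[OF q] x[OF q]
  show "cocontraction_at x (C q) z \<in> cochains q"
    by (rule cocontraction_at_cochain[OF ok])
  show "(\<lambda>xs. z xs - (\<Sum>i<length (classes (C q)). coordinate_at x (C q) i z * class_at x (C q) i xs)
      - cocontraction_at x (C q) (coboundary (table_bracket x T) z) xs)
      \<in> coboundaries (table_bracket x T) q" if "z \<in> cochains q"
    by (rule contraction_at[OF ok that])
  assume i: "i < length (classes (C q))"
  show "class_at x (C q) i \<in> cocycles (table_bracket x T) q"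
    by (rule class_at_cocycle[OF ok i])
  show "coordinate_at x (C q) i b = 0" if "b \<in> coboundaries (table_bracket x T) q"
    by (rule coordinate_at_coboundary[OF ok i that])
  show "coordinate_at x (C q) i (class_at x (C q) j) = (if i = j then 1 else 0)"
    if "j < length (classes (C q))"
    by (rule coordinate_at_class_at[OF ok i that])
qed (use lie unimodular_if_table_ok[OF T] in auto)

lemma peval_proportional:
  assumes "proportional u v" shows "peval x u * peval y v = peval y u * peval x v"
proof (cases "pzero u")
  case False
  then obtain a b where ab: "a \<noteq> 0" "pzero (padd (pscale a u) (pscale (- b) v))"
    using assms by (auto simp: proportional_def list_ex_iff)
  then have *: "of_int a * peval z u = of_int b * peval z v" for z
    using peval_pzero[OF ab(2), of z] by (simp add: peval_padd peval_pscale)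
  have "of_int a * (peval x u * peval y v) = of_int a * (peval y u * peval x v)"
    using *[of x] *[of y] by (simp add: mult.assoc[symmetric])
  then show ?thesis using ab(1) by simp
qed (simp add: peval_pzero)

lemma wedge_class_at:
  "wedge (class_at x C i) (class_at x C' j) = (\<lambda>xs.
     peval x (fst (classes C ! i)) * (peval x (fst (classes C' ! j)) *
       eval_form x (form_product (snd (classes C ! i)) (snd (classes C' ! j))) xs))"
  by (simp add: class_at_def wedge_cmul_left wedge_cmul_right eval_form_product)

lemma coordinate_at_product:
  assumes T: "table_ok T" and C3: "degree_ok T r C3" and ok: "products_ok r C1 C2 C3"
    and x: "generic x C3" "generic y C3"
    and ijk: "i < length (classes C1)" "j < length (classes C2)" "k < length (classes C3)"
  shows "coordinate_at x C3 k (wedge (class_at x C1 i) (class_at x C2 j)) =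
    coordinate_at y C3 k (wedge (class_at y C1 i) (class_at y C2 j))"
proof -
  define A where "A = form_product (snd (classes C1 ! i)) (snd (classes C2 ! j))"
  define u where "u = pmul (fst (classes C1 ! i)) (pmul (fst (classes C2 ! j)) (pairing (coordinates C3 ! k) A))"
  define v where "v = pmul (denominator C3) (fst (classes C3 ! k))"
  have len: "length (coordinates C3) = length (classes C3)" using C3 by (simp add: degree_ok_def)
  have hom: "homogeneous r A" and ratio: "proportional u v"
    using ok ijk len
    by (auto simp: products_ok_def list_all_length case_prod_beta Let_def A_def u_def v_def)
  have P: "homogeneous r (coordinates C3 ! k)"
    using C3 ijk len by (auto simp: degree_ok_def list_all_length)
  have eq: "coordinate_at z C3 k (wedge (class_at z C1 i) (class_at z C2 j)) = peval z u / peval z v" for z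
    by (simp add: coordinate_at_def wedge_class_at functional_cmul u_def v_def peval_pmul
        peval_pairing[OF P hom] flip: A_def)
  have "peval x v \<noteq> 0" "peval y v \<noteq> 0"
    using x generic_scale ijk by (auto simp: v_def peval_pmul generic_def[of _ C3])
  then show ?thesis
    using peval_proportional[OF ratio, of x y] by (simp add: eq field_simps)
qed

lemma volume_coeff_triple:
  assumes ok: "triples_ok v C1 C2 C3"
    and ijk: "i < length (classes C1)" "j < length (classes C2)" "k < length (classes C3)"
  shows "peval y v * volume_coeff (wedge (class_at x C1 i) (wedge (class_at x C2 j) (class_at x C3 k))) =
    peval x v * volume_coeff (wedge (class_at y C1 i) (wedge (class_at y C2 j) (class_at y C3 k)))"
proof -
  let ?s = "fst (classes C1 ! i)" and ?t = "fst (classes C2 ! j)" and ?u = "fst (classes C3 ! k)"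
  define A where "A = form_product (snd (classes C1 ! i))
    (form_product (snd (classes C2 ! j)) (snd (classes C3 ! k)))"
  define w where "w = pmul ?s (pmul ?t (pmul ?u (pairing [([1..<8], [1])] A)))"
  have hom: "homogeneous 7 A" and ratio: "proportional w v"
    using ok ijk by (auto simp: triples_ok_def list_all_length case_prod_beta Let_def A_def w_def)
  have "volume_coeff (eval_form z A) = peval z (pairing [([1..<8], [1])] A)" for z
    using peval_pairing[of 7 "[([1..<8], [1])]" A z] hom upt_1_8
    by (simp add: homogeneous_def basis_index_iff functional_def volume_coeff_def)
  then have "volume_coeff (wedge (class_at z C1 i) (wedge (class_at z C2 j) (class_at z C3 k))) = peval z w" for z
    by (simp add: class_at_def wedge_cmul_left wedge_cmul_right volume_coeff_cmul w_def A_def peval_pmul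
        eval_form_product algebra_simps)
  then show ?thesis using peval_proportional[OF ratio, of x y] by (simp add: algebra_simps)
qed

lemma generic_trivial_cert: "generic x trivial_cert"
  by (simp add: generic_def trivial_cert_def)

definition certificate_ok ::
    "bracket_table \<Rightarrow> coeffs \<Rightarrow> degree_cert \<Rightarrow> degree_cert \<Rightarrow> degree_cert \<Rightarrow> bool" where
  "certificate_ok T v C1 C2 C3 \<longleftrightarrow> table_ok T \<and> degree_ok T 0 trivial_cert \<and>
     degree_ok T 1 C1 \<and> degree_ok T 2 C2 \<and> degree_ok T 3 C3 \<and>
     products_ok 2 C1 C1 C2 \<and> products_ok 3 C1 C2 C3 \<and>
     triples_ok v C1 C3 C3 \<and> triples_ok v C2 C2 C3 \<and>
     nonvanishing C1 \<and> nonvanishing C2 \<and> nonvanishing C3 \<and> \<not> pzero v"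

lemma finite_not_generic: "nonvanishing C \<Longrightarrow> finite {x. \<not> generic x C}"
proof -
  assume C: "nonvanishing C"
  have "{x. \<not> generic x C} =
      {x. peval x (denominator C) = 0} \<union> (\<Union>(s, A)\<in>set (classes C). {x. peval x s = 0})"
    by (auto simp: generic_def)
  also have "finite \<dots>"
    using C by (auto simp: nonvanishing_def list_all_iff intro!: finite_roots)
  finally show ?thesis .
qed

text \<open>The exceptional parameters are the roots of the denominators, of the scales and of \<open>v\<close>.\<close>

theorem isomorphic_if_certificate:
  assumes lie: "\<And>x. lie_algebra (table_bracket x T)"
    and ok: "certificate_ok T v C1 C2 C3"
  shows "\<exists>F. finite F \<and> (\<forall>x\<in>- F. \<forall>y\<in>- F. graded_algebra_isomorphic
    (cohomology (table_bracket x T)) (cohomology (table_bracket y T)))"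
proof -
  have T: "table_ok T" using ok by (simp add: certificate_ok_def)
  define F where "F = {x. \<not> generic x C1} \<union> {x. \<not> generic x C2} \<union> {x. \<not> generic x C3} \<union> {x. peval x v = 0}"
  define C where "C q = [trivial_cert, C1, C2, C3] ! q" for q
  have C_simps: "C 0 = trivial_cert" "C (Suc 0) = C1" "C 2 = C2" "C 3 = C3"
    by (simp_all add: C_def numeral_2_eq_2 numeral_3_eq_3)
  have le3: "q = 0 \<or> q = Suc 0 \<or> q = 2 \<or> q = 3" if "q \<le> 3" for q :: nat using that by auto
  have degree: "degree_ok T q (C q)" if "q \<le> 3" for q
    using le3[OF that] ok by (auto simp: C_simps certificate_ok_def)
  have generic: "generic x (C q)" if "x \<notin> F" "q \<le> 3" for x q
    using le3[OF that(2)] that(1) generic_trivial_cert by (auto simp: C_simps F_def)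
  have "graded_algebra_isomorphic (cohomology (table_bracket x T))
      (cohomology (table_bracket y T))" if xy: "x \<notin> F" "y \<notin> F" for x y
  proof (rule isomorphic_if_matched, intro matched_contractions.intro matched_contractions_axioms.intro)
    show "low_degree_contraction (table_bracket x T) (\<lambda>q. length (classes (C q)))
      (\<lambda>q. class_at x (C q)) (\<lambda>q. coordinate_at x (C q)) (\<lambda>q. cocontraction_at x (C q))"
      by (intro low_degree_contraction_at T lie degree generic xy)
    show "low_degree_contraction (table_bracket y T) (\<lambda>q. length (classes (C q)))
      (\<lambda>q. class_at y (C q)) (\<lambda>q. coordinate_at y (C q)) (\<lambda>q. cocontraction_at y (C q))"
      by (intro low_degree_contraction_at T lie degree generic xy)
    show "peval x v \<noteq> 0" "peval y v \<noteq> 0" using xy by (auto simp: F_def)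
    show "length (classes (C 0)) = 1" by (simp add: C_simps trivial_cert_def)
    show "class_at x (C 0) 0 = one_form" "class_at y (C 0) 0 = one_form"
      by (simp_all add: C_simps trivial_cert_def class_at_def eval_form_Cons eval_form_Nil monomial_Nil)
  next
    fix p q i j k :: nat
    assume pq: "1 \<le> p" "p \<le> q" "p + q \<le> 3" and ijk: "i < length (classes (C p))"
      "j < length (classes (C q))" "k < length (classes (C (p + q)))"
    have "p = Suc 0 \<and> (q = Suc 0 \<or> q = 2)" using pq by auto
    then have "products_ok (p + q) (C p) (C q) (C (p + q))"
      using ok by (auto simp: C_simps certificate_ok_def numeral_2_eq_2[symmetric])
    then show "coordinate_at x (C (p + q)) k (wedge (class_at x (C p) i) (class_at x (C q) j)) =
        coordinate_at y (C (p + q)) k (wedge (class_at y (C p) i) (class_at y (C q) j))"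
      by (intro coordinate_at_product[OF T degree] generic xy ijk pq)
  next
    fix p q r i j k :: nat
    assume pqr: "p \<le> q" "q \<le> r" "r \<le> 3" "p + (q + r) = 7" and ijk: "i < length (classes (C p))"
      "j < length (classes (C q))" "k < length (classes (C r))"
    have "r = 3 \<and> (p = Suc 0 \<and> q = 3 \<or> p = 2 \<and> q = 2)" using pqr by presburger
    then have "triples_ok v (C p) (C q) (C r)" using ok by (auto simp: C_simps certificate_ok_def)
    then show "peval y v * volume_coeff (wedge (class_at x (C p) i) (wedge (class_at x (C q) j) (class_at x (C r) k))) =
        peval x v * volume_coeff (wedge (class_at y (C p) i) (wedge (class_at y (C q) j) (class_at y (C r) k)))"
      by (rule volume_coeff_triple[OF _ ijk])
  qed
  moreover have "finite F"
    unfolding F_def using ok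
    by (intro finite_UnI finite_not_generic finite_roots) (simp_all add: certificate_ok_def)
  ultimately show ?thesis by (intro exI[of _ F]) auto
qed

section \<open>Certificates for the five families\<close>

fun coeff_table :: "gong_family \<Rightarrow> bracket_table" where
  "coeff_table G123457I =
     [(1,2,3,[1]), (1,3,4,[1]), (1,4,5,[1]), (1,5,6,[1]), (1,6,7,[1]),
      (2,3,5,[1]), (2,4,6,[1]), (2,5,7,[0,1]), (3,4,7,[1,-1])]"
| "coeff_table G12457N =
     [(1,2,3,[1]), (1,3,4,[1]), (1,4,7,[1]), (1,5,6,[1]), (1,6,7,[1]),
      (2,3,5,[1]), (2,4,6,[1]), (2,5,7,[0,1]), (2,6,7,[1]), (3,4,7,[1]), (3,5,7,[-1])]"
| "coeff_table G12457N2 =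
     [(1,2,3,[1]), (1,3,4,[1]), (1,4,6,[-1]), (1,5,7,[1]), (1,6,7,[1]),
      (2,3,5,[1]), (2,4,7,[1]), (2,5,6,[-1]), (2,5,7,[0,1]), (3,5,7,[-1])]"
| "coeff_table G1357M =
     [(1,2,3,[1]), (1,3,5,[1]), (1,4,6,[1]), (1,5,7,[1]),
      (2,4,5,[1]), (2,6,7,[0,1]), (3,4,7,[1,-1])]"
| "coeff_table G1357N =
     [(1,2,3,[1]), (1,3,5,[1]), (1,4,6,[1]), (1,5,7,[1]),
      (2,3,7,[0,1]), (2,4,5,[1]), (3,4,7,[1]), (4,6,7,[1])]"

lemma gong_bracket_eq: "gong_bracket f x = table_bracket x (coeff_table f)"
  by (cases f) (simp_all add: gong_bracket_def real_table_def)

text \<open>The certificates come from linear algebra over the field of rational functions in the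
  parameter. In each degree choose monomials that span a complement of the cocycles. On exact
  forms, \<open>h\<close> is the inverse of \<open>d\<close> from the complement one degree lower; it vanishes on the basis
  cocycles and on the complement. The operator \<open>k\<close> is a left inverse of \<open>d\<close> on the complement.

  Write \<open>a\<^sub>i\<close>, \<open>b\<^sub>i\<close>, \<open>c\<^sub>i\<close> for the basis classes in degrees 1, 2 and 3, in the order listed. In this
  family the nonzero products among them are \<open>a\<^sub>2 b\<^sub>3 = c\<^sub>2\<close> and \<open>b\<^sub>3\<^sup>2\<close>. The last class is chosen so that
  \<open>\<integral> b\<^sub>3\<^sup>2 c\<^sub>4 = 0\<close>, whereas \<open>\<integral> b\<^sub>3\<^sup>2 c\<^sub>3\<close> is a multiple of \<open>2\<lambda> - 1\<close>, which is absorbed into the volume form.\<close>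

definition cert_G123457I_1 :: degree_cert where
  "cert_G123457I_1 = Degree_Cert [1]
    [([1], [([1],[1])]), ([1], [([2],[1])])]
    [[([1],[1])], [([2],[1])]]
    []
    [([1,2], [([3],[-1])]), ([1,3], [([4],[-1])]), ([1,5], [([6],[-1])]),
     ([1,6], [([7],[-1])]), ([2,3], [([5],[-1])])]"

definition cert_G123457I_2 :: degree_cert where
  "cert_G123457I_2 = (let d = [3,-4,1]; e = [-3,4,-1] in
   Degree_Cert d
    [([1], [([1,4],[1])]), ([1], [([1,6],[1]), ([2,5],[1])]),
     ([1], [([1,7],[-1]), ([2,6],[1,-2]), ([3,5],[-1,1])])]
    [[([1,4],d), ([2,3],e)], [([1,6],d), ([3,4],[-3,1])], [([3,5],[-3,1])]]
    [([1,2], [([3],e)]), ([1,3], [([4],e)]), ([2,3], [([5],e)]), ([2,4], [([6],e)]),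
     ([3,4], [([7],[-3,1])])]
    [([1,2,3], [([1,5],d)]), ([1,2,4], [([2,5],e)]), ([1,2,5], [([2,6],e)]),
     ([1,2,6], [([2,7],[-2,2]), ([3,6],[-1,2,-1]), ([4,5],[1,-2,1])]), ([1,2,7], [([3,7],e)]),
     ([1,3,4], [([1,7],[3,-1]), ([2,6],[0,3,-1])]),
     ([1,3,5], [([2,7],[1,-1]), ([3,6],[-1,1]), ([4,5],[-2,3,-1])]), ([1,4,5], [([4,6],e)]),
     ([1,4,6], [([4,7],e)]), ([1,4,7], [([5,7],e)]),
     ([2,3,4], [([2,7],[1,-1]), ([3,6],[-1,1]), ([4,5],[1,-1])]),
     ([2,3,6], [([4,7],d), ([5,6],e)]), ([2,4,7], [([6,7],e)])])"

definition cert_G123457I_3 :: degree_cert where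
  "cert_G123457I_3 = (let d = [-6,26,-44,42,-22,4]; e = [6,-26,44,-42,22,-4] in
   Degree_Cert d
    [([1], [([1,4,6],[1])]), ([1], [([1,2,7],[1]), ([2,3,5],[-1,1])]),
     ([1], [([1,4,7],[1]), ([3,4,5],[0,1])]),
     ([1], [([1,4,7],[-3,5]), ([1,5,6],[-1,2]), ([2,4,6],[-1,2]), ([3,4,5],[2,-7,5])])]
    [[([1,3,7],e), ([1,4,6],d), ([2,3,6],e)], [([1,2,7],d), ([1,3,6],e), ([1,4,5],d)],
     [([1,4,7],[-6,35,-80,101,-77,32,-5]), ([2,3,7],[-3,10,-15,13,-6,1]),
        ([3,4,5],[-9,36,-59,55,-28,5])],
     [([1,4,7],[0,3,-7,8,-5,1]), ([2,3,7],[-3,7,-8,5,-1]), ([3,4,5],[-3,7,-8,5,-1])]]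
    [([1,2,3], [([1,5],d)]), ([1,2,4], [([2,5],e)]), ([1,2,5], [([2,6],e)]),
     ([1,2,6], [([2,7],[4,-16,24,-20,8]), ([3,6],[2,-10,20,-22,14,-4]),
        ([4,5],[-2,10,-20,22,-14,4])]),
     ([1,3,4], [([1,7],[-6,20,-24,18,-4]), ([2,6],[0,-6,20,-24,18,-4])]),
     ([1,3,5], [([2,7],[-2,8,-12,10,-4]), ([3,6],[2,-8,12,-10,4]),
        ([4,5],[4,-18,32,-32,18,-4])]),
     ([1,3,6], [([3,7],e)]), ([1,3,7], [([4,7],e)]), ([1,4,5], [([3,7],d), ([4,6],e)]),
     ([2,3,4], [([2,7],[-2,8,-12,10,-4]), ([3,6],[2,-8,12,-10,4]), ([4,5],[-2,8,-12,10,-4])]),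
     ([2,3,6], [([5,6],e)]), ([2,3,7], [([5,7],e)]), ([2,4,7], [([6,7],e)])]
    [([1,2,3,4], [([2,3,5],e)]), ([1,2,3,5], [([2,4,5],e)]),
     ([1,2,3,6], [([1,5,6],[-3,13,-22,21,-11,2]), ([2,4,6],[3,-13,22,-21,11,-2])]),
     ([1,2,3,7], [([1,5,7],d), ([2,5,6],[-6,32,-70,86,-64,26,-4]),
        ([3,4,6],[6,-32,70,-86,64,-26,4])]),
     ([1,2,4,5], [([1,5,6],[3,-13,22,-21,11,-2]), ([2,4,6],[3,-13,22,-21,11,-2])]),
     ([1,2,4,6], [([2,5,6],e)]),
     ([1,2,4,7], [([1,6,7],[-3,10,-9,2]), ([2,5,7],[0,0,3,-10,9,-2]),
        ([3,4,7],[3,-16,32,-30,13,-2]), ([3,5,6],[0,3,-13,19,-11,2])]),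
     ([1,2,5,6], [([1,6,7],[0,3,-10,9,-2]), ([2,5,7],[3,-10,9,-2]), ([3,4,7],[-3,13,-19,11,-2]),
        ([3,5,6],[3,-16,32,-30,13,-2])]),
     ([1,2,5,7], [([2,6,7],e)]), ([1,2,6,7], [([3,6,7],e)]),
     ([1,3,4,5], [([2,5,6],d), ([3,4,6],e)]),
     ([1,3,4,6], [([1,6,7],[3,-13,19,-11,2]), ([2,5,7],[0,-3,10,-9,2]), ([3,4,7],[3,-10,9,-2]),
        ([3,5,6],[0,0,3,-10,9,-2])]),
     ([1,3,4,7], [([2,6,7],d), ([3,5,7],e), ([4,5,6],d)]), ([1,3,5,6], [([4,5,6],e)]),
     ([1,4,5,6], [([4,5,7],e)]), ([1,4,5,7], [([4,6,7],e)]),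
     ([2,3,4,5], [([1,6,7],[3,-10,9,-2]), ([2,5,7],[3,-13,19,-11,2]), ([3,4,7],[0,3,-10,9,-2]),
        ([3,5,6],[-3,10,-9,2])]),
     ([2,3,6,7], [([5,6,7],e)])])"

lemma cert_G123457I_ok:
  "certificate_ok (coeff_table G123457I) [-1, 2] cert_G123457I_1 cert_G123457I_2 cert_G123457I_3"
  by code_simp

text \<open>Here \<open>a\<^sub>1 b\<^sub>3\<close> and \<open>a\<^sub>2 b\<^sub>3\<close> are the same constant multiple of \<open>c\<^sub>1\<close>, and all triple products vanish.\<close>

definition cert_G12457N_1 :: degree_cert where
  "cert_G12457N_1 = Degree_Cert [1]
    [([1], [([1],[1])]), ([1], [([2],[1])])]
    [[([1],[1])], [([2],[1])]]
    []
    [([1,2], [([3],[-1])]), ([1,3], [([4],[-1])]), ([2,3], [([5],[-1])]),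
     ([2,4], [([6],[-1])]), ([3,5], [([7],[1])])]"

definition cert_G12457N_2 :: degree_cert where
  "cert_G12457N_2 = Degree_Cert [1]
    [([1], [([1,4],[1])]), ([1], [([2,5],[1])]), ([1], [([1,6],[1]), ([3,4],[1])])]
    [[([1,4],[1]), ([3,5],[1])], [([2,5],[1]), ([3,5],[0,1])], [([1,6],[1]), ([3,5],[1])]]
    [([1,2], [([3],[-1])]), ([1,3], [([4],[-1])]), ([2,3], [([5],[-1])]),
     ([2,4], [([6],[-1])]), ([3,5], [([7],[1])])]
    [([1,2,3], [([1,5],[1])]), ([1,2,4], [([3,4],[-1])]), ([1,2,5], [([2,6],[-1])]),
     ([1,2,6], [([3,6],[-1]), ([4,5],[-1])]),
     ([1,2,7], [([1,7],[-1]), ([2,6],[0,-1]), ([2,7],[0,1]), ([3,4],[0,-1]), ([3,6],[-1,-1]),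
        ([3,7],[-1]), ([4,5],[-1,-2])]),
     ([1,3,4], [([1,7],[1]), ([2,6],[0,1]), ([3,6],[1]), ([4,5],[1])]),
     ([1,4,5], [([4,6],[-1])]), ([1,5,6], [([4,6],[-1]), ([5,7],[-1])]),
     ([1,5,7], [([6,7],[-1])]), ([2,3,4], [([4,5],[1])]),
     ([2,3,5], [([2,7],[-1]), ([3,4],[1]), ([3,6],[1]), ([4,5],[2])]),
     ([2,4,5], [([5,6],[1])]), ([2,4,6], [([4,7],[-1]), ([5,6],[0,-1])])]"

definition cert_G12457N_3 :: degree_cert where
  "cert_G12457N_3 = Degree_Cert [2]
    [([1], [([1,2,6],[1])]), ([1], [([1,4,6],[1])]), ([1], [([2,5,6],[1])]),
     ([1], [([1,2,7],[0,-1]), ([1,3,6],[1,-1]), ([1,3,7],[1]), ([2,3,7],[1])])]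
    [[([1,2,6],[2]), ([1,2,7],[3,3]), ([1,3,4],[-3]), ([1,3,5],[-1]), ([1,3,7],[0,3,3]),
        ([2,3,4],[-1]), ([2,3,5],[-3]), ([2,4,6],[0,-3,-3])],
     [([1,4,6],[2]), ([2,4,6],[-2]), ([2,4,7],[2])],
     [([1,5,6],[-2]), ([2,4,7],[0,2]), ([2,5,6],[2])], [([1,3,7],[2]), ([2,4,6],[-2])]]
    [([1,2,3], [([1,5],[2])]), ([1,2,4], [([3,4],[-2])]), ([1,2,5], [([2,6],[-2])]),
     ([1,2,7], [([1,7],[-2]), ([2,6],[0,-2]), ([2,7],[0,2]), ([3,4],[0,-2]), ([3,6],[1,1]),
        ([3,7],[-2]), ([4,5],[1,-1])]),
     ([1,3,4], [([1,7],[2]), ([2,6],[0,2]), ([3,6],[-1]), ([4,5],[-1])]),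
     ([1,3,5], [([3,6],[-1]), ([4,5],[-1])]),
     ([1,3,7], [([1,7],[0,-2]), ([2,6],[0,0,-2]), ([2,7],[0,0,2]), ([3,4],[0,0,-2]),
        ([3,6],[0,1,1]), ([3,7],[0,-2]), ([4,5],[0,1,-1])]),
     ([1,4,5], [([4,6],[-2])]), ([1,5,6], [([4,6],[-2]), ([5,7],[-2])]),
     ([2,3,4], [([3,6],[-1]), ([4,5],[1])]),
     ([2,3,5], [([2,7],[-2]), ([3,4],[2]), ([3,6],[-1]), ([4,5],[1])]),
     ([2,4,5], [([5,6],[2])]),
     ([2,4,6], [([1,7],[0,2]), ([2,6],[0,0,2]), ([2,7],[0,0,-2]), ([3,4],[0,0,2]),
        ([3,6],[0,-1,-1]), ([3,7],[0,2]), ([4,5],[0,-1,1]), ([4,7],[-2]), ([5,6],[0,-2])]),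
     ([2,4,7], [([6,7],[-2])])]
    [([1,2,3,4], [([1,3,6],[2])]), ([1,2,3,5], [([2,3,6],[-2])]),
     ([1,2,3,6], [([1,3,6],[-2]), ([2,3,7],[-2])]),
     ([1,2,3,7], [([1,4,7],[-1]), ([1,5,7],[2]), ([2,5,7],[1]), ([3,4,5],[1,-1]), ([3,4,6],[-1]),
        ([3,5,6],[1])]),
     ([1,2,4,5], [([3,4,5],[-2])]),
     ([1,2,4,6], [([1,4,7],[1]), ([3,4,5],[0,1]), ([3,4,6],[-1])]),
     ([1,2,4,7], [([1,6,7],[1]), ([2,6,7],[1]), ([3,4,6],[1]), ([3,4,7],[-1]), ([3,5,6],[0,-1]),
        ([3,5,7],[1])]),
     ([1,2,5,6], [([2,5,7],[-1]), ([3,4,5],[-1]), ([3,5,6],[-1])]),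
     ([1,2,6,7], [([1,4,7],[0,-1]), ([1,6,7],[-1]), ([2,5,7],[0,1]), ([2,6,7],[0,1]),
        ([3,4,5],[0,1,-1]), ([3,4,7],[-1]), ([3,5,7],[0,-1]), ([3,6,7],[-2]), ([4,5,6],[-1,1]),
        ([4,5,7],[2])]),
     ([1,3,4,5], [([1,4,7],[-1]), ([3,4,5],[0,-1]), ([3,4,6],[-1])]),
     ([1,3,4,6], [([1,6,7],[-1]), ([2,5,7],[0,1]), ([3,4,5],[0,1]), ([3,4,7],[-1]),
        ([4,5,6],[-1])]),
     ([1,3,5,6], [([2,6,7],[-1]), ([3,4,6],[-1]), ([3,5,7],[-1]), ([4,5,6],[-1])]),
     ([1,3,5,7], [([4,5,7],[-2])]), ([1,4,5,7], [([4,6,7],[-2])]),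
     ([2,3,4,5], [([2,5,7],[-1]), ([3,4,5],[-1]), ([3,5,6],[1])]),
     ([2,3,4,6], [([2,6,7],[-1]), ([3,4,6],[-1]), ([3,5,7],[-1]), ([4,5,6],[1])]),
     ([2,3,5,6], [([1,4,7],[-1]), ([2,6,7],[1]), ([3,4,5],[0,-1]), ([3,5,7],[-1]),
        ([4,5,6],[1])]),
     ([2,4,5,7], [([5,6,7],[2])])]"

lemma cert_G12457N_ok:
  "certificate_ok (coeff_table G12457N) [1] cert_G12457N_1 cert_G12457N_2 cert_G12457N_3"
  by code_simp

text \<open>The only nonzero product is \<open>a\<^sub>1 b\<^sub>3 = 3 c\<^sub>1\<close>, and all triple products vanish.\<close>

definition cert_G12457N2_1 :: degree_cert where
  "cert_G12457N2_1 = Degree_Cert [1]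
    [([1], [([1],[1])]), ([1], [([2],[1])])]
    [[([1],[1])], [([2],[1])]]
    []
    [([1,2], [([3],[-1])]), ([1,3], [([4],[-1])]), ([1,4], [([6],[1])]), ([2,3], [([5],[-1])]),
     ([2,4], [([7],[-1])])]"

definition cert_G12457N2_2 :: degree_cert where
  "cert_G12457N2_2 = Degree_Cert [1]
    [([1], [([1,4],[1])]), ([1], [([1,5],[1]), ([2,4],[1])]), ([1], [([2,6],[1]), ([3,4],[1])])]
    [[([1,4],[1]), ([1,6],[0,1]), ([2,5],[-1])], [([1,5],[1]), ([1,6],[-1])], [([3,4],[1])]]
    [([1,2], [([3],[-1])]), ([1,3], [([4],[-1])]), ([1,6], [([6],[0,-1]), ([7],[-1])]),
     ([2,3], [([5],[-1])]), ([2,5], [([6],[1])])]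
    [([1,2,3], [([2,4],[-1])]), ([1,2,4], [([2,6],[1])]), ([1,2,5], [([3,5],[-1])]),
     ([1,2,6], [([2,7],[-1]), ([3,5],[1])]),
     ([1,2,7], [([1,7],[2]), ([2,6],[-2]), ([3,5],[0,2]), ([3,7],[-1]), ([4,5],[-1]),
        ([4,6],[1])]),
     ([1,3,4], [([2,7],[-1]), ([3,5],[1]), ([3,6],[1])]),
     ([1,3,5], [([1,7],[-1]), ([2,6],[1]), ([3,5],[0,-1])]), ([1,3,6], [([4,6],[-1])]),
     ([1,4,6], [([4,7],[-1])]), ([1,4,7], [([5,7],[1]), ([6,7],[1])]),
     ([1,5,6], [([5,7],[-1])]),
     ([2,3,4], [([1,7],[-1]), ([2,6],[1]), ([3,5],[0,-1]), ([4,5],[1])]),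
     ([2,3,6], [([5,6],[-1])])]"

definition cert_G12457N2_3 :: degree_cert where
  "cert_G12457N2_3 = Degree_Cert [2]
    [([1], [([1,2,6],[1])]), ([1], [([1,5,6],[1]), ([2,4,6],[1])]),
     ([1], [([1,4,6],[-1]), ([2,5,6],[1])]), ([1], [([1,4,6],[-1]), ([3,4,5],[1])])]
    [[([1,2,6],[2]), ([1,2,7],[0,2]), ([1,3,4],[4]), ([2,3,5],[-2])],
     [([2,4,6],[2]), ([3,5,6],[2])], [([2,5,6],[2]), ([3,5,6],[0,2])],
     [([1,3,7],[2]), ([3,4,5],[2])]]
    [([1,2,3], [([2,4],[-2])]), ([1,2,4], [([2,6],[2])]), ([1,2,5], [([3,5],[-2])]),
     ([1,2,7], [([1,7],[4]), ([2,6],[-4]), ([2,7],[0,2]), ([3,5],[0,2]), ([3,7],[-2]),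
        ([4,5],[-2]), ([4,6],[2])]),
     ([1,3,4], [([2,7],[2]), ([3,5],[-2]), ([3,6],[2])]),
     ([1,3,5], [([1,7],[-2]), ([2,6],[2]), ([3,5],[0,-2])]), ([1,3,6], [([4,6],[-2])]),
     ([1,3,7], [([4,7],[-2]), ([5,6],[2])]), ([1,4,5], [([5,6],[-2])]),
     ([1,5,6], [([5,7],[-2])]),
     ([2,3,4], [([1,7],[-2]), ([2,6],[2]), ([3,5],[0,-2]), ([4,5],[2])]),
     ([2,3,5], [([2,7],[-2]), ([3,5],[2])]), ([2,4,6], [([5,7],[2])]),
     ([3,5,6], [([6,7],[-2])])]
    [([1,2,3,4], [([2,3,6],[2])]), ([1,2,3,5], [([2,4,5],[-2])]),
     ([1,2,3,6], [([2,3,7],[-2]), ([2,4,5],[2])]),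
     ([1,2,3,7], [([1,4,6],[-2]), ([1,5,7],[2])]), ([1,2,4,5], [([1,4,6],[-2])]),
     ([1,2,4,6], [([1,4,6],[2]), ([1,5,7],[-1]), ([2,4,7],[-1]), ([3,4,6],[-1])]),
     ([1,2,5,6], [([2,5,7],[-2])]),
     ([1,2,5,7], [([1,6,7],[-1]), ([2,5,7],[0,1]), ([3,4,6],[1]), ([3,5,7],[-1])]),
     ([1,3,4,5], [([1,4,6],[0,-2]), ([1,4,7],[-2])]),
     ([1,3,4,6], [([1,4,7],[2]), ([1,5,7],[0,1]), ([2,4,7],[0,1]), ([3,4,6],[0,-1]),
        ([3,4,7],[-2])]),
     ([1,3,4,7], [([1,4,6],[-4]), ([1,5,7],[2]), ([1,6,7],[-2]), ([2,4,7],[2]), ([2,6,7],[0,-2]),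
        ([3,5,7],[2]), ([3,6,7],[2]), ([4,5,6],[-2])]),
     ([1,3,5,6], [([1,4,6],[2]), ([1,5,7],[-1]), ([1,6,7],[1]), ([2,4,7],[-1]), ([2,5,7],[0,-1]),
        ([3,5,7],[-1])]),
     ([2,3,4,5], [([1,4,6],[2]), ([1,5,7],[-1]), ([2,4,7],[-1]), ([3,4,6],[1])]),
     ([2,3,4,6], [([1,4,6],[2]), ([1,5,7],[-1]), ([1,6,7],[1]), ([2,4,7],[-1]), ([2,5,7],[0,-1]),
        ([3,5,7],[-1]), ([4,5,6],[2])]),
     ([2,3,4,7], [([4,5,7],[2])]), ([2,3,5,6], [([2,5,7],[2]), ([2,6,7],[2])]),
     ([2,3,6,7], [([5,6,7],[-2])]), ([2,4,5,7], [([4,6,7],[2])])]"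

lemma cert_G12457N2_ok:
  "certificate_ok (coeff_table G12457N2) [1] cert_G12457N2_1 cert_G12457N2_2 cert_G12457N2_3"
  by code_simp

text \<open>The classes \<open>c\<^sub>1\<close>, \<open>c\<^sub>5\<close> and \<open>c\<^sub>6\<close> are, up to scale, \<open>a\<^sub>2 b\<^sub>4\<close>, \<open>a\<^sub>3 b\<^sub>6\<close> and \<open>a\<^sub>2 b\<^sub>6\<close>, and \<open>c\<^sub>4\<close> is chosen so
  that \<open>\<integral> b\<^sub>6\<^sup>2 c\<^sub>4 = 0\<close>. Then every product of two basis classes that lies in degree at most 3 is a
  multiple of a single basis class, every \<open>b\<^sub>i b\<^sub>j\<close> pairs nontrivially with at most one \<open>c\<^sub>k\<close>, and the
  scales solve the multiplicative equations which say that all these constants are independent of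
  the parameter.\<close>

definition cert_G1357M_1 :: degree_cert where
  "cert_G1357M_1 = Degree_Cert [1]
    [([2,-5,3], [([1],[1])]), ([0,2,-5,3], [([2],[1])]), ([1], [([4],[1])])]
    [[([1],[1])], [([2],[1])], [([4],[1])]]
    []
    [([1,2], [([3],[-1])]), ([1,4], [([6],[-1])]), ([1,5], [([7],[-1])]), ([2,4], [([5],[-1])])]"

definition cert_G1357M_2 :: degree_cert where
  "cert_G1357M_2 = (let d = [2,-3,1]; e = [-2,3,-1] in
   Degree_Cert d
    [([0,2,-5,3], [([1,3],[1])]), ([0,2,-5,3], [([1,6],[1])]), ([0,-1,3,-2], [([2,3],[1])]),
     ([0,1], [([4,6],[1])]), ([0,0,2,-3], [([1,5],[1]), ([2,6],[1])]),
     ([1], [([1,7],[1]), ([3,6],[0,1]), ([4,5],[-1,2])])]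
    [[([1,3],d), ([2,4],e)], [([1,6],d)], [([2,3],d)], [([4,6],d)],
     [([1,5],d), ([3,4],[-2,1])], [([1,7],d)]]
    [([1,2], [([3],e)]), ([1,4], [([6],e)]), ([2,4], [([5],e)]), ([3,4], [([7],[-2,1])])]
    [([1,2,3], [([2,5],e)]), ([1,2,4], [([2,6],e)]),
     ([1,2,5], [([2,7],[-1,1]), ([3,5],[-1,2,-1])]), ([1,2,6], [([3,6],e), ([4,5],e)]),
     ([1,3,4], [([4,5],d)]), ([1,3,5], [([3,7],e)]), ([1,3,6], [([4,7],e), ([5,6],e)]),
     ([1,4,5], [([4,7],e)]), ([2,3,4], [([2,7],[1,-1]), ([3,5],[-1,1])]),
     ([2,4,7], [([5,7],e)]), ([3,4,6], [([6,7],[2,-1])])])"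

definition cert_G1357M_3 :: degree_cert where
  "cert_G1357M_3 = (let d = [0,12,-42,54,-42,12]; e = [0,-12,42,-54,42,-12] in
   Degree_Cert d
    [([0,0,2,-5,3], [([2,4,6],[1])]), ([0,2,-5,3], [([1,4,6],[1])]),
     ([0,-2,9,-13,6], [([2,3,5],[1])]),
     ([1], [([1,2,7],[1]), ([1,3,5],[2,-3]), ([2,4,5],[-1,2])]),
     ([1], [([1,4,7],[1]), ([3,4,6],[0,1])]),
     ([0,2,-5,3], [([1,2,7],[-2]), ([1,3,5],[-1]), ([2,4,5],[-1,2])]),
     ([-1,2], [([2,4,7],[-1]), ([3,4,5],[1])]), ([0,1], [([1,6,7],[-1]), ([4,5,6],[-1,1])])]
    [[([1,3,6],[0,-12,30,-12,-12,30,-12]), ([1,4,5],[0,0,-12,42,-54,42,-12]), ([2,4,6],d)],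
     [([1,4,6],d)], [([2,3,5],d)],
     [([1,2,7],[0,-4,6,-6,2]), ([1,3,5],[0,8,-12,12,-4]), ([2,3,6],[-4,6,-6,2])],
     [([1,4,7],d), ([1,5,6],d)],
     [([1,2,7],[0,-8,24,-30,22,-6]), ([1,3,5],[0,4,-6,6,-2]), ([2,3,6],[4,-18,24,-20,6])],
     [([2,5,6],[12,-54,96,-96,54,-12]), ([3,4,5],d)], [([1,6,7],e)]]
    [([1,2,3], [([2,5],e)]), ([1,2,4], [([2,6],e)]),
     ([1,2,5], [([2,7],[0,-6,18,-18,12]), ([3,5],[0,-6,24,-36,30,-12])]),
     ([1,2,6], [([3,6],e), ([4,5],e)]), ([1,3,4], [([4,5],d)]),
     ([1,3,6], [([4,7],e), ([5,6],e)]), ([1,4,5], [([4,7],e)]), ([1,5,6], [([6,7],d)]),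
     ([2,3,4], [([2,7],[0,6,-18,18,-12]), ([3,5],[0,-6,18,-18,12])]),
     ([2,3,6], [([3,7],[-12,42,-54,42,-12])]), ([2,5,6], [([5,7],[-12,42,-54,42,-12])])]
    [([1,2,3,4], [([2,4,5],d)]), ([1,2,3,5], [([2,3,7],e)]),
     ([1,2,3,6], [([1,3,7],[12,-42,54,-42,12])]), ([1,2,3,7], [([2,5,7],e)]),
     ([1,2,4,5], [([2,4,7],e)]), ([1,2,4,6], [([3,4,6],e)]),
     ([1,2,4,7], [([1,5,7],[0,6,-15,6]), ([2,6,7],[0,0,0,-6,15,-6]),
        ([3,4,7],[0,-6,27,-42,27,-6]), ([3,5,6],[0,0,6,-21,21,-6])]),
     ([1,2,5,6], [([1,5,7],[0,0,6,-15,6]), ([2,6,7],[0,6,-15,6]), ([3,4,7],[0,-6,21,-21,6]),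
        ([3,5,6],[0,-6,27,-42,27,-6])]),
     ([1,2,6,7], [([3,6,7],e)]),
     ([1,3,4,5], [([1,5,7],[0,-6,21,-21,6]), ([2,6,7],[0,0,6,-15,6]), ([3,4,7],[0,-6,15,-6]),
        ([3,5,6],[0,0,0,6,-15,6])]),
     ([1,3,4,6], [([4,5,6],d)]), ([1,3,6,7], [([5,6,7],e)]), ([1,4,5,6], [([4,6,7],d)]),
     ([2,3,4,6], [([1,5,7],[0,-6,15,-6]), ([2,6,7],[0,-6,21,-21,6]), ([3,4,7],[0,0,-6,15,-6]),
        ([3,5,6],[0,-6,15,-6])]),
     ([2,3,4,7], [([3,5,7],e)]), ([2,4,5,6], [([4,5,7],[-12,42,-54,42,-12])])])"

lemma cert_G1357M_ok:
  "certificate_ok (coeff_table G1357M) [0, 0, -2, 9, -13, 6] cert_G1357M_1 cert_G1357M_2 cert_G1357M_3"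
  by code_simp

text \<open>The term \<open>(\<lambda> - 2) e\<^sub>2\<^sub>3\<close> in \<open>b\<^sub>5\<close> makes \<open>a\<^sub>3 b\<^sub>5\<close> exact; without it, this product would be
  \<open>(\<lambda> - 2) c\<^sub>1\<close>.\<close>

definition cert_G1357N_1 :: degree_cert where
  "cert_G1357N_1 = Degree_Cert [1]
    [([1], [([1],[1])]), ([1], [([2],[1])]), ([1], [([4],[1])])]
    [[([1],[1])], [([2],[1])], [([4],[1])]]
    []
    [([1,2], [([3],[-1])]), ([1,4], [([6],[-1])]), ([1,5], [([7],[-1])]), ([2,4], [([5],[-1])])]"

definition cert_G1357N_2 :: degree_cert where
  "cert_G1357N_2 = Degree_Cert [1]
    [([1], [([1,3],[1])]), ([1], [([1,6],[1])]), ([1], [([2,3],[1])]), ([1], [([4,6],[1])]),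
     ([1], [([1,5],[1]), ([2,3],[-2,1]), ([2,6],[1])])]
    [[([1,3],[1]), ([2,4],[-1])], [([1,6],[1])], [([2,3],[1]), ([2,6],[2,-1]), ([3,4],[0,-1])],
     [([3,4],[-1]), ([4,6],[1])], [([2,6],[1])]]
    [([1,2], [([3],[-1])]), ([1,4], [([6],[-1])]), ([2,4], [([5],[-1])]), ([3,4], [([7],[-1])])]
    [([1,2,3], [([2,5],[-1])]), ([1,2,4], [([1,5],[1])]), ([1,2,5], [([3,5],[-1])]),
     ([1,2,6], [([3,6],[-1]), ([4,5],[-1])]), ([1,3,4], [([4,5],[1])]),
     ([1,3,5], [([3,7],[-1])]),
     ([1,3,6], [([2,7],[-1]), ([3,5],[1]), ([4,7],[-1]), ([5,6],[-1])]),
     ([1,4,5], [([4,7],[-1])]), ([1,4,6], [([1,7],[1]), ([2,5],[0,1]), ([4,5],[-1])]),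
     ([1,5,6], [([6,7],[1])]), ([2,4,6], [([2,7],[1]), ([3,5],[-1])]),
     ([2,4,7], [([5,7],[-1])])]"

definition cert_G1357N_3 :: degree_cert where
  "cert_G1357N_3 = (let d = [-2,2]; e = [2,-2] in
   Degree_Cert d
    [([1], [([1,2,5],[1])]), ([1], [([2,3,5],[1])]), ([1], [([1,3,5],[0,1]), ([1,4,7],[1])]),
     ([1], [([1,3,5],[1]), ([2,3,6],[1])]), ([1], [([1,3,5],[-1]), ([2,4,5],[1])]),
     ([1], [([2,4,7],[-1]), ([3,4,5],[1])]),
     ([1], [([1,3,7],[1]), ([1,6,7],[-1]), ([2,4,7],[0,1]), ([2,5,6],[0,1])])]
    [[([1,2,5],d), ([1,3,6],[4,-2,-2]), ([1,4,5],[0,2,-2]), ([2,3,4],e), ([2,4,6],[-4,4])],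
     [([2,3,5],d), ([4,5,6],[0,-2,2])], [([1,2,7],d), ([1,4,7],d), ([3,4,6],d)],
     [([1,2,7],[0,2,-2]), ([2,3,6],d), ([3,4,6],[0,2,-2])], [([2,4,5],d)],
     [([1,6,7],[0,2,-2]), ([2,4,7],e), ([4,5,6],d)], [([1,6,7],e)]]
    [([1,2,3], [([2,5],e)]), ([1,2,4], [([1,5],d)]), ([1,2,6], [([3,6],e), ([4,5],e)]),
     ([1,2,7], [([3,7],e), ([6,7],d)]), ([1,3,4], [([4,5],d)]),
     ([1,3,6], [([2,7],e), ([3,5],[2,0,-2]), ([4,7],e), ([5,6],e)]),
     ([1,4,5], [([3,5],[0,2,-2]), ([4,7],e)]),
     ([1,4,6], [([1,7],d), ([2,5],[0,-2,2]), ([4,5],e)]), ([2,3,4], [([3,5],e)]),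
     ([2,4,6], [([2,7],d), ([3,5],d)]), ([3,4,6], [([6,7],d)]), ([4,5,6], [([5,7],e)])]
    [([1,2,3,4], [([1,3,5],d)]),
     ([1,2,3,5], [([1,5,7],[-1]), ([2,3,7],[2,-1]), ([2,6,7],[-1]), ([3,5,6],[-1]),
        ([4,6,7],[1])]),
     ([1,2,3,6], [([2,5,6],e), ([3,4,5],e)]), ([1,2,3,7], [([2,5,7],e)]),
     ([1,2,4,5], [([3,4,5],e)]), ([1,2,4,6], [([1,5,6],d)]),
     ([1,2,4,7], [([1,5,7],[-1]), ([2,3,7],[0,1]), ([2,6,7],[0,-1]), ([3,4,7],[1,-1]),
        ([3,5,6],[0,-1]), ([4,6,7],[1])]),
     ([1,2,5,6], [([2,6,7],[-1,1]), ([3,4,7],[1,-1]), ([3,5,6],[1,-1])]),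
     ([1,2,5,7], [([3,5,7],e)]), ([1,2,6,7], [([3,6,7],e), ([4,5,7],e)]),
     ([1,3,4,5], [([1,5,7],[1]), ([2,3,7],[0,-1]), ([2,6,7],[0,1]), ([3,4,7],[1,-1]),
        ([3,5,6],[0,1]), ([4,6,7],[-1])]),
     ([1,3,4,6], [([1,3,7],e)]), ([1,3,4,7], [([4,5,7],d)]), ([1,3,6,7], [([5,6,7],e)]),
     ([1,4,5,6], [([1,5,7],[0,1]), ([2,3,7],[0,0,-1]), ([2,6,7],[0,1]), ([3,5,6],[0,1]),
        ([4,6,7],[-2,1])]),
     ([2,3,4,6], [([1,5,7],[1]), ([2,3,7],[0,-1]), ([2,6,7],[1]), ([3,5,6],[1]), ([4,6,7],[-1])])])"

lemma cert_G1357N_ok: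
  "certificate_ok (coeff_table G1357N) [1] cert_G1357N_1 cert_G1357N_2 cert_G1357N_3"
  by code_simp

theorem proposition5p1:
  fixes f :: gong_family
  shows "\<exists>F :: real set. finite F \<and>
    (\<forall>l \<in> parameters f - F. \<forall>l' \<in> parameters f - F.
      graded_algebra_isomorphic (cohomology (gong_bracket f l)) (cohomology (gong_bracket f l')))"
proof -
  have lie: "lie_algebra (table_bracket x (coeff_table f))" for x
    using lie_algebra_gong_bracket[of f x] by (simp only: gong_bracket_eq)
  have "\<exists>F. finite F \<and> (\<forall>x\<in>- F. \<forall>y\<in>- F. graded_algebra_isomorphic
      (cohomology (table_bracket x (coeff_table f)))
      (cohomology (table_bracket y (coeff_table f))))"
  proof (cases f)
    case G123457I
    from isomorphic_if_certificate[OF lie[unfolded G123457I] cert_G123457I_ok] show ?thesis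
      by (simp only: G123457I)
  next
    case G12457N
    from isomorphic_if_certificate[OF lie[unfolded G12457N] cert_G12457N_ok] show ?thesis
      by (simp only: G12457N)
  next
    case G12457N2
    from isomorphic_if_certificate[OF lie[unfolded G12457N2] cert_G12457N2_ok] show ?thesis
      by (simp only: G12457N2)
  next
    case G1357M
    from isomorphic_if_certificate[OF lie[unfolded G1357M] cert_G1357M_ok] show ?thesis
      by (simp only: G1357M)
  next
    case G1357N
    from isomorphic_if_certificate[OF lie[unfolded G1357N] cert_G1357N_ok] show ?thesis
      by (simp only: G1357N)
  qed
  then show ?thesis unfolding gong_bracket_eq by auto
qed

end
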